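(* Let $\mathfrak g$ be a quadratic Lie algebra and let $(M,\rho,\pi)$ be a quasi-Poisson $\mathfrak g$-manifold. Then $T^*M$ becomes a Lie algebroid, where the Lie algebroid differential $d_{T^*M}$ on $\mathbf\Gamma(\wedge^*TM)$ is $$d_{T^*M}=[\pi,\cdot]+\frac12\sum_i\rho(e^i)\wedge[\rho(e_i),\cdot].$$ Furthermore, the induced action of $\mathfrak g$ on $T^*M$ preserves the Lie algebroid structure. Moreover, let $\mathrm{pr}_{\mathfrak g}:M\times\mathfrak g\to\mathfrak g$ be the projection to the second factor and $\rho^*:T^*M\to M\times\mathfrak g^*\cong M\times\mathfrak g$ the transpose of $\rho$. Then $\mu_\rho:=\mathrm{pr}_{\mathfrak g}\circ\rho^*:T^*M\to\mathfrak g$ is a Lie algebroid morphism.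
   Context: $\mathfrak g$ is a finite-dimensional real Lie algebra with an ad-invariant non-degenerate symmetric bilinear form $\langle\cdot,\cdot\rangle$ (a quadratic Lie algebra), used to identify $\mathfrak g\cong\mathfrak g^*$; $\{e_i\},\{e^i\}$ are bases of $\mathfrak g$ dual with respect to $\langle\cdot,\cdot\rangle$. The element $\phi\in\wedge^3\mathfrak g$ is given by $\phi(\alpha,\beta,\gamma)=\frac12\langle\alpha,[\beta,\gamma]\rangle$ for $\alpha,\beta,\gamma\in\mathfrak g^*\cong\mathfrak g$. A quasi-Poisson $\mathfrak g$-manifold is a triple $(M,\rho,\pi)$ where $M$ is a manifold with a Lie algebra action of $\mathfrak g$ whose anchor is $\rho:M\times\mathfrak g\to TM$ (extended to $\wedge\mathfrak g\to\wedge TM$), and $\pi\in\mathbf\Gamma(\wedge^2TM)$ is a bivector field with $[\pi,\pi]=\rho(\phi)$ and $[\pi,\rho(\xi)]=0$ for all $\xi\in\mathfrak g$. Brackets are Schouten brackets of multivector fields, with $[X,f]=X(f)$, $[P,Q]=-(-1)^{(p-1)(q-1)}[Q,P]$, $[P,Q\wedge R]=[P,Q]\wedge R+(-1)^{(p-1)q}Q\wedge[P,R]$. A Lie algebroid structure on a vector bundle $B\to M$ is equivalent to a degree $+1$ derivation of square zero (differential) on $\mathbf\Gamma(\wedge B^* )$; here $B=T^*M$, $B^*=TM$. The induced $\mathfrak g$-action on $T^*M$ is the natural (Lie derivative) lift of the action on $M$. The Lie algebra $\mathfrak g$ is regarded as a Lie algebroid over a point. *)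

theory Defs
  imports "HOL-Analysis.Analysis" "HOL-Library.Function_Algebras"
begin

text \<open>Functions into a real vector space form a real vector space, pointwise.\<close>

instantiation "fun" :: (type, real_vector) real_vector
begin

definition scaleR_fun :: "real \<Rightarrow> ('a \<Rightarrow> 'b) \<Rightarrow> 'a \<Rightarrow> 'b" where
  "scaleR_fun c f = (\<lambda>x. c *\<^sub>R f x)"

instance
  by standard (auto simp: scaleR_fun_def fun_eq_iff algebra_simps)

end


section \<open>Alternating forms\<close>

text \<open>Forms of degree \<open>k\<close> on a subspace \<open>V\<close> are functions on lists. They vanish on every list which
  is not a \<open>k\<close>-tuple of elements of \<open>V\<close>, so that equality of forms is equality of functions.\<close>

definition alt_forms :: "'v::real_vector set \<Rightarrow> nat \<Rightarrow> ('v list \<Rightarrow> real) set" where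
  "alt_forms V k = {w.
     (\<forall>vs. w vs \<noteq> 0 \<longrightarrow> length vs = k \<and> set vs \<subseteq> V) \<and>
     (\<forall>vs i a b u v. length vs = k \<longrightarrow> set vs \<subseteq> V \<longrightarrow> i < k \<longrightarrow> u \<in> V \<longrightarrow> v \<in> V \<longrightarrow>
        w (vs[i := a *\<^sub>R u + b *\<^sub>R v]) = a * w (vs[i := u]) + b * w (vs[i := v])) \<and>
     (\<forall>vs. \<not> distinct vs \<longrightarrow> w vs = 0)}"

text \<open>Sign of the permutation of \<open>{..<n}\<close> that lists \<open>I\<close> increasingly, followed by its complement
  increasingly.\<close>

definition shuffle_sign :: "nat \<Rightarrow> nat set \<Rightarrow> real" where
  "shuffle_sign n I = (-1) ^ card {(i, j). i \<in> I \<and> j \<in> {..<n} - I \<and> j < i}"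

text \<open>The wedge product, normalized by \<open>(a \<and> b)(u, v) = a u * b v - a v * b u\<close>. If \<open>w\<close> has degree
  \<open>k\<close> then only the sets \<open>I\<close> with \<open>k\<close> elements, i.e. the shuffles, contribute.\<close>

definition wedge :: "('v list \<Rightarrow> real) \<Rightarrow> ('v list \<Rightarrow> real) \<Rightarrow> 'v list \<Rightarrow> real" where
  "wedge w z vs = (\<Sum>I\<in>Pow {..<length vs}.
     shuffle_sign (length vs) I * w (nths vs I) * z (nths vs (- I)))"


section \<open>Smooth manifolds\<close>

text \<open>\<open>C\<^sup>k\<close> on an open set: all iterated directional derivatives up to order \<open>k\<close> exist and are
  continuous.\<close>

primrec ck_on :: "nat \<Rightarrow> 'b::real_normed_vector set \<Rightarrow> ('b \<Rightarrow> 'c::real_normed_vector) \<Rightarrow> bool" where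
  "ck_on 0 S f \<longleftrightarrow> continuous_on S f"
| "ck_on (Suc k) S f \<longleftrightarrow>
     f differentiable_on S \<and> (\<forall>v. ck_on k S (\<lambda>x. frechet_derivative f (at x) v))"

definition smooth_on :: "'b::real_normed_vector set \<Rightarrow> ('b \<Rightarrow> 'c::real_normed_vector) \<Rightarrow> bool" where
  "smooth_on S f \<longleftrightarrow> (\<forall>k. ck_on k S f)"

definition finite_dimensional :: "'v::real_vector itself \<Rightarrow> bool" where
  "finite_dimensional _ \<longleftrightarrow> (\<exists>S::'v set. finite S \<and> span S = UNIV)"

text \<open>The manifold is the whole type \<open>'a\<close> with a smooth atlas. The model space is a
  finite-dimensional normed space (rather than of class \<open>euclidean_space\<close>) in order to include
  dimension 0.\<close>

type_synonym ('a, 'b) chart = "'a set \<times> ('a \<Rightarrow> 'b)"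

definition smooth_manifold ::
  "('a::{t2_space, second_countable_topology}, 'b::real_normed_vector) chart set \<Rightarrow> bool" where
  "smooth_manifold A \<longleftrightarrow>
     finite_dimensional TYPE('b) \<and>
     (\<Union>(U, x)\<in>A. U) = UNIV \<and>
     (\<forall>(U, x)\<in>A. open U \<and> open (x ` U) \<and> homeomorphism U (x ` U) x (inv_into U x)) \<and>
     (\<forall>(U, x)\<in>A. \<forall>(V, y)\<in>A. smooth_on (x ` (U \<inter> V)) (y \<circ> inv_into U x))"

definition smooth_functions :: "('a, 'b::real_normed_vector) chart set \<Rightarrow> ('a \<Rightarrow> real) set" where
  "smooth_functions A = {f. \<forall>(U, x)\<in>A. smooth_on (x ` U) (f \<circ> inv_into U x)}"

text \<open>Tangent vectors at \<open>p\<close> are the derivations at \<open>p\<close> of the algebra of smooth functions (set to 0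
  on all other functions). The cotangent space at \<open>p\<close> is the space of differentials at \<open>p\<close> of smooth
  functions.\<close>

type_synonym 'a tangent = "('a \<Rightarrow> real) \<Rightarrow> real"
type_synonym 'a cotangent = "'a tangent \<Rightarrow> real"

definition tangent_space :: "('a, 'b::real_normed_vector) chart set \<Rightarrow> 'a \<Rightarrow> 'a tangent set" where
  "tangent_space A p = {v.
     (\<forall>f\<in>smooth_functions A. \<forall>g\<in>smooth_functions A. \<forall>a b.
        v (a *\<^sub>R f + b *\<^sub>R g) = a * v f + b * v g) \<and>
     (\<forall>f\<in>smooth_functions A. \<forall>g\<in>smooth_functions A. v (f * g) = v f * g p + f p * v g) \<and>
     (\<forall>f. f \<notin> smooth_functions A \<longrightarrow> v f = 0)}"

definition differential ::
  "('a, 'b::real_normed_vector) chart set \<Rightarrow> 'a \<Rightarrow> ('a \<Rightarrow> real) \<Rightarrow> 'a cotangent" where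
  "differential A p f = (\<lambda>v. if v \<in> tangent_space A p then v f else 0)"

definition cotangent_space :: "('a, 'b::real_normed_vector) chart set \<Rightarrow> 'a \<Rightarrow> 'a cotangent set" where
  "cotangent_space A p = differential A p ` smooth_functions A"


section \<open>Multivector fields\<close>

text \<open>The \<open>k\<close>-th exterior power of the tangent space at \<open>p\<close> is the space of alternating \<open>k\<close>-forms on
  the cotangent space. A section is smooth if it is smooth when evaluated on differentials of smooth
  functions.\<close>

type_synonym 'a mvfield = "'a \<Rightarrow> 'a cotangent list \<Rightarrow> real"

definition mv_eval ::
  "('a, 'b::real_normed_vector) chart set \<Rightarrow> 'a mvfield \<Rightarrow> ('a \<Rightarrow> real) list \<Rightarrow> 'a \<Rightarrow> real" where
  "mv_eval A P fs = (\<lambda>p. P p (map (differential A p) fs))"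

definition mv_fields :: "('a, 'b::real_normed_vector) chart set \<Rightarrow> nat \<Rightarrow> 'a mvfield set" where
  "mv_fields A k = {P.
     (\<forall>p. P p \<in> alt_forms (cotangent_space A p) k) \<and>
     (\<forall>fs. length fs = k \<and> set fs \<subseteq> smooth_functions A \<longrightarrow> mv_eval A P fs \<in> smooth_functions A)}"

definition mv_wedge :: "'a mvfield \<Rightarrow> 'a mvfield \<Rightarrow> 'a mvfield" where
  "mv_wedge P Q = (\<lambda>p. wedge (P p) (Q p))"

definition vector_field :: "('a, 'b::real_normed_vector) chart set \<Rightarrow> ('a \<Rightarrow> 'a tangent) \<Rightarrow> 'a mvfield"
  where
  "vector_field A X = (\<lambda>p as. if length as = 1 \<and> set as \<subseteq> cotangent_space A p
     then hd as (X p) else 0)"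

text \<open>The multivector field with prescribed values \<open>F fs\<close> on the differentials of \<open>fs\<close>. When \<open>F\<close> is a
  derivation in each argument, \<open>F fs p\<close> depends on \<open>fs\<close> through the differentials at \<open>p\<close> only, and
  the choice of representatives is irrelevant.\<close>

definition mv_of :: "('a, 'b::real_normed_vector) chart set \<Rightarrow>
    (('a \<Rightarrow> real) list \<Rightarrow> 'a \<Rightarrow> real) \<Rightarrow> 'a mvfield" where
  "mv_of A F = (\<lambda>p as. if set as \<subseteq> cotangent_space A p
     then F (map (\<lambda>a. SOME f. f \<in> smooth_functions A \<and> differential A p f = a) as) p
     else 0)"

text \<open>The Schouten bracket of \<open>P\<close>, of degree \<open>p\<close>, and \<open>Q\<close>, of degree \<open>q\<close>, as graded commutator of
  multiderivations. In \<open>mv_insert A P Q\<close> only the sets \<open>I\<close> with \<open>p - 1\<close> elements contribute. The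
  bracket satisfies \<open>[X, f] = X f\<close>, \<open>[X, Y] f = X (Y f) - Y (X f)\<close>,
  \<open>[P, Q] = - (-1)\<^bsup>(p-1)(q-1)\<^esup> [Q, P]\<close> and
  \<open>[P, Q \<and> R] = [P, Q] \<and> R + (-1)\<^bsup>(p-1)q\<^esup> Q \<and> [P, R]\<close>.
  The exponent \<open>(p + 1) * (q + 1)\<close> has the parity of \<open>(p - 1) * (q - 1)\<close>, but avoids truncated
  subtraction.\<close>

definition mv_insert :: "('a, 'b::real_normed_vector) chart set \<Rightarrow> 'a mvfield \<Rightarrow> 'a mvfield \<Rightarrow>
    ('a \<Rightarrow> real) list \<Rightarrow> 'a \<Rightarrow> real" where
  "mv_insert A P Q fs = (\<Sum>I\<in>Pow {..<length fs}.
     shuffle_sign (length fs) I *\<^sub>R mv_eval A P (nths fs I @ [mv_eval A Q (nths fs (- I))]))"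

definition schouten :: "('a, 'b::real_normed_vector) chart set \<Rightarrow> nat \<Rightarrow> nat \<Rightarrow>
    'a mvfield \<Rightarrow> 'a mvfield \<Rightarrow> 'a mvfield" where
  "schouten A p q P Q =
     mv_of A (\<lambda>fs. mv_insert A P Q fs - ((-1) ^ ((p + 1) * (q + 1))) *\<^sub>R mv_insert A Q P fs)"

text \<open>The action of a vector field \<open>X\<close> on multivector fields that is dual to its natural lift to the
  cotangent bundle, the Lie derivative. The latter maps the differential of \<open>f\<close> to that of \<open>X f\<close>.\<close>

definition lie_derivative ::
  "('a, 'b::real_normed_vector) chart set \<Rightarrow> ('a \<Rightarrow> 'a tangent) \<Rightarrow> 'a mvfield \<Rightarrow> 'a mvfield" where
  "lie_derivative A X P = mv_of A (\<lambda>fs p.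
     X p (mv_eval A P fs) - (\<Sum>i<length fs. mv_eval A P (fs[i := (\<lambda>q. X q (fs ! i))]) p))"


section \<open>Quadratic Lie algebras\<close>

definition quadratic_lie_algebra ::
  "('g::real_vector \<Rightarrow> 'g \<Rightarrow> 'g) \<Rightarrow> ('g \<Rightarrow> 'g \<Rightarrow> real) \<Rightarrow> bool" where
  "quadratic_lie_algebra br ip \<longleftrightarrow>
     finite_dimensional TYPE('g) \<and>
     bilinear br \<and> (\<forall>x. br x x = 0) \<and>
     (\<forall>x y z. br x (br y z) + br y (br z x) + br z (br x y) = 0) \<and>
     bilinear ip \<and> (\<forall>x y. ip x y = ip y x) \<and>
     (\<forall>x. (\<forall>y. ip x y = 0) \<longrightarrow> x = 0) \<and>
     (\<forall>x y z. ip (br x y) z + ip y (br x z) = 0)"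

definition dual_bases ::
  "('g::real_vector \<Rightarrow> 'g \<Rightarrow> real) \<Rightarrow> 'i set \<Rightarrow> ('i \<Rightarrow> 'g) \<Rightarrow> ('i \<Rightarrow> 'g) \<Rightarrow> bool" where
  "dual_bases ip I e e' \<longleftrightarrow>
     finite I \<and>
     inj_on e I \<and> independent (e ` I) \<and> span (e ` I) = UNIV \<and>
     inj_on e' I \<and> independent (e' ` I) \<and> span (e' ` I) = UNIV \<and>
     (\<forall>i\<in>I. \<forall>j\<in>I. ip (e i) (e' j) = (if i = j then 1 else 0))"

text \<open>The identification of the dual space with the Lie algebra.\<close>

definition sharp :: "('g::real_vector \<Rightarrow> 'g \<Rightarrow> real) \<Rightarrow> ('g \<Rightarrow> real) \<Rightarrow> 'g" where
  "sharp ip l = (THE x. \<forall>y. ip x y = l y)"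

text \<open>The element \<open>\<phi>\<close> of the third exterior power, as an alternating form on the dual space.\<close>

definition cartan_trivector :: "('g::real_vector \<Rightarrow> 'g \<Rightarrow> 'g) \<Rightarrow> ('g \<Rightarrow> 'g \<Rightarrow> real) \<Rightarrow>
    ('g \<Rightarrow> real) list \<Rightarrow> real" where
  "cartan_trivector br ip ls = (if length ls = 3 \<and> (\<forall>l\<in>set ls. linear l)
     then ip (sharp ip (ls ! 0)) (br (sharp ip (ls ! 1)) (sharp ip (ls ! 2))) / 2
     else 0)"

text \<open>The Chevalley--Eilenberg differential, i.e. the differential of the Lie algebra as a Lie
  algebroid over a point.\<close>

definition ce_differential :: "('g \<Rightarrow> 'g \<Rightarrow> 'g) \<Rightarrow> ('g list \<Rightarrow> real) \<Rightarrow> 'g list \<Rightarrow> real" where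
  "ce_differential br w xs = (\<Sum>j<length xs. \<Sum>i<j.
     (-1) ^ (i + j) * w (br (xs ! i) (xs ! j) # nths xs (- {i, j})))"


section \<open>Quasi-Poisson manifolds\<close>

text \<open>A Lie algebra action, given by the anchor \<open>\<rho> p \<xi>\<close>.\<close>

definition lie_algebra_action :: "('a, 'b::real_normed_vector) chart set \<Rightarrow>
    ('g::real_vector \<Rightarrow> 'g \<Rightarrow> 'g) \<Rightarrow> ('a \<Rightarrow> 'g \<Rightarrow> 'a tangent) \<Rightarrow> bool" where
  "lie_algebra_action A br \<rho> \<longleftrightarrow>
     (\<forall>p \<xi>. \<rho> p \<xi> \<in> tangent_space A p) \<and>
     (\<forall>p. linear (\<rho> p)) \<and>
     (\<forall>\<xi>. \<forall>f\<in>smooth_functions A. (\<lambda>p. \<rho> p \<xi> f) \<in> smooth_functions A) \<and>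
     (\<forall>\<xi> \<eta> p. \<forall>f\<in>smooth_functions A.
        \<rho> p (br \<xi> \<eta>) f = \<rho> p \<xi> (\<lambda>q. \<rho> q \<eta> f) - \<rho> p \<eta> (\<lambda>q. \<rho> q \<xi> f))"

definition action_field :: "('a, 'b::real_normed_vector) chart set \<Rightarrow>
    ('a \<Rightarrow> 'g \<Rightarrow> 'a tangent) \<Rightarrow> 'g \<Rightarrow> 'a mvfield" where
  "action_field A \<rho> \<xi> = vector_field A (\<lambda>p. \<rho> p \<xi>)"

definition anchor_transpose :: "('a \<Rightarrow> 'g \<Rightarrow> 'a tangent) \<Rightarrow> 'a \<Rightarrow> 'a cotangent \<Rightarrow> 'g \<Rightarrow> real" where
  "anchor_transpose \<rho> p a = (\<lambda>\<xi>. a (\<rho> p \<xi>))"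

text \<open>The extension of \<open>\<rho>\<close> to exterior powers. Its argument is an element of an exterior power of the
  Lie algebra, written as an alternating form on the dual space.\<close>

definition anchor_ext :: "('a, 'b::real_normed_vector) chart set \<Rightarrow>
    ('a \<Rightarrow> 'g \<Rightarrow> 'a tangent) \<Rightarrow> (('g \<Rightarrow> real) list \<Rightarrow> real) \<Rightarrow> 'a mvfield" where
  "anchor_ext A \<rho> w = (\<lambda>p as. if set as \<subseteq> cotangent_space A p
     then w (map (anchor_transpose \<rho> p) as) else 0)"

definition quasi_poisson_manifold ::
  "('a::{t2_space, second_countable_topology}, 'b::real_normed_vector) chart set \<Rightarrow>
    ('g::real_vector \<Rightarrow> 'g \<Rightarrow> 'g) \<Rightarrow> ('g \<Rightarrow> 'g \<Rightarrow> real) \<Rightarrow>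
    ('a \<Rightarrow> 'g \<Rightarrow> 'a tangent) \<Rightarrow> 'a mvfield \<Rightarrow> bool" where
  "quasi_poisson_manifold A br ip \<rho> \<pi> \<longleftrightarrow>
     smooth_manifold A \<and>
     lie_algebra_action A br \<rho> \<and>
     \<pi> \<in> mv_fields A 2 \<and>
     schouten A 2 2 \<pi> \<pi> = anchor_ext A \<rho> (cartan_trivector br ip) \<and>
     (\<forall>\<xi>. schouten A 2 1 \<pi> (action_field A \<rho> \<xi>) = 0)"


section \<open>Lie algebroid structures on the cotangent bundle\<close>

text \<open>A Lie algebroid structure on a vector bundle \<open>B\<close> is given by its differential: a derivation of
  degree 1 and square zero of the graded algebra \<open>G\<close> of sections of the exterior powers of the dual
  of \<open>B\<close>, with product \<open>w\<close>. For the cotangent bundle, \<open>G\<close> is the algebra of multivector fields.\<close>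

definition lie_algebroid_differential :: "(nat \<Rightarrow> 's::real_vector set) \<Rightarrow> ('s \<Rightarrow> 's \<Rightarrow> 's) \<Rightarrow>
    (nat \<Rightarrow> 's \<Rightarrow> 's) \<Rightarrow> bool" where
  "lie_algebroid_differential G w D \<longleftrightarrow>
     (\<forall>k. \<forall>P\<in>G k. D k P \<in> G (k + 1)) \<and>
     (\<forall>k. \<forall>P\<in>G k. \<forall>Q\<in>G k. \<forall>a b. D k (a *\<^sub>R P + b *\<^sub>R Q) = a *\<^sub>R D k P + b *\<^sub>R D k Q) \<and>
     (\<forall>k l. \<forall>P\<in>G k. \<forall>Q\<in>G l. D (k + l) (w P Q) = w (D k P) Q + ((-1) ^ k) *\<^sub>R w P (D l Q)) \<and>
     (\<forall>k. \<forall>P\<in>G k. D (k + 1) (D k P) = 0)"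

definition quasi_poisson_differential :: "('a, 'b::real_normed_vector) chart set \<Rightarrow>
    ('a \<Rightarrow> 'g \<Rightarrow> 'a tangent) \<Rightarrow> 'a mvfield \<Rightarrow> 'i set \<Rightarrow> ('i \<Rightarrow> 'g) \<Rightarrow> ('i \<Rightarrow> 'g) \<Rightarrow>
    nat \<Rightarrow> 'a mvfield \<Rightarrow> 'a mvfield" where
  "quasi_poisson_differential A \<rho> \<pi> I e e' k P =
     schouten A 2 k \<pi> P +
     (1/2) *\<^sub>R (\<Sum>i\<in>I. mv_wedge (action_field A \<rho> (e' i)) (schouten A 1 k (action_field A \<rho> (e i)) P))"

text \<open>An action on the cotangent bundle preserves the Lie algebroid structure iff the dual action
  commutes with the differential.\<close>

definition action_preserves :: "('a, 'b::real_normed_vector) chart set \<Rightarrow>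
    ('a \<Rightarrow> 'g \<Rightarrow> 'a tangent) \<Rightarrow> (nat \<Rightarrow> 'a mvfield \<Rightarrow> 'a mvfield) \<Rightarrow> bool" where
  "action_preserves A \<rho> D \<longleftrightarrow>
     (\<forall>\<xi> k. \<forall>P\<in>mv_fields A k.
        D k (lie_derivative A (\<lambda>p. \<rho> p \<xi>) P) = lie_derivative A (\<lambda>p. \<rho> p \<xi>) (D k P))"

text \<open>\<open>\<rho>\<^sup>*\<close> from the cotangent bundle to the trivial bundle with fibre the Lie algebra, and
  \<open>\<mu>\<^sub>\<rho>\<close>.\<close>

definition rho_star :: "('g::real_vector \<Rightarrow> 'g \<Rightarrow> real) \<Rightarrow> ('a \<Rightarrow> 'g \<Rightarrow> 'a tangent) \<Rightarrow>
    'a \<times> 'a cotangent \<Rightarrow> 'a \<times> 'g" where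
  "rho_star ip \<rho> = (\<lambda>(p, a). (p, sharp ip (anchor_transpose \<rho> p a)))"

definition mu_rho :: "('g::real_vector \<Rightarrow> 'g \<Rightarrow> real) \<Rightarrow> ('a \<Rightarrow> 'g \<Rightarrow> 'a tangent) \<Rightarrow>
    'a \<times> 'a cotangent \<Rightarrow> 'g" where
  "mu_rho ip \<rho> = snd \<circ> rho_star ip \<rho>"

definition pullback_form :: "('a, 'b::real_normed_vector) chart set \<Rightarrow>
    ('a \<times> 'a cotangent \<Rightarrow> 'g) \<Rightarrow> ('g list \<Rightarrow> real) \<Rightarrow> 'a mvfield" where
  "pullback_form A \<mu> w = (\<lambda>p as. if set as \<subseteq> cotangent_space A p
     then w (map (\<lambda>a. \<mu> (p, a)) as) else 0)"

text \<open>Lie algebroid morphisms from the cotangent bundle, with differential \<open>D\<close>, to a Lie algebra: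
  smooth fibrewise linear maps whose pullback intertwines the differentials.\<close>

definition lie_algebroid_morphism :: "('a, 'b::real_normed_vector) chart set \<Rightarrow>
    (nat \<Rightarrow> 'a mvfield \<Rightarrow> 'a mvfield) \<Rightarrow> ('g::real_vector \<Rightarrow> 'g \<Rightarrow> 'g) \<Rightarrow>
    ('a \<times> 'a cotangent \<Rightarrow> 'g) \<Rightarrow> bool" where
  "lie_algebroid_morphism A D br \<mu> \<longleftrightarrow>
     (\<forall>p. \<forall>a\<in>cotangent_space A p. \<forall>b\<in>cotangent_space A p. \<forall>s t.
        \<mu> (p, s *\<^sub>R a + t *\<^sub>R b) = s *\<^sub>R \<mu> (p, a) + t *\<^sub>R \<mu> (p, b)) \<and>
     (\<forall>k. \<forall>w\<in>alt_forms UNIV k.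
        pullback_form A \<mu> w \<in> mv_fields A k \<and>
        D k (pullback_form A \<mu> w) = pullback_form A \<mu> (ce_differential br w))"

end

theory Submission
  imports Defs
begin

text \<open>A multivector field is determined by its values on differentials of functions, so everything
  takes place in the algebra of alternating multiderivations of the smooth functions, which are
  functions on lists. There, plugging in a function as first argument is a graded derivation of both
  the wedge product and the Schouten bracket; hence the Leibniz rules and the graded Jacobi identity
  follow by induction on the list of arguments, and only values on the empty list remain to be
  compared.

  Write \<open>S\<close> for the sum of \<open>\<rho>(e\<^sup>i) \<and> \<rho>(e\<^sup>j) \<and> [\<rho>[e\<^sub>i, e\<^sub>j], P]\<close>. Since
  \<open>[\<pi>, \<pi>]\<close> is \<open>1/12\<close> of the sum of \<open>\<rho>(e\<^sup>i) \<and> \<rho>(e\<^sup>j) \<and> \<rho>[e\<^sub>i, e\<^sub>j]\<close>, the Jacobi identity and the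
  invariance of the Casimir element yield \<open>[\<pi>, [\<pi>, P]] = S/8\<close>. The square of the second
  summand of the differential contributes \<open>(-S + S/2)/4 = -S/8\<close>, and the mixed terms cancel because
  the action preserves \<open>\<pi>\<close>.

  For the morphism, an Euler identity writes the pullback of a form on the Lie algebra as a sum of
  products of \<open>\<rho>(e\<^sub>i)\<close> with pullbacks of lower degree, so \<open>\<pi>\<close> brackets it to zero; the second
  summand of the differential pulls back the formula \<open>1/2 \<Sum> e\<^sup>i \<and> L(e\<^sub>i)\<close> for the
  Chevalley--Eilenberg differential.\<close>

text \<open>The factor 1/2 in the differential is forced. With a factor \<open>c\<close> in its
  place the square is \<open>(1/8 - c^2/2) S\<close>, so \<open>c\<close> is 1/2 or -1/2 as soon as
  some \<open>S\<close> is nonzero. The morphism property selects the positive sign, because the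
  Chevalley--Eilenberg differential is \<open>+1/2\<close> times the corresponding sum on the Lie
  algebra. The 1/12 originates in the 1/2 of \<phi>: a wedge product of three vector fields has six
  terms, which all contribute the same value.

  The obstacle is that multivector fields eat cotangent vectors, whereas the bracket must
  differentiate functions and \<open>mv_of\<close> picks arbitrary functions with given
  differentials. Hence all computations take functions as arguments, and it is shown once that
  values depend on differentials alone.\<close>

instance "fun" :: (type, real_algebra_1) real_algebra_1
  by standard (auto simp: fun_eq_iff scaleR_fun_def)

section \<open>Functions on lists as a graded algebra\<close>

text \<open>Interior product with \<open>v\<close>. For a multiderivation \<open>F\<close> and a
  function \<open>v\<close> it is the bracket with \<open>v\<close> up to sign, which is why it
  obeys derivation rules.\<close>

definition plug :: "'v \<Rightarrow> ('v list \<Rightarrow> 'c) \<Rightarrow> 'v list \<Rightarrow> 'c" where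
  "plug v F = (\<lambda>vs. F (v # vs))"

text \<open>The grading involution, read off from the length of the argument list. It supplies the
  sign in the Leibniz rule of \<open>plug\<close> without reference to a degree.\<close>

definition twist :: "('v list \<Rightarrow> 'c::real_vector) \<Rightarrow> 'v list \<Rightarrow> 'c" where
  "twist F = (\<lambda>vs. (-1) ^ length vs *\<^sub>R F vs)"

definition scl :: "'c::times \<Rightarrow> ('v list \<Rightarrow> 'c) \<Rightarrow> 'v list \<Rightarrow> 'c" where
  "scl c F = (\<lambda>vs. c * F vs)"

text \<open>Signs depend on degrees only modulo 2. Therefore degrees of multiderivations are recorded up to
  parity, and plugging in an argument raises them by one instead of lowering them, which avoids
  truncated subtraction; \<open>homogeneous\<close> uses integers for the same reason.\<close>

definition parity :: "nat \<Rightarrow> ('v list \<Rightarrow> 'c::zero) \<Rightarrow> bool" where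
  "parity p F \<longleftrightarrow> (\<forall>vs. odd (length vs + p) \<longrightarrow> F vs = 0)"

definition homogeneous :: "int \<Rightarrow> ('v list \<Rightarrow> 'c::zero) \<Rightarrow> bool" where
  "homogeneous k F \<longleftrightarrow> (\<forall>vs. int (length vs) \<noteq> k \<longrightarrow> F vs = 0)"

text \<open>The Leibniz rule for \<open>plug\<close> is taken as the definition, so that identities
  follow by induction on the list, without combinatorics of shuffles. Agreement with the shuffle sum
  is \<open>wdg_shuffle\<close>.\<close>

primrec wdg_list :: "'v list \<Rightarrow> ('v list \<Rightarrow> 'c::{comm_ring_1,real_algebra_1}) \<Rightarrow> ('v list \<Rightarrow> 'c) \<Rightarrow> 'c"
  where
  "wdg_list [] F G = F [] * G []"
| "wdg_list (v # vs) F G = wdg_list vs (plug v F) G + wdg_list vs (twist F) (plug v G)"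

definition wdg :: "('v list \<Rightarrow> 'c::{comm_ring_1,real_algebra_1}) \<Rightarrow> ('v list \<Rightarrow> 'c) \<Rightarrow> 'v list \<Rightarrow> 'c" where
  "wdg F G = (\<lambda>vs. wdg_list vs F G)"

text \<open>Composition of multiderivations: the value of \<open>G\<close> becomes the last argument
  of \<open>F\<close>. As \<open>F\<close> thus receives one entry more than it takes from the list,
  \<open>twist F\<close> counts one sign too many, which the minus sign undoes.\<close>

primrec insertion_list :: "'c list \<Rightarrow> ('c list \<Rightarrow> 'c::{comm_ring_1,real_algebra_1}) \<Rightarrow> ('c list \<Rightarrow> 'c) \<Rightarrow> 'c"
  where
  "insertion_list [] F G = F [G []]"
| "insertion_list (v # vs) F G = insertion_list vs (plug v F) G - insertion_list vs (twist F) (plug v G)"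

definition insertion :: "('c list \<Rightarrow> 'c::{comm_ring_1,real_algebra_1}) \<Rightarrow> ('c list \<Rightarrow> 'c) \<Rightarrow> 'c list \<Rightarrow> 'c" where
  "insertion F G = (\<lambda>vs. insertion_list vs F G)"

definition bracket :: "nat \<Rightarrow> nat \<Rightarrow> ('c list \<Rightarrow> 'c::{comm_ring_1,real_algebra_1}) \<Rightarrow> ('c list \<Rightarrow> 'c) \<Rightarrow> 'c list \<Rightarrow> 'c"
  where "bracket p q F G = insertion F G - ((-1) ^ ((p + 1) * (q + 1))) *\<^sub>R insertion G F"

lemma list_fun_eqI:
  assumes "F [] = G []" "\<And>v. plug v F = plug v G"
  shows "F = G"
proof
  fix vs show "F vs = G vs"
    using assms by (cases vs) (auto simp: plug_def fun_eq_iff)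
qed

lemma scaleR_fun_apply [simp]: "(c *\<^sub>R F) x = c *\<^sub>R F x"
  by (simp add: scaleR_fun_def)

lemma plug_apply [simp]: "plug v F vs = F (v # vs)" by (simp add: plug_def)
lemma twist_apply [simp]: "twist F vs = (-1) ^ length vs *\<^sub>R F vs" by (simp add: twist_def)
lemma scl_apply [simp]: "scl c F vs = c * F vs" by (simp add: scl_def)

lemma plug_simps [simp]:
  fixes F G :: "'v list \<Rightarrow> 'c::{comm_ring_1,real_algebra_1}"
  shows
  "plug v (F + G) = plug v F + plug v G"
  "plug v (F - G) = plug v F - plug v G"
  "plug v (- F) = - plug v F"
  "plug v (c *\<^sub>R F) = c *\<^sub>R plug v F"
  "plug v (scl d F) = scl d (plug v F)"
  "plug v (0 :: 'v list \<Rightarrow> 'c) = 0"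
  "plug v (twist F) = - twist (plug v F)"
  by (auto simp: fun_eq_iff)

lemma plug_sum: "plug v (sum H S) = (\<Sum>i\<in>S. plug v (H i :: 'v list \<Rightarrow> 'c::comm_ring_1))"
  by (induction S rule: infinite_finite_induct) (auto simp: fun_eq_iff)

lemma twist_simps [simp]:
  fixes F G :: "'v list \<Rightarrow> 'c::{comm_ring_1,real_algebra_1}"
  shows
  "twist (F + G) = twist F + twist G"
  "twist (F - G) = twist F - twist G"
  "twist (- F) = - twist F"
  "twist (c *\<^sub>R F) = c *\<^sub>R twist F"
  "twist (scl d F) = scl d (twist F)"
  "twist (0 :: 'v list \<Rightarrow> 'c) = 0"
  by (auto simp: fun_eq_iff algebra_simps)

lemma twist_parity: "parity p F \<Longrightarrow> twist F = (-1) ^ p *\<^sub>R F"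
proof
  fix vs assume "parity p F"
  then have "F vs = 0 \<or> even (length vs + p)" unfolding parity_def by blast
  then show "twist F vs = ((-1) ^ p *\<^sub>R F) vs"
    by (cases "even p") auto
qed

lemma parity_plug: "parity p F \<Longrightarrow> parity (Suc p) (plug v F)"
  by (auto simp: parity_def)

lemma homogeneous_parity: "homogeneous (int k) F \<Longrightarrow> parity k F"
  by (auto simp: parity_def homogeneous_def)

lemma wdg_Nil [simp]: "wdg F G [] = F [] * G []"
  by (simp add: wdg_def)

lemma plug_wdg: "plug v (wdg F G) = wdg (plug v F) G + wdg (twist F) (plug v G)"
  by (simp add: wdg_def fun_eq_iff)

lemma wdg_Cons: "wdg F G (v # vs) = wdg (plug v F) G vs + wdg (twist F) (plug v G) vs"
  by (simp add: wdg_def)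

lemma insertion_Nil [simp]: "insertion F G [] = F [G []]"
  by (simp add: insertion_def)

lemma plug_insertion: "plug v (insertion F G) = insertion (plug v F) G - insertion (twist F) (plug v G)"
  by (simp add: insertion_def fun_eq_iff)

lemma insertion_Cons: "insertion F G (v # vs) = insertion (plug v F) G vs - insertion (twist F) (plug v G) vs"
  by (simp add: insertion_def)

section \<open>Linearity, associativity and graded commutativity of the wedge product\<close>

lemma wdg_add_left [simp]: "wdg (F + G) H = wdg F H + wdg G H"
proof
  fix vs show "wdg (F + G) H vs = (wdg F H + wdg G H) vs"
    by (induction vs arbitrary: F G H) (auto simp: wdg_Cons algebra_simps)
qed

lemma wdg_add_right [simp]: "wdg H (F + G) = wdg H F + wdg H G"
proof
  fix vs show "wdg H (F + G) vs = (wdg H F + wdg H G) vs"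
    by (induction vs arbitrary: F G H) (auto simp: wdg_Cons algebra_simps)
qed

lemma wdg_scl_left [simp]: "wdg (scl c F) H = scl c (wdg F H)"
proof
  fix vs show "wdg (scl c F) H vs = scl c (wdg F H) vs"
    by (induction vs arbitrary: F H) (auto simp: wdg_Cons algebra_simps)
qed

lemma wdg_scl_right [simp]: "wdg H (scl c F) = scl c (wdg H F)"
proof
  fix vs show "wdg H (scl c F) vs = scl c (wdg H F) vs"
    by (induction vs arbitrary: F H) (auto simp: wdg_Cons algebra_simps)
qed

lemma scaleR_eq_scl: "(r *\<^sub>R F :: 'v list \<Rightarrow> 'c::{comm_ring_1,real_algebra_1}) = scl (of_real r) F"
  unfolding fun_eq_iff scaleR_fun_apply scl_apply by (simp add: scaleR_conv_of_real[where 'a='c])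

lemma wdg_scaleR_left [simp]: "wdg (r *\<^sub>R F) H = r *\<^sub>R wdg F H"
  by (simp add: scaleR_eq_scl)

lemma wdg_scaleR_right [simp]: "wdg H (r *\<^sub>R F) = r *\<^sub>R wdg H F"
  by (simp add: scaleR_eq_scl)

lemma wdg_minus [simp]: "wdg (- F) H = - wdg F H" "wdg H (- F) = - wdg H F"
  using wdg_scaleR_left[of "-1" F H] wdg_scaleR_right[of H "-1" F] by simp_all

lemma wdg_diff [simp]: "wdg (F - G) H = wdg F H - wdg G H" "wdg H (F - G) = wdg H F - wdg H G"
  using wdg_add_left[of F "- G" H] wdg_add_right[of H F "- G"] by simp_all

lemma wdg_zero [simp]: "wdg 0 H = 0" "wdg H 0 = 0"
  using wdg_scaleR_left[of "0" 0 H] wdg_scaleR_right[of H "0" 0] by simp_all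

lemma wdg_sum_left: "wdg (sum F S) H = (\<Sum>i\<in>S. wdg (F i) H)"
  using Modules.additive.sum[of "\<lambda>F. wdg F H" F S] by (simp add: Modules.additive_def)

lemma wdg_sum_right: "wdg H (sum F S) = (\<Sum>i\<in>S. wdg H (F i))"
  using Modules.additive.sum[of "wdg H" F S] by (simp add: Modules.additive_def)

text \<open>Each list entry goes to exactly one factor, so the sign is multiplicative. Associativity
  needs this when an entry passes a product of two factors.\<close>

lemma twist_wdg: "twist (wdg F G) = wdg (twist F) (twist G)"
proof
  fix vs show "twist (wdg F G) vs = wdg (twist F) (twist G) vs"
  proof (induction vs arbitrary: F G)
    case (Cons v vs)
    have "twist (wdg (plug v F) G) vs = wdg (twist (plug v F)) (twist G) vs"
      "twist (wdg (twist F) (plug v G)) vs = wdg (twist (twist F)) (twist (plug v G)) vs"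
      by (rule Cons)+
    then show "twist (wdg F G) (v # vs) = wdg (twist F) (twist G) (v # vs)"
      by (simp add: wdg_Cons algebra_simps)
  qed simp
qed

lemma wdg_assoc: "wdg (wdg F G) H = wdg F (wdg G H)"
proof
  fix vs show "wdg (wdg F G) H vs = wdg F (wdg G H) vs"
    by (induction vs arbitrary: F G H) (auto simp: wdg_Cons plug_wdg twist_wdg algebra_simps)
qed

lemma parity_wdg:
  assumes "parity p F" "parity q G"
  shows "parity (p + q) (wdg F G)"
proof -
  have "wdg F G vs = 0" if "odd (length vs + (p + q))" for vs
    using that assms
  proof (induction vs arbitrary: F G p q)
    case Nil
    then show ?case by (cases "even p") (auto simp: parity_def)
  next
    case (Cons v vs)
    have "wdg (plug v F) G vs = 0"
      using Cons.prems(1) by (intro Cons.IH[OF _ parity_plug[OF Cons.prems(2)] Cons.prems(3)]) auto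
    moreover have "wdg F (plug v G) vs = 0"
      using Cons.prems(1) by (intro Cons.IH[OF _ Cons.prems(2) parity_plug[OF Cons.prems(3)]]) auto
    ultimately show ?case
      by (simp add: wdg_Cons twist_parity[OF Cons.prems(2)])
  qed
  then show ?thesis
    unfolding parity_def by blast
qed

text \<open>Plugging an argument into one factor shifts the parity of that factor, and the exchange
  sign changes by just the sign of \<open>twist\<close>. On the empty list the values commute, and
  where the sign is negative both vanish because both degrees are odd.\<close>

lemma wdg_commute:
  assumes "parity p F" "parity q G"
  shows "wdg F G = ((-1) ^ (p * q)) *\<^sub>R wdg G F"
proof
  fix vs show "wdg F G vs = (((-1) ^ (p * q)) *\<^sub>R wdg G F) vs"
    using assms
  proof (induction vs arbitrary: F G p q)
    case Nil
    have "F [] = 0" if "odd p" using Nil that by (simp add: parity_def)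
    moreover have "G [] = 0" if "odd q" using Nil that by (simp add: parity_def)
    ultimately show ?case
      by (cases "even p"; cases "even q") auto
  next
    case (Cons v vs)
    have "wdg F G (v # vs) = wdg (plug v F) G vs + (-1) ^ p *\<^sub>R wdg F (plug v G) vs"
      by (simp add: wdg_Cons twist_parity[OF Cons.prems(1)])
    moreover have "wdg G F (v # vs) = wdg (plug v G) F vs + (-1) ^ q *\<^sub>R wdg G (plug v F) vs"
      by (simp add: wdg_Cons twist_parity[OF Cons.prems(2)])
    moreover have "wdg (plug v F) G vs = ((-1) ^ (Suc p * q) *\<^sub>R wdg G (plug v F)) vs"
      by (rule Cons.IH[OF parity_plug[OF Cons.prems(1)] Cons.prems(2)])
    moreover have "wdg F (plug v G) vs = ((-1) ^ (p * Suc q) *\<^sub>R wdg (plug v G) F) vs"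
      by (rule Cons.IH[OF Cons.prems(1) parity_plug[OF Cons.prems(2)]])
    ultimately show ?case
      by (cases "even p"; cases "even q") simp_all
  qed
qed

section \<open>Integer degrees\<close>

lemma homogeneous_plug: "homogeneous k F \<Longrightarrow> homogeneous (k - 1) (plug v F)"
  by (auto simp: homogeneous_def)

lemma homogeneous_scaleR: "homogeneous k F \<Longrightarrow> homogeneous k (c *\<^sub>R F)" for F :: "'v list \<Rightarrow> 'c::real_vector"
  by (auto simp: homogeneous_def)

lemma homogeneous_twist: "homogeneous k F \<Longrightarrow> homogeneous k (twist F)"
  by (auto simp: homogeneous_def)

lemma homogeneous_add: "homogeneous k F \<Longrightarrow> homogeneous k G \<Longrightarrow> homogeneous k (F + G)" for F :: "'v list \<Rightarrow> 'c::real_vector"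
  by (auto simp: homogeneous_def)

lemma homogeneous_diff: "homogeneous k F \<Longrightarrow> homogeneous k G \<Longrightarrow> homogeneous k (F - G)" for F :: "'v list \<Rightarrow> 'c::real_vector"
  by (auto simp: homogeneous_def)

lemma homogeneous_zero: "homogeneous k (0 :: 'v list \<Rightarrow> 'c::real_vector)"
  by (auto simp: homogeneous_def)

lemma homogeneous_sum: "(\<And>i. i \<in> S \<Longrightarrow> homogeneous k (F i)) \<Longrightarrow> homogeneous k (sum F S)"
  for F :: "'i \<Rightarrow> 'v list \<Rightarrow> 'c::real_vector"
  by (induction S rule: infinite_finite_induct) (auto intro: homogeneous_zero homogeneous_add)

lemma homogeneous_wdg:
  assumes "homogeneous k F" "homogeneous l G"
  shows "homogeneous (k + l) (wdg F G)"
proof -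
  have "wdg F G vs = 0" if "int (length vs) \<noteq> k + l" for vs
    using that assms
  proof (induction vs arbitrary: F G k l)
    case Nil
    then show ?case by (cases "k = 0") (auto simp: homogeneous_def)
  next
    case (Cons v vs)
    have "wdg (plug v F) G vs = 0"
      using Cons.prems(1) by (intro Cons.IH[OF _ homogeneous_plug[OF Cons.prems(2)] Cons.prems(3)]) auto
    moreover have "wdg (twist F) (plug v G) vs = 0"
      using Cons.prems(1) by (intro Cons.IH[OF _ homogeneous_twist[OF Cons.prems(2)] homogeneous_plug[OF Cons.prems(3)]]) auto
    ultimately show ?case
      by (simp add: wdg_Cons)
  qed
  then show ?thesis
    unfolding homogeneous_def by blast
qed

section \<open>The bracket and its derivation rule under plugging\<close>

lemma insertion_add_left [simp]: "insertion (F + G) H = insertion F H + insertion G H"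
proof
  fix vs show "insertion (F + G) H vs = (insertion F H + insertion G H) vs"
    by (induction vs arbitrary: F G H) (auto simp: insertion_Cons algebra_simps)
qed

lemma insertion_scl_left [simp]: "insertion (scl c F) H = scl c (insertion F H)"
proof
  fix vs show "insertion (scl c F) H vs = scl c (insertion F H) vs"
    by (induction vs arbitrary: F H) (auto simp: insertion_Cons algebra_simps)
qed

lemma insertion_scaleR_left [simp]: "insertion (r *\<^sub>R F) H = r *\<^sub>R insertion F H"
  by (simp add: scaleR_eq_scl)

lemma insertion_minus_left [simp]: "insertion (- F) H = - insertion F H"
  using insertion_scaleR_left[of "-1" F H] by simp

lemma insertion_diff_left [simp]: "insertion (F - G) H = insertion F H - insertion G H"
  using insertion_add_left[of F "- G" H] by simp

lemma bracket_parity_cong: "even p = even p' \<Longrightarrow> even q = even q' \<Longrightarrow> bracket p q = bracket p' q'"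
  unfolding bracket_def fun_eq_iff by (cases "even p'"; cases "even q'") auto

lemma bracket_swap: "bracket p q F G = - ((-1) ^ ((p + 1) * (q + 1))) *\<^sub>R bracket q p G F"
  unfolding bracket_def by (cases "even p"; cases "even q") (auto simp: fun_eq_iff)

text \<open>This is the Jacobi identity for the bracket with a function. It can be read off from the
  recursion of \<open>insertion\<close>, where parity turns each \<open>twist\<close> into a
  sign.\<close>

lemma plug_bracket:
  assumes "parity p F" "parity q G"
  shows "plug v (bracket p q F G) =
    bracket (Suc p) q (plug v F) G + ((-1) ^ (p + 1)) *\<^sub>R bracket p (Suc q) F (plug v G)"
  unfolding bracket_def plug_simps plug_insertion
  by (cases "even p"; cases "even q")
    (simp_all add: twist_parity[OF assms(1)] twist_parity[OF assms(2)] algebra_simps)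

lemma bracket_Nil: "bracket p q F G [] = F [G []] - (-1) ^ ((p + 1) * (q + 1)) *\<^sub>R G [F []]"
  by (simp add: bracket_def)

section \<open>Multiderivations\<close>

primrec after :: "'v list \<Rightarrow> ('v list \<Rightarrow> 'c) \<Rightarrow> 'v list \<Rightarrow> 'c" where
  "after [] F = F"
| "after (v # vs) F = after vs (plug v F)"

lemma after_apply: "after vs F ws = F (vs @ ws)"
  by (induction vs arbitrary: F) auto

lemma after_simps [simp]:
  fixes F G :: "'v list \<Rightarrow> 'c::{comm_ring_1,real_algebra_1}"
  shows
  "after vs (F + G) = after vs F + after vs G"
  "after vs (F - G) = after vs F - after vs G"
  "after vs (c *\<^sub>R F) = c *\<^sub>R after vs F"
  "after vs (scl d F) = scl d (after vs F)"
  "after vs (0 :: 'v list \<Rightarrow> 'c) = 0"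
  by (simp_all add: after_apply fun_eq_iff)

text \<open>\<open>C\<close> is the algebra of smooth functions inside the ring of all functions. As
  a set it leaves arguments in the ambient ring, as in \<open>mv_eval\<close>.\<close>

locale function_algebra =
  fixes C :: "'c::{comm_ring_1,real_algebra_1} set"
  assumes add_closed: "f \<in> C \<Longrightarrow> g \<in> C \<Longrightarrow> f + g \<in> C"
    and mult_closed: "f \<in> C \<Longrightarrow> g \<in> C \<Longrightarrow> f * g \<in> C"
    and scaleR_closed: "f \<in> C \<Longrightarrow> c *\<^sub>R f \<in> C"
    and one_closed: "1 \<in> C"
begin

lemma zero_closed: "0 \<in> C"
  using scaleR_closed[OF one_closed, of 0] by simp

lemma minus_closed: "f \<in> C \<Longrightarrow> - f \<in> C"
  using scaleR_closed[of f "-1"] by simp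

lemma diff_closed: "f \<in> C \<Longrightarrow> g \<in> C \<Longrightarrow> f - g \<in> C"
  using add_closed[of f "- g"] minus_closed[of g] by simp

lemmas closed = add_closed mult_closed scaleR_closed one_closed zero_closed minus_closed diff_closed

text \<open>Arguments outside \<open>C\<close> give 0 to match tangent vectors, which vanish on
  non-smooth functions. The clause for odd \<open>p\<close>, imposed after every plugging, amounts
  to \<open>parity p F\<close>.\<close>

definition front_der :: "nat \<Rightarrow> ('c list \<Rightarrow> 'c) \<Rightarrow> bool" where
  "front_der p F \<longleftrightarrow> F [] \<in> C \<and> (odd p \<longrightarrow> F [] = 0) \<and>
     (\<forall>f. f \<notin> C \<longrightarrow> plug f F = 0) \<and>
     (\<forall>f\<in>C. \<forall>g\<in>C. plug (f + g) F = plug f F + plug g F) \<and>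
     (\<forall>c. \<forall>f\<in>C. plug (c *\<^sub>R f) F = c *\<^sub>R plug f F) \<and>
     (\<forall>f\<in>C. \<forall>g\<in>C. plug (f * g) F = scl f (plug g F) + scl g (plug f F)) \<and>
     (\<forall>f g. plug g (plug f F) = - plug f (plug g F))"

text \<open>\<open>after vs F\<close> exposes each later argument as a first one, so conditions on
  the first argument reach every slot. In this form the property passes to \<open>plug f F\<close>
  at once.\<close>

definition multider :: "nat \<Rightarrow> ('c list \<Rightarrow> 'c) \<Rightarrow> bool" where
  "multider p F \<longleftrightarrow> (\<forall>vs. front_der (p + length vs) (after vs F))"

lemma multider_front: "multider p F \<Longrightarrow> front_der p F"
  unfolding multider_def by (drule spec[of _ "[]"]) simp

lemma multider_plug: "multider p F \<Longrightarrow> multider (Suc p) (plug f F)"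
  unfolding multider_def
proof
  fix vs assume "\<forall>vs. front_der (p + length vs) (after vs F)"
  from spec[OF this, of "f # vs"] show "front_der (Suc p + length vs) (after vs (plug f F))"
    by simp
qed

lemma mderI: "front_der p F \<Longrightarrow> (\<And>f. multider (Suc p) (plug f F)) \<Longrightarrow> multider p F"
  unfolding multider_def
proof
  fix vs assume "front_der p F" "\<And>f. \<forall>vs. front_der (Suc p + length vs) (after vs (plug f F))"
  then show "front_der (p + length vs) (after vs F)"
    by (cases vs) auto
qed

lemma multider_Nil: "multider p F \<Longrightarrow> F [] \<in> C"
  and multider_odd_Nil: "multider p F \<Longrightarrow> odd p \<Longrightarrow> F [] = 0"
  and multider_plug_out: "multider p F \<Longrightarrow> f \<notin> C \<Longrightarrow> plug f F = 0"
  and multider_plug_add: "multider p F \<Longrightarrow> f \<in> C \<Longrightarrow> g \<in> C \<Longrightarrow> plug (f + g) F = plug f F + plug g F"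
  and multider_plug_scaleR: "multider p F \<Longrightarrow> f \<in> C \<Longrightarrow> plug (c *\<^sub>R f) F = c *\<^sub>R plug f F"
  and multider_plug_mult: "multider p F \<Longrightarrow> f \<in> C \<Longrightarrow> g \<in> C \<Longrightarrow>
    plug (f * g) F = scl f (plug g F) + scl g (plug f F)"
  and multider_plug_swap: "multider p F \<Longrightarrow> plug g (plug f F) = - plug f (plug g F)"
  by (drule multider_front, unfold front_der_def, blast)+

lemma multider_plug_zero: "multider p F \<Longrightarrow> plug 0 F = 0"
  using multider_plug_scaleR[of p F 1 0] one_closed by simp

lemma multider_plug_diff: "multider p F \<Longrightarrow> f \<in> C \<Longrightarrow> g \<in> C \<Longrightarrow> plug (f - g) F = plug f F - plug g F"
  using multider_plug_add[of p F f "- 1 *\<^sub>R g"] multider_plug_scaleR[of p F g "-1"] scaleR_closed[of g "-1"]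
  by simp

lemma multider_mem: "multider p F \<Longrightarrow> F vs \<in> C"
proof (induction vs arbitrary: p F)
  case Nil
  then show ?case by (rule multider_Nil)
next
  case (Cons v vs)
  then show ?case
    using Cons.IH[OF multider_plug[OF Cons.prems]] by (simp add: plug_def)
qed

lemma multider_parity: "multider p F \<Longrightarrow> parity p F"
proof -
  have "F vs = 0" if "odd (length vs + p)" "multider p F" for vs
    using that
  proof (induction vs arbitrary: p F)
    case Nil
    then show ?case by (auto intro: multider_odd_Nil)
  next
    case (Cons v vs)
    have "plug v F vs = 0"
      using Cons.prems by (intro Cons.IH[OF _ multider_plug]) auto
    then show ?case by (simp only: plug_apply)
  qed
  then show "multider p F \<Longrightarrow> parity p F" unfolding parity_def by blast
qed

lemma front_der_parity_cong: "even p = even q \<Longrightarrow> front_der p = front_der q"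
  unfolding front_der_def fun_eq_iff by simp

lemma multider_parity_cong: "even p = even q \<Longrightarrow> multider p = multider q"
proof
  fix F assume "even p = even q"
  then have "front_der (p + n) = front_der (q + n)" for n
    by (intro front_der_parity_cong) auto
  then show "multider p F = multider q F" by (simp add: multider_def)
qed

lemma front_der_zero: "front_der p 0"
  by (simp add: front_der_def zero_closed) (simp add: fun_eq_iff)

lemma front_der_linear:
  assumes F: "front_der p F" and G: "front_der p G" and a: "a \<in> C" and b: "b \<in> C"
  shows "front_der p (scl a F + scl b G)"
proof -
  have "plug g (plug f (scl a F + scl b G)) = - plug f (plug g (scl a F + scl b G))" for f g
  proof -
    have "plug g (plug f F) = - plug f (plug g F)" "plug g (plug f G) = - plug f (plug g G)"
      using F G unfolding front_der_def by blast+
    then show ?thesis by (simp add: fun_eq_iff)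
  qed
  moreover have "plug (f * g) (scl a F + scl b G)
      = scl f (plug g (scl a F + scl b G)) + scl g (plug f (scl a F + scl b G))"
    if "f \<in> C" "g \<in> C" for f g
  proof -
    have "plug (f * g) F = scl f (plug g F) + scl g (plug f F)"
      "plug (f * g) G = scl f (plug g G) + scl g (plug f G)"
      using F G that unfolding front_der_def by blast+
    then show ?thesis by (simp add: fun_eq_iff algebra_simps)
  qed
  moreover have "plug (f + g) (scl a F + scl b G)
      = plug f (scl a F + scl b G) + plug g (scl a F + scl b G)"
    if "f \<in> C" "g \<in> C" for f g
  proof -
    have "plug (f + g) F = plug f F + plug g F" "plug (f + g) G = plug f G + plug g G"
      using F G that unfolding front_der_def by blast+
    then show ?thesis by (simp add: fun_eq_iff algebra_simps)
  qed
  moreover have "plug (c *\<^sub>R f) (scl a F + scl b G) = c *\<^sub>R plug f (scl a F + scl b G)"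
    if "f \<in> C" for c f
  proof -
    have "plug (c *\<^sub>R f) F = c *\<^sub>R plug f F" "plug (c *\<^sub>R f) G = c *\<^sub>R plug f G"
      using F G that unfolding front_der_def by blast+
    then show ?thesis by (simp add: fun_eq_iff algebra_simps)
  qed
  moreover have "plug f (scl a F + scl b G) = 0" if "f \<notin> C" for f
  proof -
    have "plug f F = 0" "plug f G = 0"
      using F G that unfolding front_der_def by blast+
    then show ?thesis by (simp add: fun_eq_iff)
  qed
  moreover have "(scl a F + scl b G) [] \<in> C" "odd p \<longrightarrow> (scl a F + scl b G) [] = 0"
    using F G a b unfolding front_der_def by (auto intro: closed)
  ultimately show ?thesis
    unfolding front_der_def by blast
qed

lemma scl_simps [simp]: "scl 1 F = F" "scl 0 F = 0" for F :: "'v list \<Rightarrow> 'c"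
  by (auto simp: fun_eq_iff)

lemma of_real_closed: "of_real r \<in> C"
  using scaleR_closed[OF one_closed, of r] by (simp add: of_real_def)

lemma front_der_add: "front_der p F \<Longrightarrow> front_der p G \<Longrightarrow> front_der p (F + G)"
  using front_der_linear[of p F G 1 1] by (simp add: one_closed)

lemma front_der_scl: "front_der p F \<Longrightarrow> f \<in> C \<Longrightarrow> front_der p (scl f F)"
  using front_der_linear[of p F 0 f 0] by (simp add: zero_closed front_der_zero)

lemma front_der_scaleR: "front_der p F \<Longrightarrow> front_der p (c *\<^sub>R F)"
  by (simp add: scaleR_eq_scl front_der_scl of_real_closed)

lemma multider_zero: "multider p 0"
  by (simp add: multider_def front_der_zero)

lemma multider_add: "multider p F \<Longrightarrow> multider p G \<Longrightarrow> multider p (F + G)"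
  by (simp add: multider_def front_der_add)

lemma multider_scaleR: "multider p F \<Longrightarrow> multider p (c *\<^sub>R F)"
  by (simp add: multider_def front_der_scaleR)

lemma multider_scl: "multider p F \<Longrightarrow> f \<in> C \<Longrightarrow> multider p (scl f F)"
  by (simp add: multider_def front_der_scl)

lemma multider_sum: "(\<And>i. i \<in> S \<Longrightarrow> multider p (F i)) \<Longrightarrow> multider p (sum F S)"
  by (induction S rule: infinite_finite_induct) (simp_all only: sum.infinite sum.empty sum.insert multider_zero multider_add insert_iff simp_thms)

lemma multider_twist: "multider p F \<Longrightarrow> multider p (twist F)"
  using twist_parity[OF multider_parity] multider_scaleR by metis

lemma multider_wdg:
  assumes "multider p F" "multider q G"
  shows "multider (p + q) (wdg F G)"
proof -
  \<comment> \<open>It is enough to verify the conditions on the first argument, for all degrees and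
    factors, since \<open>after vs\<close> of a product is a sum of products of the same kind. The
    proofs for the bracket and for \<open>pull\<close> are divided likewise.\<close>
  have front: "front_der (p + q) (wdg F G)" if F: "multider p F" and G: "multider q G" for p q F G
  proof -
    have "wdg F G [] \<in> C"
      by (simp add: closed multider_Nil[OF F] multider_Nil[OF G])
    moreover have "odd (p + q) \<longrightarrow> wdg F G [] = 0"
      using multider_odd_Nil[OF F] multider_odd_Nil[OF G] by auto
    moreover have "plug f (wdg F G) = 0" if "f \<notin> C" for f
      using that by (simp add: plug_wdg multider_plug_out[OF F] multider_plug_out[OF G])
    moreover have "plug (f + g) (wdg F G) = plug f (wdg F G) + plug g (wdg F G)"
      if "f \<in> C" "g \<in> C" for f g
      using that by (simp add: plug_wdg multider_plug_add[OF F] multider_plug_add[OF G])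
    moreover have "plug (c *\<^sub>R f) (wdg F G) = c *\<^sub>R plug f (wdg F G)" if "f \<in> C" for c f
      using that by (simp add: plug_wdg multider_plug_scaleR[OF F] multider_plug_scaleR[OF G] scaleR_add_right)
    moreover have "plug (f * g) (wdg F G) = scl f (plug g (wdg F G)) + scl g (plug f (wdg F G))"
      if "f \<in> C" "g \<in> C" for f g
      using that
      by (simp add: plug_wdg multider_plug_mult[OF F] multider_plug_mult[OF G])
        (simp add: fun_eq_iff algebra_simps)
    moreover have "plug g (plug f (wdg F G)) = - plug f (plug g (wdg F G))" for f g
      by (simp add: plug_wdg multider_plug_swap[OF F, of g f] multider_plug_swap[OF G, of g f])
    ultimately show ?thesis
      unfolding front_der_def by blast
  qed
  have "front_der (p + q + length vs) (after vs (wdg F G))" for vs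
    using assms
  proof (induction vs arbitrary: p q F G)
    case Nil
    then show ?case using front by simp
  next
    case (Cons v vs)
    have "front_der (Suc p + q + length vs) (after vs (wdg (plug v F) G))"
      by (rule Cons.IH[OF multider_plug[OF Cons.prems(1)] Cons.prems(2)])
    moreover have "front_der (p + Suc q + length vs) (after vs (wdg (twist F) (plug v G)))"
      by (rule Cons.IH[OF multider_twist[OF Cons.prems(1)] multider_plug[OF Cons.prems(2)]])
    ultimately have "front_der (p + q + length (v # vs)) (after (v # vs) (wdg F G))"
      by (simp add: plug_wdg front_der_add)
    then show ?case .
  qed
  then show ?thesis by (simp add: multider_def)
qed

section \<open>Linearity and product rules of the bracket\<close>

lemma insertion_add_right:
  assumes "multider p F" "\<And>vs. G vs \<in> C" "\<And>vs. H vs \<in> C"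
  shows "insertion F (G + H) = insertion F G + insertion F H"
proof
  fix vs show "insertion F (G + H) vs = (insertion F G + insertion F H) vs"
    using assms
  proof (induction vs arbitrary: p F G H)
    case Nil
    have "insertion F (G + H) [] = (insertion F G + insertion F H) []"
      using multider_plug_add[OF Nil(1,2,3), of "[]" "[]"] by (simp add: fun_eq_iff)
    then show ?case .
  next
    case (Cons v vs)
    have "insertion (plug v F) (G + H) vs = (insertion (plug v F) G + insertion (plug v F) H) vs"
      by (rule Cons.IH[OF multider_plug]) (rule Cons.prems)+
    moreover have "insertion (twist F) (plug v G + plug v H) vs
      = (insertion (twist F) (plug v G) + insertion (twist F) (plug v H)) vs"
      by (rule Cons.IH[OF multider_twist[OF Cons.prems(1)]]) (simp_all add: Cons.prems)
    ultimately have "insertion F (G + H) (v # vs) = (insertion F G + insertion F H) (v # vs)"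
      by (simp add: insertion_Cons)
    then show ?case .
  qed
qed

text \<open>\<open>F\<close> is a derivation in the slot that receives \<open>f\<close> times the
  value of \<open>G\<close>. In the extra term \<open>f\<close> stands in the last slot; moving it
  to the front passes all other arguments, whence the \<open>twist\<close>.\<close>

lemma insertion_scl_right:
  assumes "multider p F" "\<And>vs. G vs \<in> C" "f \<in> C"
  shows "insertion F (scl f G) = scl f (insertion F G) + wdg (twist (plug f F)) G"
proof
  fix vs show "insertion F (scl f G) vs = (scl f (insertion F G) + wdg (twist (plug f F)) G) vs"
    using assms
  proof (induction vs arbitrary: p F G)
    case Nil
    have "insertion F (scl f G) [] = (scl f (insertion F G) + wdg (twist (plug f F)) G) []"
      using multider_plug_mult[OF Nil(1,3,2), of "[]"] by (simp add: fun_eq_iff algebra_simps)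
    then show ?case .
  next
    case (Cons v vs)
    have "insertion (plug v F) (scl f G) vs
        = (scl f (insertion (plug v F) G) + wdg (twist (plug f (plug v F))) G) vs"
      by (rule Cons.IH[OF multider_plug]) (rule Cons.prems)+
    moreover have "insertion (twist F) (scl f (plug v G)) vs
        = (scl f (insertion (twist F) (plug v G)) + wdg (twist (plug f (twist F))) (plug v G)) vs"
      by (rule Cons.IH[OF multider_twist[OF Cons.prems(1)]]) (simp_all add: Cons.prems)
    ultimately have "insertion F (scl f G) (v # vs) = (scl f (insertion F G) + wdg (twist (plug f F)) G) (v # vs)"
      by (simp add: insertion_Cons wdg_Cons multider_plug_swap[OF Cons.prems(1), of v f] algebra_simps)
    then show ?case .
  qed
qed

lemma insertion_scaleR_right:
  assumes "multider p F" "\<And>vs. G vs \<in> C"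
  shows "insertion F (c *\<^sub>R G) = c *\<^sub>R insertion F G"
proof
  fix vs show "insertion F (c *\<^sub>R G) vs = (c *\<^sub>R insertion F G) vs"
    using assms
  proof (induction vs arbitrary: p F G)
    case Nil
    have "insertion F (c *\<^sub>R G) [] = (c *\<^sub>R insertion F G) []"
      using multider_plug_scaleR[OF Nil(1,2), of c "[]"] by (simp add: fun_eq_iff)
    then show ?case .
  next
    case (Cons v vs)
    have "insertion (plug v F) (c *\<^sub>R G) vs = (c *\<^sub>R insertion (plug v F) G) vs"
      by (rule Cons.IH[OF multider_plug]) (rule Cons.prems)+
    moreover have "insertion (twist F) (c *\<^sub>R plug v G) vs = (c *\<^sub>R insertion (twist F) (plug v G)) vs"
      by (rule Cons.IH[OF multider_twist[OF Cons.prems(1)]]) (simp_all add: Cons.prems)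
    ultimately have "insertion F (c *\<^sub>R G) (v # vs) = (c *\<^sub>R insertion F G) (v # vs)"
      by (simp add: insertion_Cons algebra_simps)
    then show ?case .
  qed
qed

lemma bracket_add_left:
  assumes "multider p F" "multider p F'" "multider q G"
  shows "bracket p q (F + F') G = bracket p q F G + bracket p q F' G"
  by (simp add: bracket_def insertion_add_right[OF assms(3) multider_mem[OF assms(1)] multider_mem[OF assms(2)]]
      algebra_simps)

lemma bracket_add_right:
  assumes "multider p F" "multider q G" "multider q G'"
  shows "bracket p q F (G + G') = bracket p q F G + bracket p q F G'"
  by (simp add: bracket_def insertion_add_right[OF assms(1) multider_mem[OF assms(2)] multider_mem[OF assms(3)]]
      algebra_simps)

lemma bracket_scaleR_left:
  assumes "multider p F" "multider q G"
  shows "bracket p q (c *\<^sub>R F) G = c *\<^sub>R bracket p q F G"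
  by (simp add: bracket_def insertion_scaleR_right[OF assms(2) multider_mem[OF assms(1)]] scaleR_diff_right scaleR_add_right mult.commute)

lemma bracket_scaleR_right:
  assumes "multider p F" "multider q G"
  shows "bracket p q F (c *\<^sub>R G) = c *\<^sub>R bracket p q F G"
  by (simp add: bracket_def insertion_scaleR_right[OF assms(1) multider_mem[OF assms(2)]] scaleR_diff_right scaleR_add_right mult.commute)

lemma bracket_scl_left:
  assumes "multider p F" "multider q G" "f \<in> C"
  shows "bracket p q (scl f F) G = scl f (bracket p q F G) - ((-1) ^ (p * (q + 1))) *\<^sub>R wdg (plug f G) F"
  by (cases "even p"; cases "even q")
    (simp_all add: bracket_def insertion_scl_right[OF assms(2) multider_mem[OF assms(1)] assms(3)]
      twist_parity[OF multider_parity[OF multider_plug[OF assms(2)]]], simp_all add: fun_eq_iff algebra_simps)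

lemma bracket_scl_right:
  assumes "multider p F" "multider q G" "f \<in> C"
  shows "bracket p q F (scl f G) = scl f (bracket p q F G) + ((-1) ^ (p + 1)) *\<^sub>R wdg (plug f F) G"
  by (cases "even p"; cases "even q")
    (simp_all add: bracket_def insertion_scl_right[OF assms(1) multider_mem[OF assms(2)] assms(3)]
      twist_parity[OF multider_parity[OF multider_plug[OF assms(1)]]], simp_all add: fun_eq_iff algebra_simps)

lemma bracket_zero_left: "multider q G \<Longrightarrow> bracket p q 0 G = 0"
  using bracket_scaleR_left[OF multider_zero, of q G p 0] by simp

lemma bracket_zero_right: "multider p F \<Longrightarrow> bracket p q F 0 = 0"
  using bracket_scaleR_right[OF _ multider_zero, of p F q 0] by simp

lemma bracket_minus_left: "multider p F \<Longrightarrow> multider q G \<Longrightarrow> bracket p q (- F) G = - bracket p q F G"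
  using bracket_scaleR_left[of p F q G "-1"] by simp

lemma bracket_minus_right: "multider p F \<Longrightarrow> multider q G \<Longrightarrow> bracket p q F (- G) = - bracket p q F G"
  using bracket_scaleR_right[of p F q G "-1"] by simp

lemma bracket_sum_left:
  assumes "\<And>i. i \<in> S \<Longrightarrow> multider p (F i)" "multider q G"
  shows "bracket p q (sum F S) G = (\<Sum>i\<in>S. bracket p q (F i) G)"
  using assms
proof (induction S rule: infinite_finite_induct)
  case (insert x S)
  have "bracket p q (F x + sum F S) G = bracket p q (F x) G + bracket p q (sum F S) G"
    by (rule bracket_add_left) (auto intro: multider_sum insert.prems)
  moreover have "bracket p q (sum F S) G = (\<Sum>i\<in>S. bracket p q (F i) G)"
    using insert by blast
  ultimately have "bracket p q (sum F (insert x S)) G = (\<Sum>i\<in>insert x S. bracket p q (F i) G)"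
    by (simp only: sum.insert[OF insert.hyps])
  then show ?case .
qed (simp_all only: sum.infinite sum.empty bracket_zero_left simp_thms)

lemma bracket_sum_right:
  assumes "multider p F" "\<And>i. i \<in> S \<Longrightarrow> multider q (G i)"
  shows "bracket p q F (sum G S) = (\<Sum>i\<in>S. bracket p q F (G i))"
  using assms
proof (induction S rule: infinite_finite_induct)
  case (insert x S)
  have "bracket p q F (G x + sum G S) = bracket p q F (G x) + bracket p q F (sum G S)"
    by (rule bracket_add_right) (auto intro: multider_sum insert.prems)
  moreover have "bracket p q F (sum G S) = (\<Sum>i\<in>S. bracket p q F (G i))"
    using insert by blast
  ultimately have "bracket p q F (sum G (insert x S)) = (\<Sum>i\<in>insert x S. bracket p q F (G i))"
    by (simp only: sum.insert[OF insert.hyps])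
  then show ?case .
qed (simp_all only: sum.infinite sum.empty bracket_zero_right simp_thms)

lemma multider_bracket:
  assumes "multider p F" "multider q G"
  shows "multider (p + q + 1) (bracket p q F G)"
proof -
  have front: "front_der (p + q + 1) (bracket p q F G)" if F: "multider p F" and G: "multider q G" for p q F G
  proof -
    note pb = plug_bracket[OF multider_parity[OF F] multider_parity[OF G]]
    note Fp = multider_plug[OF F] and Gp = multider_plug[OF G]
    have "bracket p q F G [] \<in> C"
      unfolding bracket_Nil by (intro closed multider_mem[OF F] multider_mem[OF G])
    \<comment> \<open>Here \<open>p\<close> and \<open>q\<close> have equal parity. Even degrees
      leave no values on single arguments; odd degrees leave no values on the empty list, and
      \<open>F [0] = 0\<close>.\<close>
    moreover have "bracket p q F G [] = 0" if "odd (p + q + 1)"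
    proof (cases "even p")
      case True
      then have "F [x] = 0" "G [x] = 0" for x
        using that multider_odd_Nil[OF Fp[of x]] multider_odd_Nil[OF Gp[of x]] by auto
      then show ?thesis by (simp add: bracket_Nil)
    next
      case False
      then have "F [] = 0" "G [] = 0"
        using that multider_odd_Nil[OF F] multider_odd_Nil[OF G] by auto
      moreover have "F [0] = 0" "G [0] = 0"
        using multider_plug_zero[OF F] multider_plug_zero[OF G] by (auto simp: fun_eq_iff)
      ultimately show ?thesis by (simp add: bracket_Nil)
    qed
    moreover have "plug f (bracket p q F G) = 0" if "f \<notin> C" for f
      using that by (simp add: pb multider_plug_out[OF F] multider_plug_out[OF G]
        bracket_zero_left[OF G] bracket_zero_right[OF F])
    moreover have "plug (f + g) (bracket p q F G) = plug f (bracket p q F G) + plug g (bracket p q F G)"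
      if "f \<in> C" "g \<in> C" for f g
      using that by (simp add: pb multider_plug_add[OF F] multider_plug_add[OF G]
        bracket_add_left[OF Fp Fp G] bracket_add_right[OF F Gp Gp] scaleR_add_right del: power_Suc)
    moreover have "plug (c *\<^sub>R f) (bracket p q F G) = c *\<^sub>R plug f (bracket p q F G)" if "f \<in> C" for c f
      using that by (simp add: pb multider_plug_scaleR[OF F] multider_plug_scaleR[OF G]
        bracket_scaleR_left[OF Fp G] bracket_scaleR_right[OF F Gp] scaleR_add_right mult.commute del: power_Suc)
    moreover have "plug (f * g) (bracket p q F G) = scl f (plug g (bracket p q F G)) + scl g (plug f (bracket p q F G))"
      if f: "f \<in> C" and g: "g \<in> C" for f g
    proof -
      \<comment> \<open>The product rules leave terms in which one factor differentiates
        \<open>f\<close> and the other \<open>g\<close>. They cancel in pairs by graded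
        commutativity, as in the proof that a commutator of derivations is a derivation.\<close>
      have comm: "wdg (plug u F) (plug v G) = (-1) ^ (Suc p * Suc q) *\<^sub>R wdg (plug v G) (plug u F)" for u v
        by (rule wdg_commute[OF multider_parity[OF Fp] multider_parity[OF Gp]])
      show ?thesis
        by (cases "even p"; cases "even q")
          (simp_all add: pb multider_plug_mult[OF F f g] multider_plug_mult[OF G f g]
            bracket_add_left[OF multider_scl[OF Fp f] multider_scl[OF Fp g] G]
            bracket_add_right[OF F multider_scl[OF Gp f] multider_scl[OF Gp g]]
            bracket_scl_left[OF Fp G f] bracket_scl_left[OF Fp G g]
            bracket_scl_right[OF F Gp f] bracket_scl_right[OF F Gp g] comm,
           simp_all add: fun_eq_iff algebra_simps)
    qed
    moreover have "plug g (plug f (bracket p q F G)) = - plug f (plug g (bracket p q F G))" for f g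
      by (cases "even p")
        (simp_all add: pb plug_bracket[OF multider_parity[OF Fp] multider_parity[OF G]]
         plug_bracket[OF multider_parity[OF F] multider_parity[OF Gp]]
         multider_plug_swap[OF F, of g f] multider_plug_swap[OF G, of g f]
         bracket_minus_left[OF multider_plug[OF Fp] G] bracket_minus_right[OF F multider_plug[OF Gp]])
    ultimately show ?thesis unfolding front_der_def by blast
  qed
  have "front_der (p + q + 1 + length vs) (after vs (bracket p q F G))" for vs
    using assms
  proof (induction vs arbitrary: p q F G)
    case Nil
    then show ?case using front by simp
  next
    case (Cons v vs)
    have "front_der (Suc p + q + 1 + length vs) (after vs (bracket (Suc p) q (plug v F) G))"
      by (rule Cons.IH[OF multider_plug[OF Cons.prems(1)] Cons.prems(2)])
    moreover have "front_der (p + Suc q + 1 + length vs) (after vs (bracket p (Suc q) F (plug v G)))"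
      by (rule Cons.IH[OF Cons.prems(1) multider_plug[OF Cons.prems(2)]])
    ultimately have "front_der (p + q + 1 + length (v # vs)) (after (v # vs) (bracket p q F G))"
      by (simp add: plug_bracket[OF multider_parity[OF Cons.prems(1)] multider_parity[OF Cons.prems(2)]]
          front_der_add front_der_scaleR del: power_Suc)
    then show ?case .
  qed
  then show ?thesis by (simp add: multider_def)
qed

end

section \<open>Leibniz rules and the graded Jacobi identity\<close>

context function_algebra begin

lemma multider_single_even: "multider p F \<Longrightarrow> even p \<Longrightarrow> F [x] = 0"
  using multider_odd_Nil[OF multider_plug[of p F x]] by simp

lemma multider_double_odd: "multider p F \<Longrightarrow> odd p \<Longrightarrow> F [x, y] = 0"
  using multider_odd_Nil[OF multider_plug[OF multider_plug[of p F x]], of y] by simp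

text \<open>Needed for the nested brackets in the base case of the Jacobi identity, and for
  \<open>p = q = 1\<close>, where it is the commutator of vector fields.\<close>

lemma bracket_single:
  assumes "multider p F" "multider q G"
  shows "bracket p q F G [h] = F [h, G []] - (-1) ^ (p * (q + 1)) *\<^sub>R G [F [h]]
    + (-1) ^ (p + 1) *\<^sub>R (F [G [h]] - (-1) ^ ((p + 1) * q) *\<^sub>R G [h, F []])"
proof -
  have "bracket p q F G [h] = plug h (bracket p q F G) []"
    by simp
  also have "\<dots> = F [h, G []] - (-1) ^ (p * (q + 1)) *\<^sub>R G [F [h]]
    + (-1) ^ (p + 1) *\<^sub>R (F [G [h]] - (-1) ^ ((p + 1) * q) *\<^sub>R G [h, F []])"
    unfolding plug_bracket[OF multider_parity[OF assms(1)] multider_parity[OF assms(2)]]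
    by (cases "even p"; cases "even q") (simp_all add: bracket_Nil)
  finally show ?thesis .
qed

theorem bracket_wdg_right:
  assumes "multider p P" "multider q Q" "multider r R"
  shows "bracket p (q + r) P (wdg Q R) =
    wdg (bracket p q P Q) R + ((-1) ^ ((p + 1) * q)) *\<^sub>R wdg Q (bracket p r P R)"
proof
  fix vs show "bracket p (q + r) P (wdg Q R) vs =
    (wdg (bracket p q P Q) R + ((-1) ^ ((p + 1) * q)) *\<^sub>R wdg Q (bracket p r P R)) vs"
    using assms
  proof (induction vs arbitrary: p q r P Q R)
    case (Nil p q r P Q R)
    note P = Nil(1) and Q = Nil(2) and R = Nil(3)
    \<comment> \<open>For odd \<open>p\<close> the claim on the empty list is the product rule of
      \<open>P\<close> in one argument. For even \<open>p\<close> it is the Leibniz rule for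
      plugging \<open>P []\<close> into \<open>wdg Q R\<close>.\<close>
    have "P [Q [] * R []] = Q [] * P [R []] + R [] * P [Q []]"
      using multider_plug_mult[OF P multider_Nil[OF Q] multider_Nil[OF R]] by (simp add: fun_eq_iff)
    moreover have "P [0] = 0" "Q [0] = 0" "R [0] = 0"
      using multider_plug_zero[OF P] multider_plug_zero[OF Q] multider_plug_zero[OF R]
      by (simp_all add: fun_eq_iff)
    ultimately have "bracket p (q + r) P (wdg Q R) [] =
      (wdg (bracket p q P Q) R + ((-1) ^ ((p + 1) * q)) *\<^sub>R wdg Q (bracket p r P R)) []"
      by (cases "even p"; cases "even q"; cases "even r")
        (simp_all add: bracket_Nil wdg_Cons multider_odd_Nil[OF P] multider_odd_Nil[OF Q] multider_odd_Nil[OF R]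
          multider_single_even[OF P] multider_single_even[OF Q] multider_single_even[OF R] algebra_simps)
    then show ?case .
  next
    case (Cons v vs p q r P Q R)
    note P = Cons.prems(1) and Q = Cons.prems(2) and R = Cons.prems(3)
    note [simp] = plug_bracket[OF multider_parity[OF P] multider_parity[OF Q]] plug_bracket[OF multider_parity[OF P] multider_parity[OF R]]
      plug_bracket[OF multider_parity[OF P] parity_wdg[OF multider_parity[OF Q] multider_parity[OF R]]]
    \<comment> \<open>Additivity of \<open>bracket\<close> holds for multiderivations only, so the
      plugged product is split beforehand, with degrees regrouped to fit the induction
      hypotheses.\<close>
    have c: "bracket p (Suc (q + r)) P (wdg (plug v Q) R + (-1) ^ q *\<^sub>R wdg Q (plug v R))
        = bracket p (Suc q + r) P (wdg (plug v Q) R)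
        + (-1) ^ q *\<^sub>R bracket p (q + Suc r) P (wdg Q (plug v R))"
      using multider_wdg[OF multider_plug[OF Q, of v] R] multider_wdg[OF Q multider_plug[OF R, of v]]
      by (simp add: bracket_add_right[OF P] multider_scaleR bracket_scaleR_right[OF P])
    have "bracket (Suc p) (q + r) (plug v P) (wdg Q R) vs =
      (wdg (bracket (Suc p) q (plug v P) Q) R + ((-1) ^ ((Suc p + 1) * q)) *\<^sub>R wdg Q (bracket (Suc p) r (plug v P) R)) vs"
      by (rule Cons.IH[OF multider_plug[OF P] Q R])
    moreover have "bracket p (Suc q + r) P (wdg (plug v Q) R) vs =
      (wdg (bracket p (Suc q) P (plug v Q)) R + ((-1) ^ ((p + 1) * Suc q)) *\<^sub>R wdg (plug v Q) (bracket p r P R)) vs"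
      by (rule Cons.IH[OF P multider_plug[OF Q] R])
    moreover have "bracket p (q + Suc r) P (wdg Q (plug v R)) vs =
      (wdg (bracket p q P Q) (plug v R) + ((-1) ^ ((p + 1) * q)) *\<^sub>R wdg Q (bracket p (Suc r) P (plug v R))) vs"
      by (rule Cons.IH[OF P Q multider_plug[OF R]])
    ultimately have "plug v (bracket p (q + r) P (wdg Q R)) vs =
      plug v (wdg (bracket p q P Q) R + ((-1) ^ ((p + 1) * q)) *\<^sub>R wdg Q (bracket p r P R)) vs"
      unfolding plug_bracket[OF multider_parity[OF P] parity_wdg[OF multider_parity[OF Q] multider_parity[OF R]]]
        plug_wdg plug_simps twist_parity[OF multider_parity[OF Q]] twist_parity[OF multider_parity[OF multider_bracket[OF P Q]]]
        plug_bracket[OF multider_parity[OF P] multider_parity[OF Q]] plug_bracket[OF multider_parity[OF P] multider_parity[OF R]]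
        wdg_scaleR_left c
      by (cases "even p"; cases "even q"; cases "even r") (simp_all add: algebra_simps)
    then show ?case by (simp only: plug_apply)
  qed
qed

theorem bracket_wdg_left:
  assumes "multider p P" "multider q Q" "multider r R"
  shows "bracket (q + r) p (wdg Q R) P =
    wdg Q (bracket r p R P) + ((-1) ^ (r * (p + 1))) *\<^sub>R wdg (bracket q p Q P) R"
  unfolding bracket_swap[of "q + r" p] bracket_swap[of r p] bracket_swap[of q p] bracket_wdg_right[OF assms]
  by (cases "even p"; cases "even q"; cases "even r") (simp_all add: algebra_simps)

theorem bracket_jacobi:
  assumes "multider p P" "multider q Q" "multider r R"
  shows "bracket p (q + r + 1) P (bracket q r Q R) =
    bracket (p + q + 1) r (bracket p q P Q) R
    + ((-1) ^ ((p + 1) * (q + 1))) *\<^sub>R bracket q (p + r + 1) Q (bracket p r P R)"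
proof
  fix vs show "bracket p (q + r + 1) P (bracket q r Q R) vs =
    (bracket (p + q + 1) r (bracket p q P Q) R
    + ((-1) ^ ((p + 1) * (q + 1))) *\<^sub>R bracket q (p + r + 1) Q (bracket p r P R)) vs"
    using assms
  proof (induction vs arbitrary: p q r P Q R)
    case (Nil p q r P Q R)
    note P = Nil(1) and Q = Nil(2) and R = Nil(3)
    have zero: "F [0] = 0" "F [0, a] = 0" "F [a, 0] = 0" if "multider k F" for k F a
      using multider_plug_zero[OF that] multider_plug_zero[OF multider_plug[OF that]]
      by (simp_all add: fun_eq_iff)
    have lin: "F [a + b] = F [a] + F [b]" "F [a - b] = F [a] - F [b]"
      if "multider k F" "a \<in> C" "b \<in> C" for k F a b
      using multider_plug_add[OF that] multider_plug_diff[OF that] by (simp_all add: fun_eq_iff)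
    have neg: "F [- a] = - F [a]" if "multider k F" "a \<in> C" for k F a
      using lin(2)[OF that(1) zero_closed that(2)] zero[OF that(1)] by simp
    note mem = multider_mem[OF P] multider_mem[OF Q] multider_mem[OF R]
    note lins = zero[OF P] zero[OF Q] zero[OF R] lin[OF P] lin[OF Q] lin[OF R] neg[OF P] neg[OF Q] neg[OF R]
    have swap: "F [b, a] = - F [a, b]" if "multider k F" for k F a b
      using multider_plug_swap[OF that, of a b] by (simp add: fun_eq_iff)
    have "bracket p (q + r + 1) P (bracket q r Q R) [] =
      (bracket (p + q + 1) r (bracket p q P Q) R
      + ((-1) ^ ((p + 1) * (q + 1))) *\<^sub>R bracket q (p + r + 1) Q (bracket p r P R)) []"
      \<comment> \<open>What survives for parity reasons are iterated terms such as
        \<open>P [Q [R []]]\<close>, which match, and second-order terms such as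
        \<open>P [Q [], R []]\<close>, which need skew symmetry.\<close>
      using swap[OF P, of "Q []" "R []"] swap[OF Q, of "P []" "R []"] swap[OF R, of "P []" "Q []"]
      unfolding bracket_Nil bracket_single[OF Q R] bracket_single[OF P Q] bracket_single[OF P R]
        plus_fun_apply scaleR_fun_apply
      by (cases "even p"; cases "even q"; cases "even r")
        (simp_all add: multider_odd_Nil[OF P] multider_odd_Nil[OF Q] multider_odd_Nil[OF R]
          multider_single_even[OF P] multider_single_even[OF Q] multider_single_even[OF R] 
          multider_double_odd[OF P] multider_double_odd[OF Q] multider_double_odd[OF R] mem lins closed algebra_simps)
    then show ?case .
  next
    case (Cons v vs p q r P Q R)
    note P = Cons.prems(1) and Q = Cons.prems(2) and R = Cons.prems(3)
    note p_QR = plug_bracket[OF multider_parity[OF Q] multider_parity[OF R]]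
      and p_PQ = plug_bracket[OF multider_parity[OF P] multider_parity[OF Q]]
      and p_PR = plug_bracket[OF multider_parity[OF P] multider_parity[OF R]]
    have c1: "bracket p (Suc (q + r + 1)) P (plug v (bracket q r Q R))
        = bracket p (Suc q + r + 1) P (bracket (Suc q) r (plug v Q) R)
        + (-1) ^ (q + 1) *\<^sub>R bracket p (q + Suc r + 1) P (bracket q (Suc r) Q (plug v R))"
      using multider_bracket[OF multider_plug[OF Q, of v] R] multider_bracket[OF Q multider_plug[OF R, of v]]
      by (simp add: p_QR bracket_add_right[OF P] multider_scaleR bracket_scaleR_right[OF P] del: power_Suc)
    have c2: "bracket q (Suc (p + r + 1)) Q (plug v (bracket p r P R))
        = bracket q (Suc p + r + 1) Q (bracket (Suc p) r (plug v P) R)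
        + (-1) ^ (p + 1) *\<^sub>R bracket q (p + Suc r + 1) Q (bracket p (Suc r) P (plug v R))"
      using multider_bracket[OF multider_plug[OF P, of v] R] multider_bracket[OF P multider_plug[OF R, of v]]
      by (simp add: p_PR bracket_add_right[OF Q] multider_scaleR bracket_scaleR_right[OF Q] del: power_Suc)
    have c3: "bracket (Suc (p + q + 1)) r (plug v (bracket p q P Q)) R
        = bracket (Suc p + q + 1) r (bracket (Suc p) q (plug v P) Q) R
        + (-1) ^ (p + 1) *\<^sub>R bracket (p + Suc q + 1) r (bracket p (Suc q) P (plug v Q)) R"
      using multider_bracket[OF multider_plug[OF P, of v] Q] multider_bracket[OF P multider_plug[OF Q, of v]]
      by (simp add: p_PQ bracket_add_left[OF _ _ R] multider_scaleR bracket_scaleR_left[OF _ R] del: power_Suc)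
    have "bracket (Suc p) (q + r + 1) (plug v P) (bracket q r Q R) vs =
      (bracket (Suc p + q + 1) r (bracket (Suc p) q (plug v P) Q) R
      + ((-1) ^ ((Suc p + 1) * (q + 1))) *\<^sub>R bracket q (Suc p + r + 1) Q (bracket (Suc p) r (plug v P) R)) vs"
      by (rule Cons.IH[OF multider_plug[OF P] Q R])
    moreover have "bracket p (Suc q + r + 1) P (bracket (Suc q) r (plug v Q) R) vs =
      (bracket (p + Suc q + 1) r (bracket p (Suc q) P (plug v Q)) R
      + ((-1) ^ ((p + 1) * (Suc q + 1))) *\<^sub>R bracket (Suc q) (p + r + 1) (plug v Q) (bracket p r P R)) vs"
      by (rule Cons.IH[OF P multider_plug[OF Q] R])
    moreover have "bracket p (q + Suc r + 1) P (bracket q (Suc r) Q (plug v R)) vs =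
      (bracket (p + q + 1) (Suc r) (bracket p q P Q) (plug v R)
      + ((-1) ^ ((p + 1) * (q + 1))) *\<^sub>R bracket q (p + Suc r + 1) Q (bracket p (Suc r) P (plug v R))) vs"
      by (rule Cons.IH[OF P Q multider_plug[OF R]])
    ultimately have "plug v (bracket p (q + r + 1) P (bracket q r Q R)) vs =
      plug v (bracket (p + q + 1) r (bracket p q P Q) R
      + ((-1) ^ ((p + 1) * (q + 1))) *\<^sub>R bracket q (p + r + 1) Q (bracket p r P R)) vs"
      unfolding plug_simps plug_bracket[OF multider_parity[OF P] multider_parity[OF multider_bracket[OF Q R]]]
        plug_bracket[OF multider_parity[OF Q] multider_parity[OF multider_bracket[OF P R]]]
        plug_bracket[OF multider_parity[OF multider_bracket[OF P Q]] multider_parity[OF R]] c1 c2 c3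
      by (cases "even p"; cases "even q"; cases "even r") (simp_all add: algebra_simps)
    then show ?case by (simp only: plug_apply)
  qed
qed

end

section \<open>Quadratic Lie algebras\<close>

locale quadratic_lie =
  fixes br :: "'g::real_vector \<Rightarrow> 'g \<Rightarrow> 'g" and ip :: "'g \<Rightarrow> 'g \<Rightarrow> real"
    and I :: "'i set" and e e' :: "'i \<Rightarrow> 'g"
  assumes quadratic: "quadratic_lie_algebra br ip" and dual: "dual_bases ip I e e'"
begin

lemma bilinear_br: "bilinear br" and br_self: "br x x = 0"
  and bilinear_ip: "bilinear ip" and ip_commute: "ip x y = ip y x"
  and ip_nondegenerate: "(\<And>y. ip x y = 0) \<Longrightarrow> x = 0"
  and ip_invariant: "ip (br x y) z = - ip y (br x z)"
  using quadratic unfolding quadratic_lie_algebra_def by (blast, blast, blast, blast, blast, smt (verit))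

lemma linear_br: "linear (br x)" "linear (\<lambda>y. br y x)" and linear_ip: "linear (ip x)" "linear (\<lambda>y. ip y x)"
  using bilinear_br bilinear_ip by (auto simp: bilinear_def)

lemma br_swap: "br y x = - br x y"
proof -
  have "br y x + br x y = br (x + y) (x + y)"
    unfolding bilinear_ladd[OF bilinear_br] bilinear_radd[OF bilinear_br] by (simp add: br_self)
  then show ?thesis by (simp add: br_self eq_neg_iff_add_eq_0)
qed

lemma finite_I: "finite I"
  and span_e: "span (e ` I) = UNIV" and span_e': "span (e' ` I) = UNIV"
  and ip_e_e': "i \<in> I \<Longrightarrow> j \<in> I \<Longrightarrow> ip (e i) (e' j) = (if i = j then 1 else 0)"
  using dual by (auto simp: dual_bases_def)

lemma ip_eqI: "(\<And>i. i \<in> I \<Longrightarrow> ip x (e i) = ip y (e i)) \<Longrightarrow> x = y"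
  and ip_eqI': "(\<And>i. i \<in> I \<Longrightarrow> ip x (e' i) = ip y (e' i)) \<Longrightarrow> x = y"
proof -
  have *: "x = y" if S: "span S = UNIV" "\<And>s. s \<in> S \<Longrightarrow> ip x s = ip y s" for S
  proof -
    have "ip x z = ip y z" for z
      using linear_eq_on_span[OF linear_ip(1)[of x] linear_ip(1)[of y], of S z] S by auto
    then have "ip (x - y) z = 0" for z
      by (simp add: bilinear_lsub[OF bilinear_ip])
    then show ?thesis using ip_nondegenerate[of "x - y"] by simp
  qed
  show "(\<And>i. i \<in> I \<Longrightarrow> ip x (e i) = ip y (e i)) \<Longrightarrow> x = y"
    using *[OF span_e] by blast
  show "(\<And>i. i \<in> I \<Longrightarrow> ip x (e' i) = ip y (e' i)) \<Longrightarrow> x = y"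
    using *[OF span_e'] by blast
qed

lemma expand_e': "(\<Sum>i\<in>I. ip x (e i) *\<^sub>R e' i) = x"
proof (rule ip_eqI)
  fix j assume j: "j \<in> I"
  have "ip (\<Sum>i\<in>I. ip x (e i) *\<^sub>R e' i) (e j) = (\<Sum>i\<in>I. ip x (e i) * ip (e j) (e' i))"
    by (simp add: linear_sum[OF linear_ip(2)] linear_scale[OF linear_ip(2)] ip_commute[of "e j"])
  also have "\<dots> = ip x (e j)"
    using j finite_I by (simp add: ip_e_e' if_distrib cong: if_cong)
  finally show "ip (\<Sum>i\<in>I. ip x (e i) *\<^sub>R e' i) (e j) = ip x (e j)" .
qed

lemma expand_e: "(\<Sum>i\<in>I. ip x (e' i) *\<^sub>R e i) = x"
proof (rule ip_eqI')
  fix j assume j: "j \<in> I"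
  have "ip (\<Sum>i\<in>I. ip x (e' i) *\<^sub>R e i) (e' j) = (\<Sum>i\<in>I. ip x (e' i) * ip (e i) (e' j))"
    by (simp add: linear_sum[OF linear_ip(2)] linear_scale[OF linear_ip(2)])
  also have "\<dots> = ip x (e' j)"
    using j finite_I by (simp add: ip_e_e' if_distrib cong: if_cong)
  finally show "ip (\<Sum>i\<in>I. ip x (e' i) *\<^sub>R e i) (e' j) = ip x (e' j)" .
qed

lemma linear_expand_e': "linear f \<Longrightarrow> (\<Sum>i\<in>I. ip x (e i) *\<^sub>R f (e' i)) = f x"
  by (subst (2) expand_e'[of x, symmetric]) (simp add: linear_sum linear_scale)

lemma linear_expand_e: "linear f \<Longrightarrow> (\<Sum>i\<in>I. ip x (e' i) *\<^sub>R f (e i)) = f x"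
  by (subst (2) expand_e[of x, symmetric]) (simp add: linear_sum linear_scale)

text \<open>The Casimir element is a symmetric tensor: written in the \<open>e'\<close> alone, its
  coefficients form the symmetric matrix \<open>ip (e i) (e j)\<close>.\<close>

lemma casimir_swap:
  assumes "bilinear B"
  shows "(\<Sum>i\<in>I. B (e' i) (e i)) = (\<Sum>i\<in>I. B (e i) (e' i))"
proof -
  have lin: "linear (B x)" "linear (\<lambda>y. B y x)" for x
    using assms by (auto simp: bilinear_def)
  have "(\<Sum>i\<in>I. B (e' i) (e i)) = (\<Sum>i\<in>I. \<Sum>j\<in>I. ip (e i) (e j) *\<^sub>R B (e' i) (e' j))"
    by (simp only: linear_expand_e'[OF lin(1)])
  also have "\<dots> = (\<Sum>j\<in>I. \<Sum>i\<in>I. ip (e j) (e i) *\<^sub>R B (e' i) (e' j))"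
    by (subst sum.swap) (simp only: ip_commute)
  also have "\<dots> = (\<Sum>i\<in>I. B (e i) (e' i))"
    by (simp only: linear_expand_e'[OF lin(2)])
  finally show ?thesis .
qed

text \<open>Invariance of the form makes \<open>br x\<close> skew with respect to \<open>ip\<close>,
  so the adjoint action annihilates the Casimir element.\<close>

lemma casimir_invariant:
  assumes "bilinear B"
  shows "(\<Sum>i\<in>I. B (br x (e i)) (e' i)) = - (\<Sum>i\<in>I. B (e i) (br x (e' i)))"
proof -
  have lin: "linear (B x)" "linear (\<lambda>y. B y x)" for x
    using assms by (auto simp: bilinear_def)
  have "(\<Sum>i\<in>I. B (br x (e i)) (e' i))
      = (\<Sum>i\<in>I. \<Sum>j\<in>I. ip (br x (e i)) (e' j) *\<^sub>R B (e j) (e' i))"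
    by (simp only: linear_expand_e[OF lin(2)])
  also have "\<dots> = (\<Sum>j\<in>I. \<Sum>i\<in>I. - (ip (br x (e' j)) (e i) *\<^sub>R B (e j) (e' i)))"
    by (subst sum.swap) (simp add: ip_invariant ip_commute[of "e _" "br x _"])
  also have "\<dots> = - (\<Sum>j\<in>I. B (e j) (br x (e' j)))"
    by (simp only: sum_negf linear_expand_e'[OF lin(1)])
  finally show ?thesis .
qed

end

section \<open>The differential of a quasi-Poisson structure\<close>

definition unit_list :: "'v list \<Rightarrow> 'c::{comm_ring_1,real_algebra_1}" where
  "unit_list vs = (if vs = [] then 1 else 0)"

lemma wdg_unit_left [simp]:
  fixes F :: "'v list \<Rightarrow> 'c::{comm_ring_1,real_algebra_1}"
  shows "wdg unit_list F = F"
proof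
  fix vs show "wdg unit_list F vs = F vs"
  proof (induction vs arbitrary: F)
    case (Cons v vs)
    have "plug v (unit_list :: 'v list \<Rightarrow> 'c) = 0" "twist (unit_list :: 'v list \<Rightarrow> 'c) = unit_list"
      by (auto simp: unit_list_def fun_eq_iff)
    moreover have "wdg unit_list (plug v F) vs = plug v F vs" by (rule Cons)
    ultimately have "wdg unit_list F (v # vs) = F (v # vs)"
      by (simp only: wdg_Cons wdg_zero plug_apply zero_fun_apply add_0_left)
    then show ?case .
  qed (simp add: unit_list_def)
qed

lemma wdg_unit_right [simp]: "wdg F unit_list = F"
proof -
  have "wdg F unit_list vs = F vs" for vs
  proof (induction vs arbitrary: F)
    case (Cons v vs)
    have "plug v (unit_list :: _ \<Rightarrow> 'b) = 0"
      by (auto simp: unit_list_def fun_eq_iff)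
    moreover have "wdg (plug v F) unit_list vs = plug v F vs" by (rule Cons)
    ultimately have "wdg F unit_list (v # vs) = F (v # vs)" by (simp add: wdg_Cons)
    then show ?case .
  qed (simp add: unit_list_def)
  then show ?thesis by blast
qed

lemma homogeneous_0_eq: "homogeneous 0 F \<Longrightarrow> F = scl (F []) unit_list"
  by (auto simp: homogeneous_def unit_list_def fun_eq_iff)

lemma plug_homogeneous_1: "homogeneous 1 X \<Longrightarrow> plug f X = scl (X [f]) unit_list"
  using homogeneous_0_eq[OF homogeneous_plug[of 1 X f, simplified]] by simp

lemma twist_homogeneous_1: "homogeneous 1 X \<Longrightarrow> twist X = - X"
  using twist_parity[OF homogeneous_parity[of 1 X]] by simp

text \<open>When the first degree is odd, the sign of the bracket does not depend on the second.\<close>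

definition lie :: "('c list \<Rightarrow> 'c::{comm_ring_1,real_algebra_1}) \<Rightarrow> ('c list \<Rightarrow> 'c) \<Rightarrow> 'c list \<Rightarrow> 'c" where
  "lie = bracket 1 0"

lemma bracket_1: "bracket 1 k = lie" "bracket (Suc 0) k = lie"
  unfolding lie_def fun_eq_iff bracket_def by simp_all

lemma bracket_3: "bracket 3 k = lie"
  unfolding bracket_1(1)[of k, symmetric] by (rule bracket_parity_cong) auto

section \<open>Lie derivatives along one-vectors\<close>

context function_algebra begin

lemma multider_unit: "multider 0 unit_list"
proof (rule mderI)
  have "plug f unit_list = (0 :: 'c list \<Rightarrow> 'c)" for f
    by (auto simp: fun_eq_iff unit_list_def)
  then show "front_der 0 unit_list" "multider (Suc 0) (plug f unit_list)" for f
    by (simp_all add: front_der_def multider_zero unit_list_def one_closed, simp add: fun_eq_iff)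
qed

text \<open>A derivation vanishes on a unit: \<open>unit_list\<close> is its own square, so the
  Leibniz rule yields \<open>x = x + x\<close>.\<close>

lemma bracket_unit:
  assumes "multider p P"
  shows "bracket p 0 P unit_list = 0" "bracket 0 p unit_list P = 0"
proof -
  have "bracket p 0 P unit_list = bracket p 0 P unit_list + bracket p 0 P unit_list"
    using bracket_wdg_right[OF assms multider_unit multider_unit] by simp
  then show "bracket p 0 P unit_list = 0" by simp
  then show "bracket 0 p unit_list P = 0" by (subst bracket_swap) simp
qed

lemma multider_lie:
  assumes "multider 1 X" "multider k F"
  shows "multider k (lie X F)"
proof -
  have "multider (1 + k + 1) (bracket 1 k X F)" by (rule multider_bracket[OF assms])
  also have "multider (1 + k + 1) = multider k" by (rule multider_parity_cong) simp
  finally show ?thesis by (simp only: bracket_1)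
qed

lemma multider_bracket_2:
  assumes "multider 2 P" "multider k F"
  shows "multider (k + 1) (bracket 2 k P F)"
proof -
  have "multider (2 + k + 1) (bracket 2 k P F)" by (rule multider_bracket[OF assms])
  also have "multider (2 + k + 1) = multider (k + 1)" by (rule multider_parity_cong) simp
  finally show ?thesis .
qed

lemma lie_wdg:
  assumes "multider 1 X" "multider q Q" "multider r R"
  shows "lie X (wdg Q R) = wdg (lie X Q) R + wdg Q (lie X R)"
  using bracket_wdg_right[OF assms] by (simp add: bracket_1)

lemma lie_lie:
  assumes "multider 1 X" "multider 1 Y" "multider k F"
  shows "lie X (lie Y F) = lie (lie X Y) F + lie Y (lie X F)"
  using bracket_jacobi[OF assms] by (simp add: bracket_1 bracket_3[unfolded numeral_3_eq_3])

lemma lie_add_left: "multider 1 X \<Longrightarrow> multider 1 Y \<Longrightarrow> multider k F \<Longrightarrow> lie (X + Y) F = lie X F + lie Y F"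
  using bracket_add_left[of 1 X Y k F] by (simp add: bracket_1)

lemma lie_scaleR_left: "multider 1 X \<Longrightarrow> multider k F \<Longrightarrow> lie (c *\<^sub>R X) F = c *\<^sub>R lie X F"
  using bracket_scaleR_left[of 1 X k F c] by (simp add: bracket_1)

lemma lie_add_right: "multider 1 X \<Longrightarrow> multider k F \<Longrightarrow> multider k G \<Longrightarrow> lie X (F + G) = lie X F + lie X G"
  using bracket_add_right[of 1 X k F G] by (simp add: bracket_1)

lemma lie_scaleR_right: "multider 1 X \<Longrightarrow> multider k F \<Longrightarrow> lie X (c *\<^sub>R F) = c *\<^sub>R lie X F"
  using bracket_scaleR_right[of 1 X k F c] by (simp add: bracket_1)

lemma lie_sum_right:
  "multider 1 X \<Longrightarrow> (\<And>i. i \<in> S \<Longrightarrow> multider k (F i)) \<Longrightarrow> lie X (sum F S) = (\<Sum>i\<in>S. lie X (F i))"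
  using bracket_sum_right[of 1 X S k F] by (simp add: bracket_1)

text \<open>Cartan's commutation rule for Lie derivative and contraction. \<open>plug f X\<close> is
  the function \<open>X [f]\<close>, whose recorded degree 2 is read as 0, and bracketing with a
  function is minus plugging it in.\<close>

lemma plug_lie:
  assumes X: "multider 1 X" "homogeneous 1 X" and F: "multider k F"
  shows "plug f (lie X F) = lie X (plug f F) - plug (X [f]) F"
proof -
  have "plug f (bracket 1 k X F) = bracket 2 k (plug f X) F + lie X (plug f F)"
    using plug_bracket[OF multider_parity[OF X(1)] multider_parity[OF F]] by (simp add: bracket_1 numeral_2_eq_2)
  also have "bracket 2 k (plug f X) F = bracket 0 k (scl (X [f]) unit_list) F"
    unfolding plug_homogeneous_1[OF X(2)] by (subst bracket_parity_cong[of 2 0 k k]) simp_all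
  also have "\<dots> = - plug (X [f]) F"
    using bracket_scl_left[OF multider_unit F multider_mem[OF X(1)]] by (simp add: bracket_unit(2)[OF F] fun_eq_iff)
  finally show ?thesis by (simp only: bracket_1 diff_conv_add_uminus add.commute)
qed

lemma lie_scl:
  assumes X: "multider 1 X" "homogeneous 1 X" and F: "multider k F" and f: "f \<in> C"
  shows "lie X (scl f F) = scl f (lie X F) + scl (X [f]) F"
  using bracket_scl_right[OF X(1) F f] by (simp add: bracket_1 plug_homogeneous_1[OF X(2)])

text \<open>Serves to let the trivector \<open>[\<pi>, \<pi>]\<close> act on \<open>F\<close>. With
  the differentiated factor moved to the end, the signs no longer depend on
  \<open>k\<close>.\<close>

lemma lie_wdg3:
  assumes X: "multider 1 X" and Y: "multider 1 Y" and Z: "multider 1 Z" and F: "multider k F"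
  shows "bracket 3 k (wdg X (wdg Y Z)) F =
    wdg X (wdg Y (lie Z F)) - wdg X (wdg Z (lie Y F)) + wdg Y (wdg Z (lie X F))"
proof -
  have YZ: "multider (1 + 1) (wdg Y Z)" by (rule multider_wdg[OF Y Z])
  have "wdg (lie Y F) Z = (-1) ^ k *\<^sub>R wdg Z (lie Y F)"
    using wdg_commute[OF multider_parity[OF multider_lie[OF Y F]] multider_parity[OF Z]] by simp
  then have "bracket (1 + 1) k (wdg Y Z) F = wdg Y (lie Z F) - wdg Z (lie Y F)"
    unfolding bracket_wdg_left[OF F Y Z] by (cases "even k") (simp_all add: bracket_1)
  moreover have "wdg (lie X F) (wdg Y Z) = wdg Y (wdg Z (lie X F))"
    using wdg_commute[OF multider_parity[OF multider_lie[OF X F]] multider_parity[OF YZ]] by (simp add: wdg_assoc)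
  ultimately have *: "bracket (1 + (1 + 1)) k (wdg X (wdg Y Z)) F =
    wdg X (wdg Y (lie Z F)) - wdg X (wdg Z (lie Y F)) + wdg Y (wdg Z (lie X F))"
    unfolding bracket_wdg_left[OF F X YZ] by (simp add: bracket_1)
  have "bracket (1 + (1 + 1)) k = bracket 3 k" by (rule bracket_parity_cong) simp_all
  then show ?thesis by (rule subst) (rule *)
qed

end

text \<open>What can be said about a quasi-Poisson manifold without points: \<open>R x\<close> is
  the fundamental vector field of \<open>x\<close> as a derivation, and \<open>pi_pi\<close> is the
  condition on \<open>[\<pi>, \<pi>]\<close> with \<phi> expanded in dual bases.\<close>

locale quasi_poisson_algebra = function_algebra C + quadratic_lie br ip I e e'
  for C :: "'c::{comm_ring_1,real_algebra_1} set"
    and br :: "'g::real_vector \<Rightarrow> 'g \<Rightarrow> 'g" and ip I and e e' :: "'i \<Rightarrow> 'g" +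
  fixes R :: "'g \<Rightarrow> 'c list \<Rightarrow> 'c" and \<pi> :: "'c list \<Rightarrow> 'c"
  assumes linear_R: "linear R"
    and multider_R: "multider 1 (R x)"
    and homogeneous_R: "homogeneous 1 (R x)"
    and lie_R: "lie (R x) (R y) = R (br x y)"
    and multider_pi: "multider 2 \<pi>"
    and pi_R: "bracket 2 1 \<pi> (R x) = 0"
    and pi_pi: "bracket 2 2 \<pi> \<pi> =
      (1/12) *\<^sub>R (\<Sum>i\<in>I. \<Sum>j\<in>I. wdg (R (e' i)) (wdg (R (e' j)) (R (br (e i) (e j)))))"
begin

definition qp_diff :: "nat \<Rightarrow> ('c list \<Rightarrow> 'c) \<Rightarrow> 'c list \<Rightarrow> 'c" where
  "qp_diff k F = bracket 2 k \<pi> F + (1/2) *\<^sub>R (\<Sum>i\<in>I. wdg (R (e' i)) (lie (R (e i)) F))"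

lemma multider_wdg_R: "multider k F \<Longrightarrow> multider (k + 1) (wdg (R x) F)"
  using multider_wdg[OF multider_R, of k F x] by simp

lemma multider_diff_op: "multider k F \<Longrightarrow> multider (k + 1) (qp_diff k F)"
  unfolding qp_diff_def
  by (intro multider_add multider_scaleR multider_sum multider_wdg_R multider_bracket_2 multider_lie multider_R multider_pi)

text \<open>Puts the second summand of the differential into the form to which
  \<open>casimir_invariant\<close> applies.\<close>

lemma bilinear_wdg_lie:
  assumes "multider k F"
  shows "bilinear (\<lambda>u v. wdg (R v) (lie (R u) F))"
  unfolding bilinear_def
  by (auto intro!: linearI simp: linear_add[OF linear_R] linear_scale[OF linear_R]
      lie_add_left[OF multider_R multider_R assms] lie_scaleR_left[OF multider_R assms])

lemma lie_R_lie_R: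
  "multider k F \<Longrightarrow> lie (R x) (lie (R y) F) = lie (R (br x y)) F + lie (R y) (lie (R x) F)"
  using lie_lie[OF multider_R multider_R, of k F x y] by (simp only: lie_R)

lemma pi_wdg_R:
  assumes "multider k F"
  shows "bracket 2 (k + 1) \<pi> (wdg (R x) F) = - wdg (R x) (bracket 2 k \<pi> F)"
  using bracket_wdg_right[OF multider_pi multider_R assms, of x] by (simp add: pi_R[simplified])

lemma lie_R_pi: "lie (R x) \<pi> = 0"
  using bracket_swap[of 1 2 "R x" \<pi>] pi_R[of x] by (simp add: bracket_1)

lemma lie_R_bracket_pi:
  assumes "multider k F"
  shows "lie (R x) (bracket 2 k \<pi> F) = bracket 2 k \<pi> (lie (R x) F)"
proof -
  have "bracket (1 + 2 + 1) k (0 :: 'c list \<Rightarrow> 'c) F = 0" "bracket 2 (1 + k + 1) = bracket 2 k"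
    using bracket_zero_left[OF assms] by (auto intro!: bracket_parity_cong)
  note jacobi = bracket_jacobi[OF multider_R multider_pi assms, of x, unfolded bracket_1 lie_R_pi this]
  show ?thesis by (subst jacobi) simp
qed

theorem diff_lie_R:
  assumes F: "multider k F"
  shows "qp_diff k (lie (R x) F) = lie (R x) (qp_diff k F)"
proof -
  note mF = multider_lie[OF multider_R F]
  \<comment> \<open>\<open>R x\<close> acts on \<open>R (e' i)\<close> and, through a commutator, on
    \<open>R (e i)\<close>. Summed over \<open>i\<close>, these two contributions cancel by
    invariance of the Casimir element.\<close>
  have t: "lie (R x) (wdg (R (e' i)) (lie (R (e i)) F)) =
      wdg (R (br x (e' i))) (lie (R (e i)) F) + wdg (R (e' i)) (lie (R (br x (e i))) F)
      + wdg (R (e' i)) (lie (R (e i)) (lie (R x) F))" for i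
    by (simp add: lie_wdg[OF multider_R multider_R mF] lie_R lie_R_lie_R[OF F, of x "e i"])
  have "lie (R x) (\<Sum>i\<in>I. wdg (R (e' i)) (lie (R (e i)) F)) =
      (\<Sum>i\<in>I. lie (R x) (wdg (R (e' i)) (lie (R (e i)) F)))"
    by (rule lie_sum_right[OF multider_R multider_wdg_R[OF mF]])
  also have "\<dots> = (\<Sum>i\<in>I. wdg (R (e' i)) (lie (R (e i)) (lie (R x) F)))"
    using casimir_invariant[OF bilinear_wdg_lie[OF F], of x]
    unfolding t sum.distrib by simp
  finally have 1: "lie (R x) (\<Sum>i\<in>I. wdg (R (e' i)) (lie (R (e i)) F)) =
    (\<Sum>i\<in>I. wdg (R (e' i)) (lie (R (e i)) (lie (R x) F)))" .
  have "multider (k + 1) (\<Sum>i\<in>I. wdg (R (e' i)) (lie (R (e i)) F))"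
    by (intro multider_sum multider_wdg_R mF)
  then show ?thesis
    unfolding qp_diff_def
    by (simp only: lie_add_right[OF multider_R multider_bracket_2[OF multider_pi F] multider_scaleR]
        lie_scaleR_right[OF multider_R] lie_R_bracket_pi[OF F] 1)
qed

text \<open>Each term of the second summand is a derivation of degree 0 multiplied by an odd
  element. Such an operator is an odd derivation, the sign arising when \<open>R (e' i)\<close>
  passes \<open>P\<close>.\<close>

theorem diff_wdg:
  assumes P: "multider k P" and Q: "multider l Q"
  shows "qp_diff (k + l) (wdg P Q) = wdg (qp_diff k P) Q + (-1) ^ k *\<^sub>R wdg P (qp_diff l Q)"
proof -
  have "wdg (R (e' i)) (lie (R (e i)) (wdg P Q)) =
    wdg (wdg (R (e' i)) (lie (R (e i)) P)) Q
    + (-1) ^ k *\<^sub>R wdg P (wdg (R (e' i)) (lie (R (e i)) Q))" for i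
  proof -
    have "wdg (R (e' i)) P = (-1) ^ k *\<^sub>R wdg P (R (e' i))"
      using wdg_commute[OF multider_parity[OF multider_R] multider_parity[OF P], of "e' i"] by simp
    then have "wdg (R (e' i)) (wdg P G) = (-1) ^ k *\<^sub>R wdg P (wdg (R (e' i)) G)" for G
      by (simp add: wdg_assoc[symmetric])
    then show ?thesis
      by (simp add: lie_wdg[OF multider_R P Q] wdg_assoc)
  qed
  then show ?thesis
    unfolding qp_diff_def bracket_wdg_right[OF multider_pi P Q]
    by (cases "even k") (simp_all add: sum.distrib sum_subtractf wdg_sum_left wdg_sum_right
      scaleR_add_right scaleR_diff_right sum_negf)
qed

text \<open>The sum \<open>S\<close> of the overview, to which all terms of the squared differential
  are reduced.\<close>

definition cubic :: "nat \<Rightarrow> ('c list \<Rightarrow> 'c) \<Rightarrow> 'c list \<Rightarrow> 'c" where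
  "cubic k F = (\<Sum>i\<in>I. \<Sum>j\<in>I. wdg (R (e' i)) (wdg (R (e' j)) (lie (R (br (e i) (e j))) F)))"

text \<open>For fixed \<open>i\<close>, Casimir invariance under \<open>e i\<close> moves the
  bracket from the second factor to the third with a minus sign. Symmetry of the Casimir element
  then restores the roles of \<open>e j\<close> and \<open>e' j\<close>.\<close>

lemma cubic_cyclic:
  assumes F: "multider k F"
  shows "(\<Sum>i\<in>I. \<Sum>j\<in>I. wdg (R (e' i)) (wdg (R (br (e i) (e j))) (lie (R (e' j)) F))) = - cubic k F"
proof -
  have bil: "bilinear (\<lambda>u v. wdg (R (e' i)) (wdg (R u) (lie (R v) F)))" for i
    unfolding bilinear_def
    by (auto intro!: linearI simp: linear_add[OF linear_R] linear_scale[OF linear_R]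
      lie_add_left[OF multider_R multider_R F] lie_scaleR_left[OF multider_R F])
  have bil': "bilinear (\<lambda>u v. wdg (R (e' i)) (wdg (R u) (lie (R (br (e i) v)) F)))" for i
    unfolding bilinear_def
    by (auto intro!: linearI simp: linear_add[OF linear_R] linear_scale[OF linear_R]
      linear_add[OF linear_br(1)] linear_scale[OF linear_br(1)]
      lie_add_left[OF multider_R multider_R F] lie_scaleR_left[OF multider_R F])
  have "(\<Sum>j\<in>I. wdg (R (e' i)) (wdg (R (br (e i) (e j))) (lie (R (e' j)) F)))
      = - (\<Sum>j\<in>I. wdg (R (e' i)) (wdg (R (e' j)) (lie (R (br (e i) (e j))) F)))" for i
    using casimir_invariant[OF bil[of i], of "e i"] casimir_swap[OF bil'[of i]] by simp
  then show ?thesis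
    by (simp only: cubic_def sum_negf)
qed

lemma wdg_R_commute: "wdg (R x) (wdg (R y) F) = - wdg (R y) (wdg (R x) F)"
  using wdg_commute[OF multider_parity[OF multider_R] multider_parity[OF multider_R], of x y]
  by (simp add: wdg_assoc[symmetric])

text \<open>The three choices of the differentiated factor contribute equally, because the structure
  tensor is totally skew; hence the 3.\<close>

lemma cartan_lie:
  assumes F: "multider k F"
  shows "bracket 3 k (\<Sum>i\<in>I. \<Sum>j\<in>I. wdg (R (e' i)) (wdg (R (e' j)) (R (br (e i) (e j))))) F
    = 3 *\<^sub>R cubic k F"
proof -
  have m: "multider 3 (wdg (R x) (wdg (R y) (R z)))" for x y z
    using multider_wdg[OF multider_R multider_wdg[OF multider_R multider_R], of x y z] by (simp add: numeral_3_eq_3)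
  have "(\<Sum>i\<in>I. \<Sum>j\<in>I. wdg (R (e' j)) (wdg (R (br (e i) (e j))) (lie (R (e' i)) F)))
     = (\<Sum>j\<in>I. \<Sum>i\<in>I. wdg (R (e' j)) (wdg (R (br (e i) (e j))) (lie (R (e' i)) F)))"
    by (rule sum.swap)
  also have "\<dots> = (\<Sum>j\<in>I. \<Sum>i\<in>I. - wdg (R (e' j)) (wdg (R (br (e j) (e i))) (lie (R (e' i)) F)))"
    by (subst br_swap) (simp only: linear_neg[OF linear_R] wdg_minus)
  also have "\<dots> = cubic k F"
    by (simp only: sum_negf cubic_cyclic[OF F] minus_minus)
  finally have 1: "(\<Sum>i\<in>I. \<Sum>j\<in>I. wdg (R (e' j)) (wdg (R (br (e i) (e j))) (lie (R (e' i)) F)))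
     = cubic k F" .
  have "bracket 3 k (\<Sum>i\<in>I. \<Sum>j\<in>I. wdg (R (e' i)) (wdg (R (e' j)) (R (br (e i) (e j))))) F
    = (\<Sum>i\<in>I. \<Sum>j\<in>I. bracket 3 k (wdg (R (e' i)) (wdg (R (e' j)) (R (br (e i) (e j))))) F)"
    by (simp only: bracket_sum_left[OF m F] bracket_sum_left[OF multider_sum[OF m] F])
  also have "\<dots> = cubic k F + cubic k F + cubic k F"
    unfolding lie_wdg3[OF multider_R multider_R multider_R F] sum.distrib sum_subtractf cubic_cyclic[OF F] 1
    by (simp add: cubic_def)
  also have "\<dots> = (1 + 1 + 1) *\<^sub>R cubic k F"
    by (simp only: scaleR_add_left scaleR_one)
  finally show ?thesis by simp
qed

text \<open>As \<open>\<pi>\<close> has even degree, bracketing with it is an odd operator, and the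
  Jacobi identity says that twice the left-hand side is the bracket of \<open>[\<pi>, \<pi>]\<close>
  with \<open>F\<close>. The constant is therefore \<open>1/2 * 1/12 * 3\<close>.\<close>

lemma pi_pi_lie:
  assumes F: "multider k F"
  shows "bracket 2 (k + 1) \<pi> (bracket 2 k \<pi> F) = (1/8) *\<^sub>R cubic k F"
proof -
  let ?\<Phi> = "\<Sum>i\<in>I. \<Sum>j\<in>I. wdg (R (e' i)) (wdg (R (e' j)) (R (br (e i) (e j))))"
  have m: "multider 3 ?\<Phi>"
  proof (intro multider_sum)
    fix x y z show "multider 3 (wdg (R x) (wdg (R y) (R z)))"
      using multider_wdg[OF multider_R multider_wdg[OF multider_R multider_R], of x y z] by (simp add: numeral_3_eq_3)
  qed
  have "bracket 2 (2 + k + 1) = bracket 2 (k + 1)" "bracket (2 + 2 + 1) k = bracket 3 k"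
    by (auto intro!: bracket_parity_cong)
  note jacobi = bracket_jacobi[OF multider_pi multider_pi F, unfolded this]
  have "bracket 2 (k + 1) \<pi> (bracket 2 k \<pi> F)
      = bracket 3 k (bracket 2 2 \<pi> \<pi>) F - bracket 2 (k + 1) \<pi> (bracket 2 k \<pi> F)"
    by (subst jacobi) simp
  also have "bracket 3 k (bracket 2 2 \<pi> \<pi>) F = (1/4) *\<^sub>R cubic k F"
    by (simp add: pi_pi bracket_scaleR_left[OF m F] cartan_lie[OF F])
  finally have "2 *\<^sub>R bracket 2 (k + 1) \<pi> (bracket 2 k \<pi> F) = (1/4) *\<^sub>R cubic k F"
    unfolding scaleR_2 eq_diff_eq .
  then have "(1/2) *\<^sub>R 2 *\<^sub>R bracket 2 (k + 1) \<pi> (bracket 2 k \<pi> F) = (1/2) *\<^sub>R (1/4) *\<^sub>R cubic k F"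
    by (simp only:)
  then show ?thesis by simp
qed

text \<open>The outer Lie derivative either meets the factor \<open>R (e' j)\<close>, which gives
  \<open>- cubic k F\<close> by Casimir invariance, or the inner Lie derivative, which gives the sum
  \<open>?T\<close>.\<close>

lemma casimir_casimir:
  assumes F: "multider k F"
  shows "(\<Sum>i\<in>I. wdg (R (e' i)) (lie (R (e i)) (\<Sum>j\<in>I. wdg (R (e' j)) (lie (R (e j)) F))))
    = - (1/2) *\<^sub>R cubic k F"
proof -
  note mF = multider_lie[OF multider_R F]
  let ?T = "\<Sum>i\<in>I. \<Sum>j\<in>I. wdg (R (e' i)) (wdg (R (e' j)) (lie (R (e i)) (lie (R (e j)) F)))"
  have "(\<Sum>j\<in>I. wdg (R (e' i)) (wdg (R (br (e i) (e' j))) (lie (R (e j)) F)))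
    = - (\<Sum>j\<in>I. wdg (R (e' i)) (wdg (R (e' j)) (lie (R (br (e i) (e j))) F)))" for i
    unfolding wdg_sum_right[symmetric] casimir_invariant[OF bilinear_wdg_lie[OF F], of "e i"]
    by simp
  then have 1: "(\<Sum>i\<in>I. \<Sum>j\<in>I. wdg (R (e' i)) (wdg (R (br (e i) (e' j))) (lie (R (e j)) F)))
    = - cubic k F"
    by (simp only: cubic_def sum_negf)
  \<comment> \<open>Exchanging \<open>i\<close> and \<open>j\<close> in \<open>?T\<close> changes
    the sign of the wedge product and the order of the two Lie derivatives. So twice
    \<open>?T\<close> contains only their commutator, and that is \<open>cubic k F\<close>.\<close>
  have *: "wdg (R (e' j)) (wdg (R (e' i)) (lie (R (e j)) (lie (R (e i)) F))) =
    wdg (R (e' i)) (wdg (R (e' j)) (lie (R (br (e i) (e j))) F))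
    - wdg (R (e' i)) (wdg (R (e' j)) (lie (R (e i)) (lie (R (e j)) F)))" for i j
    unfolding lie_R_lie_R[OF F, of "e i" "e j"] wdg_R_commute[of "e' j" "e' i"]
    by (simp only: wdg_add_right diff_add_eq_diff_diff_swap diff_self) simp
  have "?T = (\<Sum>i\<in>I. \<Sum>j\<in>I. wdg (R (e' j)) (wdg (R (e' i)) (lie (R (e j)) (lie (R (e i)) F))))"
    by (rule sum.swap)
  also have "\<dots> = (\<Sum>i\<in>I. \<Sum>j\<in>I. wdg (R (e' i)) (wdg (R (e' j)) (lie (R (br (e i) (e j))) F))
      - wdg (R (e' i)) (wdg (R (e' j)) (lie (R (e i)) (lie (R (e j)) F))))"
    by (intro sum.cong refl *)
  also have "\<dots> = cubic k F - ?T"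
    by (simp only: sum_subtractf cubic_def)
  finally have "2 *\<^sub>R ?T = cubic k F"
    unfolding scaleR_2 eq_diff_eq .
  then have "(1/2) *\<^sub>R 2 *\<^sub>R ?T = (1/2) *\<^sub>R cubic k F"
    by (simp only:)
  then have 2: "?T = (1/2) *\<^sub>R cubic k F"
    by simp
  have "lie (R (e i)) (\<Sum>j\<in>I. wdg (R (e' j)) (lie (R (e j)) F))
    = (\<Sum>j\<in>I. wdg (R (br (e i) (e' j))) (lie (R (e j)) F)
      + wdg (R (e' j)) (lie (R (e i)) (lie (R (e j)) F)))" for i
    by (simp only: lie_sum_right[OF multider_R multider_wdg_R[OF mF]] lie_wdg[OF multider_R multider_R mF] lie_R)
  then have "(\<Sum>i\<in>I. wdg (R (e' i)) (lie (R (e i)) (\<Sum>j\<in>I. wdg (R (e' j)) (lie (R (e j)) F))))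
    = - cubic k F + (1/2) *\<^sub>R cubic k F"
    by (simp only: wdg_sum_right wdg_add_right sum.distrib 1 2)
  also have "\<dots> = (- 1 + 1/2) *\<^sub>R cubic k F"
    by (simp only: scaleR_add_left scaleR_minus1_left)
  finally show ?thesis by simp
qed

theorem diff_diff:
  assumes F: "multider k F"
  shows "qp_diff (k + 1) (qp_diff k F) = 0"
proof -
  note mF = multider_lie[OF multider_R F]
  let ?c = "\<lambda>F. \<Sum>i\<in>I. wdg (R (e' i)) (lie (R (e i)) F)"
  have mc: "multider (k + 1) (?c F)"
    by (intro multider_sum multider_wdg_R mF)
  have mpi: "multider (k + 1) (bracket 2 k \<pi> F)"
    by (rule multider_bracket_2[OF multider_pi F])
  \<comment> \<open>Bracketing with \<open>\<pi>\<close> commutes with the Lie derivatives and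
    anticommutes with multiplication by \<open>R (e' i)\<close>.\<close>
  have "bracket 2 (k + 1) \<pi> (?c F) = - ?c (bracket 2 k \<pi> F)"
    by (simp only: bracket_sum_right[OF multider_pi multider_wdg_R[OF mF]] pi_wdg_R[OF mF] lie_R_bracket_pi[OF F]
        sum_negf)
  then have "qp_diff (k + 1) (qp_diff k F) = (1/8) *\<^sub>R cubic k F + (1/4) *\<^sub>R (?c (?c F))"
    unfolding qp_diff_def
    by (simp only: bracket_add_right[OF multider_pi mpi multider_scaleR[OF mc]] bracket_scaleR_right[OF multider_pi mc]
        pi_pi_lie[OF F] lie_add_right[OF multider_R mpi multider_scaleR[OF mc]] lie_scaleR_right[OF multider_R mc]
        wdg_add_right sum.distrib wdg_scaleR_right scaleR_sum_right[symmetric] scaleR_add_right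
        scaleR_scaleR scaleR_minus_right) simp
  then show ?thesis
    by (simp only: casimir_casimir[OF F]) simp
qed

end

section \<open>Degree of the bracket\<close>

context function_algebra begin

lemma homogeneous_insertion:
  assumes "multider p F" "homogeneous k F" "homogeneous l G"
  shows "homogeneous (k + l - 1) (insertion F G)"
proof -
  have "insertion F G vs = 0" if "int (length vs) \<noteq> k + l - 1" for vs
    using that assms
  proof (induction vs arbitrary: p F G k l)
    case Nil
    \<comment> \<open>For nonzero \<open>l\<close> the value of \<open>G\<close> on the empty list
      is 0, and linearity of \<open>F\<close> disposes of that argument.\<close>
    have "F [0] = 0"
      using multider_plug_zero[OF Nil(2)] by (simp add: fun_eq_iff)
    moreover have "F [G []] = 0" if "l = 0"
      using Nil(1,3) that by (simp add: homogeneous_def)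
    moreover have "G [] = 0" if "l \<noteq> 0"
      using Nil(4) that by (simp add: homogeneous_def)
    ultimately have "insertion F G [] = 0" by (cases "l = 0") simp_all
    then show ?case .
  next
    case (Cons v vs)
    have "insertion (plug v F) G vs = 0"
      using Cons.prems(1) by (intro Cons.IH[OF _ multider_plug[OF Cons.prems(2)] homogeneous_plug[OF Cons.prems(3)] Cons.prems(4)]) auto
    moreover have "insertion (twist F) (plug v G) vs = 0"
      using Cons.prems(1) by (intro Cons.IH[OF _ multider_twist[OF Cons.prems(2)] homogeneous_twist[OF Cons.prems(3)] homogeneous_plug[OF Cons.prems(4)]]) auto
    ultimately have "insertion F G (v # vs) = 0"
      by (simp add: insertion_Cons)
    then show ?case .
  qed
  then show ?thesis
    unfolding homogeneous_def by blast
qed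

lemma homogeneous_bracket:
  assumes "multider p F" "multider q G" "homogeneous k F" "homogeneous l G"
  shows "homogeneous (k + l - 1) (bracket p q F G)"
  using homogeneous_insertion[OF assms(1,3,4)] homogeneous_insertion[OF assms(2,4,3)] unfolding bracket_def
  by (intro homogeneous_diff homogeneous_scaleR) (simp_all add: add.commute)

end

section \<open>Forms on the Lie algebra\<close>

definition flat_form :: "('g \<Rightarrow> 'g \<Rightarrow> real) \<Rightarrow> 'g \<Rightarrow> 'g list \<Rightarrow> real" where
  "flat_form ip x ys = (if length ys = 1 then ip x (hd ys) else 0)"

text \<open>Counterpart of \<open>multider\<close> for forms on the Lie algebra; degree and parity
  are stated separately.\<close>

definition alternating :: "('g::real_vector list \<Rightarrow> real) \<Rightarrow> bool" where
  "alternating w \<longleftrightarrow> (\<forall>vs. linear (\<lambda>x. plug x (after vs w)) \<and>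
     (\<forall>x y. plug y (plug x (after vs w)) = - plug x (plug y (after vs w))))"

lemma alternating_linear: "alternating w \<Longrightarrow> linear (\<lambda>x. plug x w)"
  and alternating_swap: "alternating w \<Longrightarrow> plug y (plug x w) = - plug x (plug y w)"
proof -
  assume "alternating w"
  from spec[OF this[unfolded alternating_def], of "[]"]
  have "linear (\<lambda>x. plug x w) \<and> (\<forall>x y. plug y (plug x w) = - plug x (plug y w))"
    unfolding after.simps .
  then show "linear (\<lambda>x. plug x w)" "plug y (plug x w) = - plug x (plug y w)"
    by blast+
qed

lemma alternating_plug: "alternating w \<Longrightarrow> alternating (plug x w)"
  unfolding alternating_def
proof
  fix vs assume "\<forall>vs. linear (\<lambda>x. plug x (after vs w)) \<and>
     (\<forall>x y. plug y (plug x (after vs w)) = - plug x (plug y (after vs w)))"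
  from spec[OF this, of "x # vs"] show "linear (\<lambda>y. plug y (after vs (plug x w))) \<and>
     (\<forall>z y. plug y (plug z (after vs (plug x w))) = - plug z (plug y (after vs (plug x w))))"
    unfolding after.simps .
qed

context quadratic_lie begin

text \<open>The coadjoint action on forms: minus the sum over all ways to replace one entry
  \<open>y\<close> by \<open>br x y\<close>.\<close>

primrec lie_form_list :: "'g list \<Rightarrow> 'g \<Rightarrow> ('g list \<Rightarrow> real) \<Rightarrow> real" where
  "lie_form_list [] x w = 0"
| "lie_form_list (y # ys) x w = lie_form_list ys x (plug y w) - w (br x y # ys)"

definition lie_form :: "'g \<Rightarrow> ('g list \<Rightarrow> real) \<Rightarrow> 'g list \<Rightarrow> real" where
  "lie_form x w = (\<lambda>ys. lie_form_list ys x w)"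

lemma lie_form_Nil [simp]: "lie_form x w [] = 0"
  by (simp add: lie_form_def)

lemma lie_form_Cons: "lie_form x w (y # ys) = lie_form x (plug y w) ys - w (br x y # ys)"
  by (simp add: lie_form_def)

lemma plug_lie_form: "plug y (lie_form x w) = lie_form x (plug y w) - plug (br x y) w"
  by (simp add: fun_eq_iff lie_form_Cons)

lemma linear_lie_form:
  assumes "alternating w"
  shows "linear (\<lambda>x. lie_form x w)"
proof -
  have "linear (\<lambda>x. lie_form x w ys)" for ys
    using assms
  proof (induction ys arbitrary: w)
    case Nil
    show ?case by (simp add: linear_zero)
  next
    case (Cons y ys)
    have "linear (\<lambda>x. plug (br x y) w)"
      using linear_compose[OF linear_br(2) alternating_linear[OF Cons.prems]] by (simp add: o_def)
    then have "linear (\<lambda>x. w (br x y # ys))"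
      by (auto simp: linear_iff fun_eq_iff)
    moreover have "linear (\<lambda>x. lie_form x (plug y w) ys)"
      by (rule Cons.IH[OF alternating_plug[OF Cons.prems]])
    ultimately have "linear (\<lambda>x. lie_form x w (y # ys))"
      unfolding lie_form_Cons by (intro linear_compose_sub)
    then show ?case .
  qed
  then show ?thesis
    by (auto simp: linear_iff fun_eq_iff)
qed

lemma flat_form_Nil [simp]: "flat_form ip x [] = 0"
  by (simp add: flat_form_def)

lemma plug_flat_form: "plug y (flat_form ip x) = ip x y *\<^sub>R unit_list"
  by (auto simp: flat_form_def fun_eq_iff unit_list_def)

lemma twist_flat_form [simp]: "twist (flat_form ip x) = - flat_form ip x"
  by (auto simp: flat_form_def fun_eq_iff)

lemma linear_comp_plug: "alternating w \<Longrightarrow> linear f \<Longrightarrow> linear (\<lambda>x. plug (f x) w)"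
  using linear_compose[of f "\<lambda>x. plug x w"] alternating_linear[of w] by (simp add: o_def)

text \<open>Writes the coadjoint action as a derivation of the algebra of forms, given by its effect
  on covectors. Plugging \<open>y\<close> into the covector produces the term
  \<open>- plug (br x y) w\<close> in which \<open>lie_form x w\<close> and
  \<open>lie_form x (plug y w)\<close> differ.\<close>

lemma sum_flat_plug:
  assumes "alternating w"
  shows "(\<Sum>i\<in>I. wdg (flat_form ip (e' i)) (plug (br (e i) x) w)) = lie_form x w"
proof
  fix ys show "(\<Sum>i\<in>I. wdg (flat_form ip (e' i)) (plug (br (e i) x) w)) ys = lie_form x w ys"
    using assms
  proof (induction ys arbitrary: w)
    case Nil
    have "(\<Sum>i\<in>S. wdg (flat_form ip (e' i)) (plug (br (e i) x) w)) [] = 0" for S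
      by (induction S rule: infinite_finite_induct) simp_all
    then have "(\<Sum>i\<in>I. wdg (flat_form ip (e' i)) (plug (br (e i) x) w)) [] = lie_form x w []" by simp
    then show ?case .
  next
    case (Cons y ys)
    have "plug y (wdg (flat_form ip (e' i)) (plug (br (e i) x) w)) =
      ip y (e' i) *\<^sub>R plug (br (e i) x) w
      + wdg (flat_form ip (e' i)) (plug (br (e i) x) (plug y w))" for i
      by (simp add: plug_wdg plug_flat_form alternating_swap[OF Cons.prems, of y] ip_commute[of y])
    moreover have "(\<Sum>i\<in>I. ip y (e' i) *\<^sub>R plug (br (e i) x) w) = - plug (br x y) w"
      unfolding linear_expand_e[OF linear_comp_plug[OF Cons.prems linear_br(2)]]
      by (simp add: br_swap[of y x] linear_neg[OF alternating_linear[OF Cons.prems]])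
    ultimately have "plug y (\<Sum>i\<in>I. wdg (flat_form ip (e' i)) (plug (br (e i) x) w)) =
      - plug (br x y) w + (\<Sum>i\<in>I. wdg (flat_form ip (e' i)) (plug (br (e i) x) (plug y w)))"
      by (simp only: plug_sum sum.distrib)
    moreover have "(\<Sum>i\<in>I. wdg (flat_form ip (e' i)) (plug (br (e i) x) (plug y w))) ys
      = lie_form x (plug y w) ys"
      by (rule Cons.IH[OF alternating_plug[OF Cons.prems]])
    ultimately have "plug y (\<Sum>i\<in>I. wdg (flat_form ip (e' i)) (plug (br (e i) x) w)) ys
      = lie_form x w (y # ys)"
      by (simp add: lie_form_Cons del: plug_apply) simp
    then have "(\<Sum>i\<in>I. wdg (flat_form ip (e' i)) (plug (br (e i) x) w)) (y # ys) = lie_form x w (y # ys)"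
      by (simp only: plug_apply)
    then show ?case .
  qed
qed

definition ce_sum :: "('g list \<Rightarrow> real) \<Rightarrow> 'g list \<Rightarrow> real" where
  "ce_sum w = (1/2) *\<^sub>R (\<Sum>i\<in>I. wdg (flat_form ip (e' i)) (lie_form (e i) w))"

text \<open>Cartan's formula. One copy of \<open>lie_form x w\<close> arises from plugging
  \<open>x\<close> into the covector, a second one from the commutator of plugging with
  \<open>lie_form (e i)\<close>; hence the factor 1/2 in \<open>ce_sum\<close>.\<close>

lemma plug_ce_sum:
  assumes "alternating w"
  shows "plug x (ce_sum w) = lie_form x w - ce_sum (plug x w)"
proof -
  have "plug x (wdg (flat_form ip (e' i)) (lie_form (e i) w)) =
    ip x (e' i) *\<^sub>R lie_form (e i) w + (- wdg (flat_form ip (e' i)) (lie_form (e i) (plug x w))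
    + wdg (flat_form ip (e' i)) (plug (br (e i) x) w))" for i
    by (simp add: plug_wdg plug_flat_form plug_lie_form ip_commute[of x])
  then have "plug x (ce_sum w) = (1/2) *\<^sub>R (lie_form x w
    + (- (\<Sum>i\<in>I. wdg (flat_form ip (e' i)) (lie_form (e i) (plug x w))) + lie_form x w))"
    unfolding ce_sum_def
    by (simp only: plug_simps plug_sum sum.distrib linear_expand_e[OF linear_lie_form[OF assms]]
        sum_flat_plug[OF assms] sum_negf)
  also have "\<dots> = ((1/2) *\<^sub>R lie_form x w + (1/2) *\<^sub>R lie_form x w) - ce_sum (plug x w)"
    unfolding ce_sum_def by (simp only: scaleR_add_right scaleR_minus_right) simp
  also have "(1/2) *\<^sub>R lie_form x w + (1/2) *\<^sub>R lie_form x w = lie_form x w"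
    unfolding scaleR_add_left[symmetric] by simp
  finally show ?thesis .
qed

lemma ce_sum_Nil: "ce_sum w [] = 0"
proof -
  have "(\<Sum>i\<in>S. wdg (flat_form ip (e' i)) (lie_form (e i) w)) [] = 0" for S
    by (induction S rule: infinite_finite_induct) simp_all
  then show ?thesis by (simp add: ce_sum_def)
qed

end

section \<open>Pullback of forms on the Lie algebra\<close>

context quasi_poisson_algebra begin

text \<open>Pullback along the map that sends \<open>f\<close> to the sum of the \<open>e' i\<close>
  with coefficients \<open>R (e i) [f]\<close>. These coefficients are functions, so the form is
  expanded multilinearly instead of being evaluated at a vector; \<open>pull_apply\<close> recovers
  the pointwise formula.\<close>

primrec pull_list :: "'c list \<Rightarrow> ('g list \<Rightarrow> real) \<Rightarrow> 'c" where
  "pull_list [] w = of_real (w [])"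
| "pull_list (f # fs) w = (\<Sum>i\<in>I. R (e i) [f] * pull_list fs (plug (e' i) w))"

definition pull :: "('g list \<Rightarrow> real) \<Rightarrow> 'c list \<Rightarrow> 'c" where
  "pull w = (\<lambda>fs. pull_list fs w)"

lemma pull_Nil [simp]: "pull w [] = of_real (w [])"
  by (simp add: pull_def)

lemma sum_list_fun_apply: "(sum F S) fs = (\<Sum>i\<in>S. F i fs)"
  for F :: "'k \<Rightarrow> 'a list \<Rightarrow> 'c"
  by (induction S rule: infinite_finite_induct) simp_all

lemma pull_Cons: "pull w (f # fs) = (\<Sum>i\<in>I. R (e i) [f] * pull (plug (e' i) w) fs)"
  by (simp add: pull_def)

lemma plug_pull: "plug f (pull w) = (\<Sum>i\<in>I. scl (R (e i) [f]) (pull (plug (e' i) w)))"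
  by (rule ext) (simp only: plug_apply pull_Cons sum_list_fun_apply scl_apply)

lemma pull_add: "pull (v + w) = pull v + pull w"
proof
  fix fs show "pull (v + w) fs = (pull v + pull w) fs"
  proof (induction fs arbitrary: v w)
    case (Cons f fs)
    have "pull (v + w) (f # fs) = (pull v + pull w) (f # fs)"
      unfolding pull_Cons plug_simps Cons.IH by (simp add: pull_Cons distrib_left sum.distrib)
    then show ?case .
  qed simp
qed

lemma pull_scaleR: "pull (c *\<^sub>R w) = c *\<^sub>R pull w"
proof
  fix fs show "pull (c *\<^sub>R w) fs = (c *\<^sub>R pull w) fs"
  proof (induction fs arbitrary: w)
    case Nil
    show ?case by (simp add: scaleR_conv_of_real[where 'a='c])
  next
    case (Cons f fs)
    have "pull (c *\<^sub>R w) (f # fs) = (c *\<^sub>R pull w) (f # fs)"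
      unfolding pull_Cons plug_simps Cons.IH by (simp add: pull_Cons scaleR_sum_right)
    then show ?case .
  qed
qed

lemma linear_pull: "linear pull"
  by (rule linearI) (simp_all add: pull_add pull_scaleR)

lemma pull_twist: "pull (twist w) = twist (pull w)"
proof
  fix fs show "pull (twist w) fs = twist (pull w) fs"
  proof (induction fs arbitrary: w)
    case (Cons f fs)
    have "pull (twist (plug (e' i) w)) fs = twist (pull (plug (e' i) w)) fs" for i
      by (rule Cons.IH)
    then have "pull (twist w) (f # fs) = twist (pull w) (f # fs)"
      unfolding pull_Cons plug_simps linear_neg[OF linear_pull]
      by (simp add: pull_Cons scaleR_sum_right sum_negf)
    then show ?case .
  qed simp
qed

lemma pull_unit: "pull unit_list = unit_list"
proof
  fix fs :: "'c list"
  have "plug x (unit_list :: 'g list \<Rightarrow> real) = 0" for x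
    by (auto simp: unit_list_def fun_eq_iff)
  then show "pull unit_list fs = unit_list fs"
    by (cases fs) (simp_all add: pull_Cons linear_0[OF linear_pull], simp_all add: unit_list_def)
qed

lemma linear_R_apply: "linear (\<lambda>x. R x fs)"
  using linear_R by (auto simp: linear_iff fun_eq_iff)

lemma pull_flat_form: "pull (flat_form ip x) = R x"
proof (rule list_fun_eqI)
  show "pull (flat_form ip x) [] = R x []"
    using multider_odd_Nil[OF multider_R] by simp
  fix f
  have "plug f (pull (flat_form ip x)) = scl (\<Sum>i\<in>I. ip x (e' i) *\<^sub>R R (e i) [f]) unit_list"
    by (simp add: plug_pull plug_flat_form pull_scaleR pull_unit fun_eq_iff sum_list_fun_apply
       sum_distrib_right)
  also have "\<dots> = plug f (R x)"
    unfolding linear_expand_e[OF linear_R_apply] plug_homogeneous_1[OF homogeneous_R] ..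
  finally show "plug f (pull (flat_form ip x)) = plug f (R x)" .
qed

lemma scl_sum_right: "scl c (sum F S) = (\<Sum>i\<in>S. scl c (F i))" for F :: "'k \<Rightarrow> 'a list \<Rightarrow> 'c"
  by (auto simp: fun_eq_iff sum_list_fun_apply sum_distrib_left)

lemma pull_wdg: "pull (wdg v w) = wdg (pull v) (pull w)"
proof
  fix fs show "pull (wdg v w) fs = wdg (pull v) (pull w) fs"
  proof (induction fs arbitrary: v w)
    case (Cons f fs)
    have "pull (wdg v w) (f # fs) = wdg (pull v) (pull w) (f # fs)"
      unfolding pull_Cons plug_wdg pull_add wdg_Cons plus_fun_apply Cons.IH plug_pull wdg_sum_left
        wdg_sum_right sum_list_fun_apply pull_twist
      by (simp add: distrib_left sum.distrib)
    then show ?case .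
  qed simp
qed

lemma multider_pull:
  assumes "alternating w" "parity k w"
  shows "multider k (pull w)"
proof -
  have front: "front_der k (pull w)" if w: "alternating w" "parity k w" for k w
  proof -
    have "pull w [] \<in> C" by (simp add: of_real_closed)
    moreover have "odd k \<longrightarrow> pull w [] = 0"
      using w(2) by (simp add: parity_def)
    moreover have "plug f (pull w) = 0" if "f \<notin> C" for f
      using multider_plug_out[OF multider_R that] by (simp add: plug_pull fun_eq_iff sum_list_fun_apply)
    moreover have "plug (f + g) (pull w) = plug f (pull w) + plug g (pull w)"
      if "f \<in> C" "g \<in> C" for f g
      using multider_plug_add[OF multider_R that]
      by (simp add: plug_pull fun_eq_iff sum_list_fun_apply distrib_right sum.distrib)
    moreover have "plug (c *\<^sub>R f) (pull w) = c *\<^sub>R plug f (pull w)" if "f \<in> C" for c f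
      using multider_plug_scaleR[OF multider_R that]
      by (simp add: plug_pull fun_eq_iff sum_list_fun_apply scaleR_sum_right)
    moreover have "plug (f * g) (pull w) = scl f (plug g (pull w)) + scl g (plug f (pull w))"
      if "f \<in> C" "g \<in> C" for f g
      using multider_plug_mult[OF multider_R that]
      by (simp add: plug_pull fun_eq_iff sum_list_fun_apply distrib_right sum.distrib
        sum_distrib_left mult.assoc)
    moreover have "plug g (plug f (pull w)) = - plug f (plug g (pull w))" for f g
    proof -
      have swap: "pull (plug (e' j) (plug (e' i) w)) = - pull (plug (e' i) (plug (e' j) w))" for i j
        unfolding linear_neg[OF linear_pull, symmetric]
        by (rule arg_cong[where f = pull]) (rule alternating_swap[OF w(1)])
      have *: "scl a (scl b (pull (plug (e' j) (plug (e' i) w))))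
          = - scl b (scl a (pull (plug (e' i) (plug (e' j) w))))" for i j a b
        unfolding swap[of j i] by (simp add: fun_eq_iff mult.left_commute)
      have "plug g (plug f (pull w)) = (\<Sum>i\<in>I. \<Sum>j\<in>I.
        scl (R (e i) [f]) (scl (R (e j) [g]) (pull (plug (e' j) (plug (e' i) w)))))"
        by (simp only: plug_pull plug_sum plug_simps scl_sum_right)
      also have "\<dots> = (\<Sum>i\<in>I. \<Sum>j\<in>I. -
        scl (R (e j) [g]) (scl (R (e i) [f]) (pull (plug (e' i) (plug (e' j) w)))))"
        by (intro sum.cong refl *)
      also have "\<dots> = (\<Sum>j\<in>I. \<Sum>i\<in>I. -
        scl (R (e j) [g]) (scl (R (e i) [f]) (pull (plug (e' i) (plug (e' j) w)))))"
        by (rule sum.swap)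
      also have "\<dots> = - plug f (plug g (pull w))"
        by (simp only: plug_pull plug_sum plug_simps scl_sum_right sum_negf)
      finally show ?thesis .
    qed
    ultimately show ?thesis unfolding front_der_def by blast
  qed
  have "front_der (k + length fs) (after fs (pull w))" for fs
    using assms
  proof (induction fs arbitrary: k w)
    case Nil
    then show ?case using front by simp
  next
    case (Cons f fs)
    have s: "after fs (sum F S) = (\<Sum>i\<in>S. after fs (F i))" for F :: "'i \<Rightarrow> 'c list \<Rightarrow> 'c" and S
      by (simp add: fun_eq_iff after_apply sum_list_fun_apply)
    have fsum: "front_der n (sum F S)" if "\<And>i. front_der n (F i)" for F :: "'i \<Rightarrow> 'c list \<Rightarrow> 'c" and S n
      using that by (induction S rule: infinite_finite_induct)
        (simp_all only: sum.infinite sum.empty sum.insert front_der_zero front_der_add simp_thms)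
    have "front_der (Suc k + length fs) (after fs (pull (plug (e' i) w)))" for i
      by (rule Cons.IH[OF alternating_plug[OF Cons.prems(1)] parity_plug[OF Cons.prems(2)]])
    then have "front_der (k + length (f # fs)) (after (f # fs) (pull w))"
      by (simp add: plug_pull s) (intro fsum front_der_scl multider_mem[OF multider_R])
    then show ?case .
  qed
  then show ?thesis by (simp add: multider_def)
qed

lemma homogeneous_pull:
  assumes "homogeneous k w"
  shows "homogeneous k (pull w)"
proof -
  have "pull w fs = 0" if "int (length fs) \<noteq> k" for fs
    using that assms
  proof (induction fs arbitrary: k w)
    case Nil
    then show ?case by (simp add: homogeneous_def)
  next
    case (Cons f fs)
    have "pull (plug (e' i) w) fs = 0" for i
      using Cons.prems(1) by (intro Cons.IH[OF _ homogeneous_plug[OF Cons.prems(2)]]) auto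
    then have "pull w (f # fs) = 0" by (simp add: pull_Cons)
    then show ?case .
  qed
  then show ?thesis by (simp add: homogeneous_def)
qed

lemma homogeneous_neg: "homogeneous k F \<Longrightarrow> k < 0 \<Longrightarrow> F = 0"
  by (auto simp: homogeneous_def fun_eq_iff)

text \<open>Contracting with \<open>e' i\<close> and wedging with \<open>R (e i)\<close> counts the
  degree. A plugged argument meets either \<open>R (e i)\<close>, which leaves the pullback itself,
  or the contracted form, to which the claim in degree \<open>k\<close> applies.\<close>

lemma euler_pull:
  assumes "alternating w" "homogeneous (int k) w"
  shows "(\<Sum>i\<in>I. wdg (R (e i)) (pull (plug (e' i) w))) = real k *\<^sub>R pull w"
  using assms
proof (induction k arbitrary: w)
  case 0
  have "plug (e' i) w = 0" for i
    by (rule homogeneous_neg[OF homogeneous_plug[OF 0(2)]]) simp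
  then have "(\<Sum>i\<in>I. wdg (R (e i)) (pull (plug (e' i) w))) = real 0 *\<^sub>R pull w"
    by (simp add: linear_0[OF linear_pull])
  then show ?case .
next
  case (Suc k)
  have homogeneous: "homogeneous (int k) (plug x w)" for x
    using homogeneous_plug[OF Suc.prems(2), of x] by simp
  have "(\<Sum>i\<in>I. wdg (R (e i)) (pull (plug (e' i) w))) = real (Suc k) *\<^sub>R pull w"
  proof (rule list_fun_eqI)
    show "(\<Sum>i\<in>I. wdg (R (e i)) (pull (plug (e' i) w))) [] = (real (Suc k) *\<^sub>R pull w) []"
      using multider_odd_Nil[OF multider_R] Suc.prems(2) by (simp add: sum_list_fun_apply homogeneous_def)
    fix f
    have "plug f (wdg (R (e i)) (pull (plug (e' i) w))) = scl (R (e i) [f]) (pull (plug (e' i) w))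
      + (\<Sum>j\<in>I. scl (R (e j) [f]) (wdg (R (e i)) (pull (plug (e' i) (plug (e' j) w)))))" for i
      unfolding plug_wdg plug_homogeneous_1[OF homogeneous_R] twist_parity[OF multider_parity[OF multider_R]] plug_pull[of f "plug _ w"]
        wdg_sum_right alternating_swap[OF Suc.prems(1), of _ "e' i"] linear_neg[OF linear_pull]
      by (simp add: sum_negf[symmetric] fun_eq_iff sum_list_fun_apply)
    then have "plug f (\<Sum>i\<in>I. wdg (R (e i)) (pull (plug (e' i) w))) =
      plug f (pull w) + (\<Sum>i\<in>I. \<Sum>j\<in>I. scl (R (e j) [f]) (wdg (R (e i)) (pull (plug (e' i) (plug (e' j) w)))))"
      by (simp only: plug_sum sum.distrib plug_pull[of f w])
    also have "(\<Sum>i\<in>I. \<Sum>j\<in>I. scl (R (e j) [f]) (wdg (R (e i)) (pull (plug (e' i) (plug (e' j) w)))))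
      = (\<Sum>j\<in>I. scl (R (e j) [f]) (\<Sum>i\<in>I. wdg (R (e i)) (pull (plug (e' i) (plug (e' j) w)))))"
      by (subst sum.swap) (simp only: scl_sum_right)
    also have "\<dots> = (\<Sum>j\<in>I. scl (R (e j) [f]) (real k *\<^sub>R pull (plug (e' j) w)))"
    proof (intro sum.cong refl arg_cong[of _ _ "scl _"])
      fix j
      show "(\<Sum>i\<in>I. wdg (R (e i)) (pull (plug (e' i) (plug (e' j) w)))) = real k *\<^sub>R pull (plug (e' j) w)"
        by (rule Suc.IH[OF alternating_plug[OF Suc.prems(1)] homogeneous])
    qed
    also have "\<dots> = real k *\<^sub>R plug f (pull w)"
      by (simp add: plug_pull fun_eq_iff sum_list_fun_apply scaleR_sum_right)
    finally have *: "plug f (\<Sum>i\<in>I. wdg (R (e i)) (pull (plug (e' i) w)))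
      = plug f (pull w) + real k *\<^sub>R plug f (pull w)" .
    show "plug f (\<Sum>i\<in>I. wdg (R (e i)) (pull (plug (e' i) w)))
      = plug f (real (Suc k) *\<^sub>R pull w)"
      by (simp only: * plug_simps of_nat_Suc scaleR_add_left scaleR_one add.commute)
  qed
  then show ?case .
qed

text \<open>In degree 0 the pullback is a constant multiple of the unit. In positive degree
  \<open>pi_wdg_R\<close> leads back to lower degree, and the factor \<open>Suc k\<close> of the
  Euler identity is divided out.\<close>

lemma pi_pull:
  assumes "alternating w" "homogeneous (int k) w"
  shows "bracket 2 k \<pi> (pull w) = 0"
  using assms
proof (induction k arbitrary: w)
  case 0
  have "pull w = w [] *\<^sub>R unit_list"
    using homogeneous_0_eq[OF homogeneous_pull[OF 0(2)[simplified]]] by (simp add: scaleR_eq_scl)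
  then have "bracket 2 0 \<pi> (pull w) = 0"
    by (simp add: bracket_scaleR_right[OF multider_pi multider_unit] bracket_unit[OF multider_pi])
  then show ?case .
next
  case (Suc k)
  have homogeneous: "homogeneous (int k) (plug x w)" for x
    using homogeneous_plug[OF Suc.prems(2), of x] by simp
  note m = multider_pull[OF alternating_plug[OF Suc.prems(1)] homogeneous_parity[OF homogeneous]]
  have "bracket 2 (k + 1) \<pi> (wdg (R (e i)) (pull (plug (e' i) w))) = 0" for i
    using Suc.IH[OF alternating_plug[OF Suc.prems(1)] homogeneous] by (simp only: pi_wdg_R[OF m] wdg_zero minus_zero)
  then have "bracket 2 (k + 1) \<pi> (\<Sum>i\<in>I. wdg (R (e i)) (pull (plug (e' i) w))) = 0"
    by (simp only: bracket_sum_right[OF multider_pi multider_wdg_R[OF m]] sum.neutral_const)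
  then have "real (Suc k) *\<^sub>R bracket 2 (Suc k) \<pi> (pull w) = 0"
    using bracket_scaleR_right[OF multider_pi multider_pull[OF Suc.prems(1) homogeneous_parity[OF Suc.prems(2)]], of "real (Suc k)"]
    by (simp only: euler_pull[OF Suc.prems] Suc_eq_plus1)
  then have "bracket 2 (Suc k) \<pi> (pull w) = 0" by (simp del: of_nat_Suc)
  then show ?case .
qed

text \<open>The moment map is equivariant: \<open>R x\<close> changes the coefficients
  \<open>R (e i) [f]\<close> by brackets, and Casimir invariance transfers these to the entries
  \<open>e' i\<close> of the form.\<close>

lemma lie_R_pull:
  assumes "alternating w" "parity k w"
  shows "lie (R x) (pull w) = pull (lie_form x w)"
proof
  fix fs show "lie (R x) (pull w) fs = pull (lie_form x w) fs"
    using assms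
  proof (induction fs arbitrary: k w)
    case Nil
    \<comment> \<open>That a derivation kills constants is extracted from
      \<open>bracket_unit\<close>.\<close>
    have "lie (R x) (w [] *\<^sub>R unit_list) [] = (w [] *\<^sub>R lie (R x) unit_list) []"
      by (simp only: lie_scaleR_right[OF multider_R multider_unit])
    also have "\<dots> = 0"
      using bracket_unit(1)[OF multider_R] by (simp add: bracket_1 lie_def[symmetric])
    finally have *: "R x [of_real (w [])] - of_real (w []) * unit_list [R x []] = (0::'c)"
      by (simp add: lie_def bracket_Nil unit_list_def scaleR_conv_of_real[where 'a='c])
    moreover have "R x [] = 0" "plug 0 (pull w) = 0"
      using multider_odd_Nil[OF multider_R] multider_plug_zero[OF multider_pull[OF Nil]] by auto
    ultimately have "lie (R x) (pull w) [] = pull (lie_form x w) []"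
      by (simp add: lie_def bracket_Nil unit_list_def fun_eq_iff)
    then show ?case .
  next
    case (Cons f fs)
    note w = Cons.prems(1) and parity = Cons.prems(2)
    have m: "multider (Suc k) (pull (plug y w))" for y
      by (rule multider_pull[OF alternating_plug[OF w] parity_plug[OF parity]])
    have Rf: "R y [f] \<in> C" for y f by (rule multider_mem[OF multider_R])
    have Rbr: "R (br x y) [f] = R x [R y [f]] - R y [R x [f]]" for y
      using bracket_single[OF multider_R multider_R, of x y f] multider_double_odd[OF multider_R]
      unfolding bracket_1 lie_R by simp
    have bil: "bilinear (\<lambda>u v. scl (R u [f]) (pull (plug v w)))"
      unfolding bilinear_def
      using linear_R_apply[of "[f]"] linear_compose[OF alternating_linear[OF w] linear_pull]
      by (auto simp: linear_iff o_def fun_eq_iff distrib_left distrib_right)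
    have "plug f (lie (R x) (pull w)) = (\<Sum>i\<in>I. lie (R x) (scl (R (e i) [f]) (pull (plug (e' i) w))))
      - plug (R x [f]) (pull w)"
      unfolding plug_lie[OF multider_R homogeneous_R multider_pull[OF w parity]] plug_pull[of f]
      by (simp only: lie_sum_right[OF multider_R multider_scl[OF m Rf]])
    also have "\<dots> = (\<Sum>i\<in>I. scl (R (e i) [f]) (lie (R x) (pull (plug (e' i) w)))
      + scl (R (br x (e i)) [f]) (pull (plug (e' i) w)))"
      unfolding lie_scl[OF multider_R homogeneous_R m Rf] Rbr plug_pull[of "R x [f]"] sum_subtractf[symmetric]
      by (simp add: fun_eq_iff sum_list_fun_apply algebra_simps)
    also have "\<dots> = (\<Sum>i\<in>I. scl (R (e i) [f]) (lie (R x) (pull (plug (e' i) w))))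
      - (\<Sum>i\<in>I. scl (R (e i) [f]) (pull (plug (br x (e' i)) w)))"
      unfolding sum.distrib casimir_invariant[OF bil] by simp
    finally have *: "plug f (lie (R x) (pull w)) fs =
      (\<Sum>i\<in>I. R (e i) [f] * lie (R x) (pull (plug (e' i) w)) fs)
      - (\<Sum>i\<in>I. R (e i) [f] * pull (plug (br x (e' i)) w) fs)"
      by (simp add: sum_list_fun_apply)
    have IH: "lie (R x) (pull (plug (e' i) w)) fs = pull (lie_form x (plug (e' i) w)) fs" for i
      by (rule Cons.IH[OF alternating_plug[OF w] parity_plug[OF parity]])
    have "(\<Sum>i\<in>I. R (e i) [f] * pull (lie_form x (plug (e' i) w)) fs)
      - (\<Sum>i\<in>I. R (e i) [f] * pull (plug (br x (e' i)) w) fs) = pull (lie_form x w) (f # fs)"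
      unfolding pull_Cons plug_lie_form linear_diff[OF linear_pull]
      by (simp add: right_diff_distrib sum_subtractf)
    then have "lie (R x) (pull w) (f # fs) = pull (lie_form x w) (f # fs)"
      using * by (simp only: IH plug_apply)
    then show ?case .
  qed
qed

theorem diff_pull:
  assumes "alternating w" "homogeneous (int k) w"
  shows "qp_diff k (pull w) = pull (ce_sum w)"
  unfolding qp_diff_def pi_pull[OF assms] lie_R_pull[OF assms(1) homogeneous_parity[OF assms(2)]] ce_sum_def
    pull_scaleR linear_sum[OF linear_pull] pull_wdg pull_flat_form
  by simp

end

section \<open>The algebra of smooth functions\<close>

text \<open>On an open set the derivative depends only on values in the set. This permits replacing
  the \<open>frechet_derivative\<close> of a sum or product by the explicit formula, which is known
  on \<open>S\<close> only.\<close>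

lemma ck_on_cong:
  assumes "open S" "ck_on k S f" "\<And>x. x \<in> S \<Longrightarrow> f x = g x"
  shows "ck_on k S g"
  using assms(2,3)
proof (induction k arbitrary: f g)
  case 0
  then show ?case using continuous_on_cong[of S S f g] by simp
next
  case (Suc k)
  have "g differentiable at x \<and> frechet_derivative f (at x) = frechet_derivative g (at x)"
    if x: "x \<in> S" for x
  proof -
    have "f differentiable at x"
      using Suc.prems(1) x assms(1) by (simp add: differentiable_on_eq_differentiable_at)
    then have "(f has_derivative frechet_derivative f (at x)) (at x)"
      by (simp add: frechet_derivative_works)
    then have "(g has_derivative frechet_derivative f (at x)) (at x)"
      by (rule has_derivative_transform_within_open[OF _ assms(1) x Suc.prems(2)])
    then show ?thesis
      using frechet_derivative_at differentiable_def by blast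
  qed
  then show ?case
    using Suc.prems(1) assms(1)
    by (auto simp: differentiable_on_eq_differentiable_at intro: Suc.IH)
qed

lemma ck_on_SucI:
  assumes "open S" "\<And>x. x \<in> S \<Longrightarrow> (f has_derivative f' x) (at x)" "\<And>v. ck_on k S (\<lambda>x. f' x v)"
  shows "ck_on (Suc k) S f"
proof -
  have "ck_on k S (\<lambda>x. frechet_derivative f (at x) v)" for v
    using frechet_derivative_at[OF assms(2)] by (intro ck_on_cong[OF assms(1) assms(3)[of v]]) simp
  then show ?thesis
    using assms(1,2) by (auto simp: differentiable_on_eq_differentiable_at differentiable_def)
qed

lemma ck_on_Suc_has_derivative:
  "ck_on (Suc k) S f \<Longrightarrow> open S \<Longrightarrow> x \<in> S \<Longrightarrow> (f has_derivative frechet_derivative f (at x)) (at x)"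
  by (simp add: differentiable_on_eq_differentiable_at frechet_derivative_works)

lemma ck_on_mono: "ck_on (Suc k) S f \<Longrightarrow> ck_on k S f"
proof (induction k arbitrary: f)
  case 0
  then show ?case by (simp add: differentiable_imp_continuous_on)
next
  case (Suc k)
  from Suc.prems show ?case using Suc.IH unfolding ck_on.simps(2)[of "Suc k"] ck_on.simps(2)[of k] by blast
qed

lemma ck_on_const: "open S \<Longrightarrow> ck_on k S (\<lambda>x. c)"
proof (induction k arbitrary: c)
  case (Suc k)
  show ?case
    by (rule ck_on_SucI[OF Suc.prems has_derivative_const Suc.IH[OF Suc.prems]])
qed simp

lemma ck_on_add: "open S \<Longrightarrow> ck_on k S f \<Longrightarrow> ck_on k S g \<Longrightarrow> ck_on k S (\<lambda>x. f x + g x)"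
proof (induction k arbitrary: f g)
  case (Suc k)
  show ?case
    by (rule ck_on_SucI[OF Suc.prems(1) has_derivative_add[OF
      ck_on_Suc_has_derivative[OF Suc.prems(2,1)] ck_on_Suc_has_derivative[OF Suc.prems(3,1)]]])
      (use Suc in auto)
qed (simp add: continuous_on_add)

lemma ck_on_mult:
  fixes f g :: "'b::real_normed_vector \<Rightarrow> real"
  shows "open S \<Longrightarrow> ck_on k S f \<Longrightarrow> ck_on k S g \<Longrightarrow> ck_on k S (\<lambda>x. f x * g x)"
proof (induction k arbitrary: f g)
  case (Suc k)
  show ?case
  proof (rule ck_on_SucI[OF Suc.prems(1) has_derivative_mult[OF
      ck_on_Suc_has_derivative[OF Suc.prems(2,1)] ck_on_Suc_has_derivative[OF Suc.prems(3,1)]]])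
    fix v
    show "ck_on k S (\<lambda>x. f x * frechet_derivative g (at x) v + frechet_derivative f (at x) v * g x)"
      using Suc.prems ck_on_mono[OF Suc.prems(2)] ck_on_mono[OF Suc.prems(3)]
      by (intro ck_on_add Suc.IH) auto
  qed
qed (simp add: continuous_on_mult)

lemma function_algebra_smooth_functions:
  assumes "smooth_manifold A"
  shows "function_algebra (smooth_functions A)"
proof
  have op: "open (x ` U)" if "(U, x) \<in> A" for U x
    using assms that by (auto simp: smooth_manifold_def)
  fix f g :: "'a \<Rightarrow> real" and c :: real
  show "1 \<in> smooth_functions A"
    by (auto simp: smooth_functions_def smooth_on_def o_def intro!: ck_on_const op)
  show "f + g \<in> smooth_functions A" "f * g \<in> smooth_functions A"
    if "f \<in> smooth_functions A" "g \<in> smooth_functions A"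
    using that by (auto simp: smooth_functions_def smooth_on_def o_def intro!: ck_on_add ck_on_mult op)
  show "c *\<^sub>R f \<in> smooth_functions A" if "f \<in> smooth_functions A"
    using that by (auto simp: smooth_functions_def smooth_on_def o_def intro!: ck_on_const ck_on_mult op)
qed

section \<open>Shuffle sums\<close>

text \<open>Separates the sets according to which factor receives the first list entry, as the
  recursion of \<open>wdg_list\<close> does.\<close>

lemma sum_Pow_lessThan_Suc:
  fixes f :: "nat set \<Rightarrow> 'x::comm_monoid_add"
  shows "(\<Sum>I\<in>Pow {..<Suc n}. f I) =
    (\<Sum>J\<in>Pow {..<n}. f (insert 0 (Suc ` J))) + (\<Sum>J\<in>Pow {..<n}. f (Suc ` J))"
proof -
  have P: "Pow {..<Suc n} = insert 0 ` image Suc ` Pow {..<n} \<union> image Suc ` Pow {..<n}"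
    unfolding lessThan_Suc_eq_insert_0 Pow_insert image_Pow_surj[OF refl] by blast
  have inj: "inj_on (image Suc) X" "inj_on (\<lambda>J. insert 0 (Suc ` J)) X" for X
    by (auto intro!: inj_onI simp: inj_image_eq_iff)
  show ?thesis
    unfolding P image_image
    by (subst sum.union_disjoint) (auto simp: sum.reindex inj)
qed

text \<open>If 0 is left out, it forms an inversion with each of the \<open>card J\<close> chosen
  indices, which is the sign produced by \<open>twist\<close>. If 0 is chosen, it forms
  none.\<close>

lemma card_inversions_Suc:
  assumes "J \<subseteq> {..<n}"
  shows "card {(i, j). i \<in> Suc ` J \<and> j \<in> {..<Suc n} - Suc ` J \<and> j < i}
    = card J + card {(i, j). i \<in> J \<and> j \<in> {..<n} - J \<and> j < i}"
    and "card {(i, j). i \<in> insert 0 (Suc ` J) \<and> j \<in> {..<Suc n} - insert 0 (Suc ` J) \<and> j < i}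
    = card {(i, j). i \<in> J \<and> j \<in> {..<n} - J \<and> j < i}"
proof -
  let ?N = "{(i, j). i \<in> J \<and> j \<in> {..<n} - J \<and> j < i}"
  have fin: "finite J" "finite ?N"
    using assms finite_subset[of ?N "{..<n} \<times> {..<n}"] by (auto intro: finite_subset)
  have c: "card (map_prod Suc Suc ` ?N) = card ?N"
    by (rule card_image) (auto intro!: inj_onI)
  have "{(i, j). i \<in> insert 0 (Suc ` J) \<and> j \<in> {..<Suc n} - insert 0 (Suc ` J) \<and> j < i}
      = map_prod Suc Suc ` ?N"
    by (auto simp: image_iff less_Suc_eq_0_disj)
  then show "card {(i, j). i \<in> insert 0 (Suc ` J) \<and> j \<in> {..<Suc n} - insert 0 (Suc ` J) \<and> j < i}
      = card ?N"
    using c by simp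
  have "{(i, j). i \<in> Suc ` J \<and> j \<in> {..<Suc n} - Suc ` J \<and> j < i}
      = (Suc ` J) \<times> {0} \<union> map_prod Suc Suc ` ?N"
    by (auto simp: image_iff less_Suc_eq_0_disj)
  moreover have "card ((Suc ` J) \<times> {0::nat}) = card J"
    by (simp add: card_cartesian_product card_image)
  moreover have "card ((Suc ` J) \<times> {0} \<union> map_prod Suc Suc ` ?N)
      = card ((Suc ` J) \<times> {0::nat}) + card (map_prod Suc Suc ` ?N)"
    using fin by (intro card_Un_disjoint) auto
  ultimately show "card {(i, j). i \<in> Suc ` J \<and> j \<in> {..<Suc n} - Suc ` J \<and> j < i} = card J + card ?N"
    using c by simp
qed

lemma shuffle_sign_Suc:
  assumes "J \<subseteq> {..<n}"
  shows "shuffle_sign (Suc n) (Suc ` J) = (-1) ^ card J * shuffle_sign n J"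
    and "shuffle_sign (Suc n) (insert 0 (Suc ` J)) = shuffle_sign n J"
  unfolding shuffle_sign_def card_inversions_Suc[OF assms] by (simp_all add: power_add)

lemma nths_Cons_Suc:
  "nths (v # vs) (Suc ` J) = nths vs J"
  "nths (v # vs) (- Suc ` J) = v # nths vs (- J)"
  "nths (v # vs) (insert 0 (Suc ` J)) = v # nths vs J"
  "nths (v # vs) (- insert 0 (Suc ` J)) = nths vs (- J)"
  by (auto simp: nths_Cons image_iff intro!: arg_cong[of _ _ "nths vs"])

lemma length_nths_subset: "J \<subseteq> {..<length vs} \<Longrightarrow> length (nths vs J) = card J"
  unfolding length_nths by (rule arg_cong[of _ _ card]) auto

lemma wdg_shuffle:
  "wdg F G vs = (\<Sum>I\<in>Pow {..<length vs}.
     shuffle_sign (length vs) I *\<^sub>R (F (nths vs I) * G (nths vs (- I))))"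
proof (induction vs arbitrary: F G)
  case Nil
  show ?case by (simp add: shuffle_sign_def)
next
  case (Cons v vs)
  have "wdg F G (v # vs) = (\<Sum>J\<in>Pow {..<length vs}. shuffle_sign (length vs) J *\<^sub>R (plug v F (nths vs J) * G (nths vs (- J))))
    + (\<Sum>J\<in>Pow {..<length vs}. shuffle_sign (length vs) J *\<^sub>R (twist F (nths vs J) * plug v G (nths vs (- J))))"
    unfolding wdg_Cons Cons ..
  also have "\<dots> = (\<Sum>I\<in>Pow {..<length (v # vs)}.
     shuffle_sign (length (v # vs)) I *\<^sub>R (F (nths (v # vs) I) * G (nths (v # vs) (- I))))"
    unfolding list.size(4) add_0_right add_Suc_right sum_Pow_lessThan_Suc nths_Cons_Suc
    by (intro arg_cong2[of _ _ _ _ "(+)"] sum.cong refl)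
      (auto simp: shuffle_sign_Suc length_nths_subset mult.commute)
  finally show ?case .
qed

lemma insertion_shuffle:
  "insertion F G vs = (\<Sum>I\<in>Pow {..<length vs}.
     shuffle_sign (length vs) I *\<^sub>R F (nths vs I @ [G (nths vs (- I))]))"
proof (induction vs arbitrary: F G)
  case Nil
  show ?case by (simp add: shuffle_sign_def)
next
  case (Cons v vs)
  have "insertion F G (v # vs) = (\<Sum>J\<in>Pow {..<length vs}. shuffle_sign (length vs) J *\<^sub>R plug v F (nths vs J @ [G (nths vs (- J))]))
    - (\<Sum>J\<in>Pow {..<length vs}. shuffle_sign (length vs) J *\<^sub>R twist F (nths vs J @ [plug v G (nths vs (- J))]))"
    unfolding insertion_Cons Cons ..
  also have "\<dots> = (\<Sum>J\<in>Pow {..<length vs}. shuffle_sign (length vs) J *\<^sub>R plug v F (nths vs J @ [G (nths vs (- J))]))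
    + (\<Sum>J\<in>Pow {..<length vs}. - (shuffle_sign (length vs) J *\<^sub>R twist F (nths vs J @ [plug v G (nths vs (- J))])))"
    by (simp add: sum_negf)
  also have "\<dots> = (\<Sum>I\<in>Pow {..<length (v # vs)}.
     shuffle_sign (length (v # vs)) I *\<^sub>R F (nths (v # vs) I @ [G (nths (v # vs) (- I))]))"
    unfolding list.size(4) add_0_right add_Suc_right sum_Pow_lessThan_Suc nths_Cons_Suc
    by (intro arg_cong2[of _ _ _ _ "(+)"] sum.cong refl)
      (auto simp: shuffle_sign_Suc length_nths_subset mult.commute)
  finally show ?case .
qed

lemma wedge_eq_wdg: "wedge = wdg"
  by (intro ext) (simp add: wedge_def wdg_shuffle mult.assoc)

lemma mv_insert_eq_insertion: "mv_insert A P Q = insertion (mv_eval A P) (mv_eval A Q)"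
  by (intro ext) (simp add: mv_insert_def insertion_shuffle)

text \<open>Evaluation at \<open>p\<close> is a ring homomorphism, so it commutes with the product;
  \<open>d\<close> will be the differential at \<open>p\<close>.\<close>

lemma wdg_pointwise:
  fixes F G :: "'v list \<Rightarrow> 'a \<Rightarrow> real"
  assumes "\<And>vs. F vs p = F' (map d vs)" "\<And>vs. G vs p = G' (map d vs)"
  shows "wdg F G vs p = wdg F' G' (map d vs)"
  using assms
proof (induction vs arbitrary: F G F' G')
  case Nil
  then show ?case by (simp only: wdg_Nil times_fun_apply list.map)
next
  case (Cons v vs)
  have "wdg (plug v F) G vs p = wdg (plug (d v) F') G' (map d vs)"
    by (rule Cons.IH) (simp_all add: Cons.prems)
  moreover have "wdg (twist F) (plug v G) vs p = wdg (twist F') (plug (d v) G') (map d vs)"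
    by (rule Cons.IH) (simp_all add: Cons.prems)
  ultimately have "wdg F G (v # vs) p = wdg F' G' (map d (v # vs))"
    by (simp only: wdg_Cons plus_fun_apply list.map)
  then show ?case .
qed

section \<open>Multivector fields as multiderivations\<close>

lemma alt_forms_linear:
  assumes w: "w \<in> alt_forms V k" and V: "set as \<subseteq> V" "set bs \<subseteq> V" "u \<in> V" "v \<in> V"
    and uv: "a *\<^sub>R u + b *\<^sub>R v \<in> V"
  shows "w (as @ (a *\<^sub>R u + b *\<^sub>R v) # bs) = a * w (as @ u # bs) + b * w (as @ v # bs)"
proof (cases "length (as @ u # bs) = k")
  case True
  have "w ((as @ u # bs)[length as := a *\<^sub>R u + b *\<^sub>R v])
    = a * w ((as @ u # bs)[length as := u]) + b * w ((as @ u # bs)[length as := v])"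
  proof -
    have "set (as @ u # bs) \<subseteq> V" "length as < k" using V True by auto
    then show ?thesis
      using w True V(3,4) unfolding alt_forms_def by blast
  qed
  then show ?thesis by simp
next
  case False
  then have "w (as @ x # bs) = 0" for x
    using w unfolding alt_forms_def by force
  then show ?thesis by simp
qed

text \<open>Polarization: expand the form on the repeated entry \<open>u + v\<close>.\<close>

lemma alt_forms_swap:
  assumes w: "w \<in> alt_forms V k" and V: "set as \<subseteq> V" "set bs \<subseteq> V" "u \<in> V" "v \<in> V" "u + v \<in> V"
  shows "w (as @ u # v # bs) = - w (as @ v # u # bs)"
proof -
  have rep: "w (as @ x # x # bs) = 0" for x
    using w unfolding alt_forms_def by simp
  have l: "w (as @ (u + v) # xs) = w (as @ u # xs) + w (as @ v # xs)" if "set xs \<subseteq> V" for xs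
    using alt_forms_linear[OF w V(1) that V(3,4), of 1 1] V(5) by simp
  have r: "w (as @ x # (u + v) # bs) = w (as @ x # u # bs) + w (as @ x # v # bs)" if "x \<in> V" for x
    using alt_forms_linear[OF w _ V(2,3,4), of "as @ [x]" 1 1] V that by simp
  show ?thesis
    using rep[of "u + v"] V by (simp add: l r rep[of u] rep[of v])
qed

lemma alt_forms_zero_outside: "w \<in> alt_forms V k \<Longrightarrow> \<not> (length vs = k \<and> set vs \<subseteq> V) \<Longrightarrow> w vs = 0"
  unfolding alt_forms_def by blast

locale manifold =
  fixes A :: "('a::{t2_space, second_countable_topology}, 'b::real_normed_vector) chart set"
  assumes manifold: "smooth_manifold A"

sublocale manifold \<subseteq> function_algebra "smooth_functions A"
  by (rule function_algebra_smooth_functions[OF manifold])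

context manifold begin

abbreviation "C \<equiv> smooth_functions A"
abbreviation "ctg \<equiv> cotangent_space A"
abbreviation "dif \<equiv> differential A"

lemma tangent_linear:
  "v \<in> tangent_space A p \<Longrightarrow> f \<in> C \<Longrightarrow> g \<in> C \<Longrightarrow> v (a *\<^sub>R f + b *\<^sub>R g) = a * v f + b * v g"
  and tangent_mult: "v \<in> tangent_space A p \<Longrightarrow> f \<in> C \<Longrightarrow> g \<in> C \<Longrightarrow> v (f * g) = v f * g p + f p * v g"
  and tangent_out: "v \<in> tangent_space A p \<Longrightarrow> f \<notin> C \<Longrightarrow> v f = 0"
  by (auto simp: tangent_space_def)

lemma dif_linear: "f \<in> C \<Longrightarrow> g \<in> C \<Longrightarrow> dif p (a *\<^sub>R f + b *\<^sub>R g) = a *\<^sub>R dif p f + b *\<^sub>R dif p g"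
  by (auto simp: differential_def fun_eq_iff tangent_linear[of _ p f g])

lemma dif_mult: "f \<in> C \<Longrightarrow> g \<in> C \<Longrightarrow> dif p (f * g) = g p *\<^sub>R dif p f + f p *\<^sub>R dif p g"
  by (auto simp: differential_def fun_eq_iff tangent_mult[of _ p f g])

lemma dif_out: "f \<notin> C \<Longrightarrow> dif p f = 0"
  by (auto simp: differential_def fun_eq_iff tangent_out)

lemma dif_zero: "dif p 0 = 0"
  using dif_linear[OF zero_closed zero_closed, of p 0 0] by simp

text \<open>Non-smooth \<open>f\<close> are included: tangent vectors vanish on them, so their
  differential is that of 0. This removes smoothness conditions when forms are evaluated on
  arbitrary lists.\<close>

lemma dif_mem: "dif p f \<in> ctg p"
  using dif_out[of f p] dif_zero[of p] zero_closed unfolding cotangent_space_def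
  by (cases "f \<in> C") (auto simp: image_iff)

lemma cot_linear: "a \<in> ctg p \<Longrightarrow> b \<in> ctg p \<Longrightarrow> s *\<^sub>R a + t *\<^sub>R b \<in> ctg p"
  by (auto simp: cotangent_space_def dif_linear[symmetric] closed)

lemma cot_add: "a \<in> ctg p \<Longrightarrow> b \<in> ctg p \<Longrightarrow> a + b \<in> ctg p"
  using cot_linear[of a p b 1 1] by simp

lemma dif_map_mem: "set (map (dif p) fs) \<subseteq> ctg p"
  using dif_mem by auto

definition rep :: "'a \<Rightarrow> 'a cotangent \<Rightarrow> 'a \<Rightarrow> real" where
  "rep p a = (SOME f. f \<in> C \<and> dif p f = a)"

lemma rep: "a \<in> ctg p \<Longrightarrow> rep p a \<in> C \<and> dif p (rep p a) = a"
  using someI_ex[of "\<lambda>f. f \<in> C \<and> dif p f = a"] by (auto simp: rep_def cotangent_space_def)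

lemma map_rep: "set as \<subseteq> ctg p \<Longrightarrow> set (map (rep p) as) \<subseteq> C \<and> map (dif p) (map (rep p) as) = as"
  using rep by (induction as) auto

lemma mv_of_eq: "mv_of A F p as = (if set as \<subseteq> ctg p then F (map (rep p) as) p else 0)"
proof -
  have "rep p = (\<lambda>a. SOME f. f \<in> C \<and> dif p f = a)"
    by (rule ext) (rule rep_def)
  then show ?thesis by (simp only: mv_of_def)
qed

lemma mv_fields_alt: "P \<in> mv_fields A k \<Longrightarrow> P p \<in> alt_forms (ctg p) k"
  by (simp add: mv_fields_def)

lemma homogeneous_mv_eval: "P \<in> mv_fields A k \<Longrightarrow> homogeneous (int k) (mv_eval A P)"
  using alt_forms_zero_outside[OF mv_fields_alt]
  by (fastforce simp: homogeneous_def mv_eval_def fun_eq_iff)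

lemma mv_eval_zero_entry:
  assumes P: "P \<in> mv_fields A k" and "dif p f = 0"
  shows "mv_eval A P (as @ f # bs) p = 0"
  using alt_forms_linear[OF mv_fields_alt[OF P] dif_map_mem[of p as] dif_map_mem[of p bs] dif_mem dif_mem, of 0 f 0 f]
    dif_mem[of p 0] assms(2)
  by (simp add: mv_eval_def dif_zero)

lemma multider_mv_eval:
  assumes P: "P \<in> mv_fields A k"
  shows "multider k (mv_eval A P)"
  unfolding multider_def
proof
  fix hs
  let ?F = "after hs (mv_eval A P)"
  note alt = mv_fields_alt[OF P]
  have lin: "P p (map (dif p) hs @ (a *\<^sub>R dif p f + b *\<^sub>R dif p g) # map (dif p) gs)
      = a * P p (map (dif p) hs @ dif p f # map (dif p) gs) + b * P p (map (dif p) hs @ dif p g # map (dif p) gs)"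
    for p a b f g gs
    by (rule alt_forms_linear[OF alt dif_map_mem dif_map_mem dif_mem dif_mem cot_linear[OF dif_mem dif_mem]])
  have "?F [] \<in> C"
  proof (cases "length hs = k")
    case True
    show ?thesis
    proof (cases "set hs \<subseteq> C")
      case sub: True
      then show ?thesis using P True by (simp add: after_apply mv_fields_def)
    next
      case False
      then obtain as f bs where hs: "hs = as @ f # bs" and f: "f \<notin> C"
        by (meson split_list subsetI)
      have "?F [] = 0"
        unfolding hs after_apply append_Nil2
        by (rule ext) (simp add: mv_eval_zero_entry[OF P dif_out[OF f]])
      then show ?thesis using zero_closed by simp
    qed
  next
    case False
    then have "?F [] = 0"
      using homogeneous_mv_eval[OF P] by (simp add: after_apply homogeneous_def)
    then show ?thesis using zero_closed by simp
  qed
  moreover have "odd (k + length hs) \<longrightarrow> ?F [] = 0"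
    using homogeneous_mv_eval[OF P] by (cases "length hs = k") (auto simp: after_apply homogeneous_def)
  moreover have "plug f ?F = 0" if "f \<notin> C" for f
    by (rule ext, rule ext) (simp add: after_apply mv_eval_zero_entry[OF P dif_out[OF that]])
  moreover have "plug (f + g) ?F = plug f ?F + plug g ?F" if "f \<in> C" "g \<in> C" for f g
    using dif_linear[OF that, of _ 1 1] lin[of _ 1 _ 1]
    by (intro ext) (simp add: after_apply mv_eval_def)
  moreover have "plug (c *\<^sub>R f) ?F = c *\<^sub>R plug f ?F" if "f \<in> C" for c f
    using dif_linear[OF that that, of _ c 0] lin[of _ c _ 0]
    by (intro ext) (simp add: after_apply mv_eval_def)
  moreover have "plug (f * g) ?F = scl f (plug g ?F) + scl g (plug f ?F)" if "f \<in> C" "g \<in> C" for f g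
    using dif_mult[OF that] lin
    by (intro ext) (simp add: after_apply mv_eval_def)
  moreover have "plug g (plug f ?F) = - plug f (plug g ?F)" for f g
  proof (rule ext, rule ext)
    fix gs p
    show "plug g (plug f ?F) gs p = (- plug f (plug g ?F)) gs p"
      using alt_forms_swap[OF alt dif_map_mem[of p hs] dif_map_mem[of p gs] dif_mem dif_mem cot_add[OF dif_mem dif_mem], of f g]
      by (simp add: after_apply mv_eval_def)
  qed
  ultimately show "front_der (k + length hs) ?F"
    unfolding front_der_def by blast
qed

lemma multider_after: "multider k F \<Longrightarrow> multider (k + length hs) (after hs F)"
proof (induction hs arbitrary: k F)
  case (Cons h hs)
  have "multider (Suc k + length hs) (after hs (plug h F))"
    by (rule Cons.IH[OF multider_plug[OF Cons.prems]])
  then have "multider (k + length (h # hs)) (after (h # hs) F)" by simp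
  then show ?case .
qed simp

lemma multider_zero_entry: "multider k F \<Longrightarrow> f \<notin> C \<or> f = 0 \<Longrightarrow> F (as @ f # bs) = 0"
proof -
  assume "multider k F" "f \<notin> C \<or> f = 0"
  then have "plug f (after as F) = 0"
    using multider_plug_out[OF multider_after] multider_plug_zero[OF multider_after] by blast
  from fun_cong[OF this, of bs] show ?thesis by (simp add: after_apply)
qed

text \<open>Adjacent exchanges bring the equal entries together, where skew symmetry makes the value
  its own negative.\<close>

lemma multider_repeat: "multider k F \<Longrightarrow> F (as @ f # bs @ f # cs) = 0"
proof (induction bs arbitrary: as)
  case Nil
  have "F (as @ f # f # cs) = - F (as @ f # f # cs)"
    using multider_plug_swap[OF multider_after[OF Nil, of as], of f f]
    unfolding fun_eq_iff[of "plug _ _"] by (simp add: after_apply)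
  then have "2 *\<^sub>R F (as @ f # f # cs) = 0"
    unfolding scaleR_2 by (metis add.right_inverse)
  then have "F (as @ f # [] @ f # cs) = 0" by simp
  then show ?case .
next
  case (Cons b bs)
  have "F (as @ f # b # bs @ f # cs) = - F (as @ b # f # bs @ f # cs)"
    using multider_plug_swap[OF multider_after[OF Cons.prems, of as], of b f]
    unfolding fun_eq_iff[of "plug _ _"] by (simp add: after_apply)
  moreover have "F ((as @ [b]) @ f # bs @ f # cs) = 0" by (rule Cons.IH[OF Cons.prems])
  ultimately have "F (as @ f # (b # bs) @ f # cs) = 0" by simp
  then show ?case .
qed

text \<open>The map \<open>f \<mapsto> F (f # vs) p\<close> is itself a tangent vector at \<open>p\<close>, so neither charts nor bump
  functions are needed.\<close>

lemma derivation_dif_cong: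
  assumes F: "multider k F" and fg: "f \<in> C" "g \<in> C" "dif p f = dif p g"
  shows "F (f # vs) p = F (g # vs) p"
proof -
  let ?v = "\<lambda>f. F (f # vs) p"
  have add: "F ((a *\<^sub>R f + b *\<^sub>R g) # vs) = a *\<^sub>R F (f # vs) + b *\<^sub>R F (g # vs)" if "f \<in> C" "g \<in> C" for f g a b
    using multider_plug_add[OF F scaleR_closed[OF that(1)] scaleR_closed[OF that(2)], of a b]
      multider_plug_scaleR[OF F that(1), of a] multider_plug_scaleR[OF F that(2), of b]
    unfolding fun_eq_iff[of "plug _ _"] by simp
  have mult: "F ((f * g) # vs) = f * F (g # vs) + g * F (f # vs)" if "f \<in> C" "g \<in> C" for f g
    using multider_plug_mult[OF F that] unfolding fun_eq_iff[of "plug _ _"] by simp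
  have out: "F (f # vs) = 0" if "f \<notin> C" for f
    using multider_plug_out[OF F that] unfolding fun_eq_iff[of "plug _ _"] by simp
  have "?v \<in> tangent_space A p"
    by (simp add: tangent_space_def add mult out)
  then show ?thesis
    using fun_cong[OF fg(3), of ?v] by (simp add: differential_def)
qed

lemma multider_dif_cong:
  assumes "multider k F" "set fs \<subseteq> C" "set gs \<subseteq> C" "map (dif p) fs = map (dif p) gs"
  shows "F fs p = F gs p"
  using assms
proof (induction fs arbitrary: k F gs)
  case (Cons f fs)
  obtain g gs' where gs: "gs = g # gs'" "dif p f = dif p g" "map (dif p) fs = map (dif p) gs'"
    using Cons.prems(4) by (cases gs) auto
  have "F (f # fs) p = F (g # fs) p"
    using Cons.prems gs by (intro derivation_dif_cong[OF Cons.prems(1)]) auto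
  also have "\<dots> = plug g F fs p" by simp
  also have "\<dots> = plug g F gs' p"
    using Cons.prems gs by (intro Cons.IH[OF multider_plug[OF Cons.prems(1)]]) auto
  finally have "F (f # fs) p = F gs p" by (simp add: gs(1))
  then show ?case .
qed simp

lemma mv_of_dif:
  assumes F: "multider k F" and fs: "set fs \<subseteq> C"
  shows "mv_of A F p (map (dif p) fs) = F fs p"
  unfolding mv_of_eq using map_rep[OF dif_map_mem[of p fs]] dif_map_mem[of p fs]
  by (auto intro!: multider_dif_cong[OF F _ fs] simp del: map_map set_map)

lemma mv_eval_mv_of:
  assumes F: "multider k F"
  shows "mv_eval A (mv_of A F) = F"
proof (rule ext, rule ext)
  fix fs p
  show "mv_eval A (mv_of A F) fs p = F fs p"
  proof (cases "set fs \<subseteq> C")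
    case True
    then show ?thesis using mv_of_dif[OF F] by (simp add: mv_eval_def)
  next
    case False
    then obtain as f bs where fs: "fs = as @ f # bs" and f: "f \<notin> C"
      by (meson split_list subsetI)
    \<comment> \<open>Non-smooth entries have the same differential as 0, so replacing them by 0
      leads back to smooth arguments; both sides then vanish.\<close>
    let ?z = "\<lambda>f. if f \<in> C then f else 0"
    have z: "map (dif p) fs = map (dif p) (map ?z fs)" "set (map ?z fs) \<subseteq> C"
      by (auto simp: dif_out dif_zero zero_closed)
    have "mv_eval A (mv_of A F) fs p = F (map ?z fs) p"
      unfolding mv_eval_def z(1) by (rule mv_of_dif[OF F z(2)])
    also have "\<dots> = 0"
      using f multider_zero_entry[OF F, of 0 "map ?z as" "map ?z bs"] by (simp add: fs)
    also have "\<dots> = F fs p"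
      using f multider_zero_entry[OF F, of f as bs] by (simp add: fs)
    finally show ?thesis .
  qed
qed

text \<open>Since values depend on differentials only, a linear combination of covectors may be
  represented by the same combination of functions. Equal covectors have equal representatives, so
  repetitions are inherited.\<close>

lemma mv_of_mem:
  assumes F: "multider k F" and homogeneous: "homogeneous (int k) F"
  shows "mv_of A F \<in> mv_fields A k"
proof -
  have "mv_of A F p \<in> alt_forms (ctg p) k" for p
  proof -
    have "length as = k \<and> set as \<subseteq> ctg p" if "mv_of A F p as \<noteq> 0" for as
    proof -
      have "set as \<subseteq> ctg p" "F (map (rep p) as) \<noteq> 0"
        using that by (auto simp: mv_of_eq split: if_splits)
      moreover from this(2) have "length as = k"
        using homogeneous unfolding homogeneous_def by (metis length_map of_nat_eq_iff)
      ultimately show ?thesis by blast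
    qed
    moreover have "mv_of A F p (as[i := a *\<^sub>R u + b *\<^sub>R v]) =
        a * mv_of A F p (as[i := u]) + b * mv_of A F p (as[i := v])"
      if "set as \<subseteq> ctg p" "i < length as" "u \<in> ctg p" "v \<in> ctg p" for as i a b u v
    proof -
      define xs ys where "xs = map (rep p) (take i as)" and "ys = map (rep p) (drop (Suc i) as)"
      have sub: "set (take i as) \<subseteq> ctg p" "set (drop (Suc i) as) \<subseteq> ctg p"
        using that(1) set_take_subset set_drop_subset by fastforce+
      have upd: "as[i := x] = map (dif p) (xs @ g # ys)" if "dif p g = x" for x g
        using that map_rep[OF sub(1)] map_rep[OF sub(2)] \<open>i < length as\<close>
        by (simp add: xs_def ys_def upd_conv_take_nth_drop)
      have C: "set (xs @ g # ys) \<subseteq> C" if "g \<in> C" for g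
        using that map_rep[OF sub(1)] map_rep[OF sub(2)] by (simp add: xs_def ys_def)
      have u: "rep p u \<in> C" "dif p (rep p u) = u" and v: "rep p v \<in> C" "dif p (rep p v) = v"
        using rep that(3,4) by auto
      have uv: "a *\<^sub>R rep p u + b *\<^sub>R rep p v \<in> C"
        "dif p (a *\<^sub>R rep p u + b *\<^sub>R rep p v) = a *\<^sub>R u + b *\<^sub>R v"
        using u v by (simp_all add: dif_linear closed)
      have "F (xs @ (a *\<^sub>R rep p u + b *\<^sub>R rep p v) # ys) =
        a *\<^sub>R F (xs @ rep p u # ys) + b *\<^sub>R F (xs @ rep p v # ys)"
        using multider_plug_add[OF multider_after[OF F, of xs] scaleR_closed[OF u(1)] scaleR_closed[OF v(1)], of a b]
          multider_plug_scaleR[OF multider_after[OF F, of xs] u(1), of a]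
          multider_plug_scaleR[OF multider_after[OF F, of xs] v(1), of b]
        unfolding fun_eq_iff[of "plug _ _"] by (simp add: after_apply)
      then show ?thesis
        unfolding upd[OF uv(2)] upd[OF u(2)] upd[OF v(2)] mv_of_dif[OF F C[OF uv(1)]]
          mv_of_dif[OF F C[OF u(1)]] mv_of_dif[OF F C[OF v(1)]]
        by simp
    qed
    moreover have "mv_of A F p as = 0" if "\<not> distinct as" for as
    proof -
      obtain xs ys zs y where "as = xs @ [y] @ ys @ [y] @ zs"
        using not_distinct_decomp[OF \<open>\<not> distinct as\<close>] by blast
      then show ?thesis using multider_repeat[OF F] by (simp add: mv_of_eq)
    qed
    ultimately show ?thesis unfolding alt_forms_def by blast
  qed
  then show ?thesis
    by (simp add: mv_fields_def mv_eval_mv_of[OF F] multider_mem[OF F])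
qed

lemma mv_fields_outside: "P \<in> mv_fields A k \<Longrightarrow> \<not> set as \<subseteq> ctg p \<Longrightarrow> P p as = 0"
  using alt_forms_zero_outside[OF mv_fields_alt] by blast

lemma mv_of_outside: "\<not> set as \<subseteq> ctg p \<Longrightarrow> mv_of A F p as = 0"
  by (simp add: mv_of_eq)

lemma mv_of_simps:
  "mv_of A (F + G) = mv_of A F + mv_of A G"
  "mv_of A (c *\<^sub>R F) = c *\<^sub>R mv_of A F"
  "mv_of A 0 = 0"
  by (auto simp: mv_of_eq fun_eq_iff)

lemma mv_of_sum: "mv_of A (sum F S) = (\<Sum>i\<in>S. mv_of A (F i))"
  using Modules.additive.sum[of "mv_of A" F S] by (simp add: Modules.additive_def mv_of_simps)

lemma schouten_eq: "schouten A p q P Q = mv_of A (bracket p q (mv_eval A P) (mv_eval A Q))"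
  unfolding schouten_def mv_insert_eq_insertion bracket_def
  by (rule arg_cong[of _ _ "mv_of A"]) (rule ext, simp)

lemma mv_wedge_eq:
  assumes "\<And>p as. \<not> set as \<subseteq> ctg p \<Longrightarrow> P p as = 0" "\<And>p as. \<not> set as \<subseteq> ctg p \<Longrightarrow> Q p as = 0"
  shows "mv_wedge P Q = mv_of A (wdg (mv_eval A P) (mv_eval A Q))"
proof (rule ext, rule ext)
  fix p as
  show "mv_wedge P Q p as = mv_of A (wdg (mv_eval A P) (mv_eval A Q)) p as"
  proof (cases "set as \<subseteq> ctg p")
    case True
    have "wdg (mv_eval A P) (mv_eval A Q) (map (rep p) as) p = wdg (P p) (Q p) (map (dif p) (map (rep p) as))"
      by (rule wdg_pointwise) (simp_all add: mv_eval_def)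
    then show ?thesis
      using True map_rep[OF True] by (simp add: mv_wedge_def wedge_eq_wdg mv_of_eq del: map_map)
  next
    case False
    \<comment> \<open>Every shuffle hands the entry outside the cotangent space to one of the
      factors, which then vanishes.\<close>
    have "P p (nths as I) * Q p (nths as (- I)) = 0" for I
    proof -
      have "set as \<subseteq> set (nths as I) \<union> set (nths as (- I))"
      proof
        fix x assume "x \<in> set as"
        then obtain i where "i < length as" "x = as ! i" by (auto simp: in_set_conv_nth)
        then show "x \<in> set (nths as I) \<union> set (nths as (- I))"
          by (cases "i \<in> I") (auto simp: set_nths)
      qed
      then have "\<not> set (nths as I) \<subseteq> ctg p \<or> \<not> set (nths as (- I)) \<subseteq> ctg p"
        using False by blast
      then show ?thesis using assms(1)[of "nths as I" p] assms(2)[of "nths as (- I)" p] by fastforce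
    qed
    then have "mv_wedge P Q p as = 0"
      by (simp only: mv_wedge_def wedge_eq_wdg wdg_shuffle scaleR_zero_right sum.neutral_const)
    then show ?thesis using False by (simp add: mv_of_eq)
  qed
qed

end

section \<open>The Chevalley--Eilenberg differential\<close>

text \<open>The property under which \<open>pull_apply\<close> identifies the pullback pointwise. It
  is applied to \<open>w\<close> and to \<open>ce_sum w\<close>.\<close>

definition multilin :: "('g::real_vector list \<Rightarrow> real) \<Rightarrow> bool" where
  "multilin w \<longleftrightarrow> (\<forall>vs. linear (\<lambda>x. plug x (after vs w)))"

lemma multilin_linear: "multilin w \<Longrightarrow> linear (\<lambda>x. plug x w)"
  unfolding multilin_def by (drule spec[of _ "[]"]) simp

lemma multilin_plug: "multilin w \<Longrightarrow> multilin (plug x w)"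
  unfolding multilin_def
proof
  fix vs assume "\<forall>vs. linear (\<lambda>y. plug y (after vs w))"
  from spec[OF this, of "x # vs"] show "linear (\<lambda>y. plug y (after vs (plug x w)))" by simp
qed

lemma alternating_multilin: "alternating w \<Longrightarrow> multilin w"
  by (simp add: alternating_def multilin_def)

lemma alternating_alt_forms:
  assumes w: "w \<in> alt_forms UNIV k"
  shows "alternating w" "homogeneous (int k) w"
proof -
  show "homogeneous (int k) w"
    using alt_forms_zero_outside[OF w] by (simp add: homogeneous_def)
  have "linear (\<lambda>x. w (vs @ x # ws))" for vs ws
    using alt_forms_linear[OF w, of vs ws _ _ 1 1] alt_forms_linear[OF w, of vs ws _ _ _ 0]
    by (intro linearI) auto
  then have "linear (\<lambda>x. plug x (after vs w))" for vs
    by (auto simp: linear_iff fun_eq_iff after_apply)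
  moreover have "plug y (plug x (after vs w)) = - plug x (plug y (after vs w))" for vs x y
    using alt_forms_swap[OF w, of vs _ x y] by (simp add: fun_eq_iff after_apply)
  ultimately show "alternating w"
    unfolding alternating_def by blast
qed

context quadratic_lie begin

lemma linear_lie_form_form: "linear (lie_form x)"
proof -
  have "lie_form x (a *\<^sub>R v + b *\<^sub>R v') ys = (a *\<^sub>R lie_form x v + b *\<^sub>R lie_form x v') ys" for a b v v' ys
  proof (induction ys arbitrary: v v')
    case (Cons y ys)
    have "lie_form x (a *\<^sub>R v + b *\<^sub>R v') (y # ys) = (a *\<^sub>R lie_form x v + b *\<^sub>R lie_form x v') (y # ys)"
      unfolding lie_form_Cons plug_simps Cons.IH by (simp add: lie_form_Cons algebra_simps)
    then show ?case .
  qed simp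
  then have "lie_form x (a *\<^sub>R v + b *\<^sub>R v') = a *\<^sub>R lie_form x v + b *\<^sub>R lie_form x v'" for a b v v'
    by (rule ext)
  from this[of 1 _ 1] this[of _ _ 0] show ?thesis
    by (intro linearI) auto
qed

lemma multilin_lie_form: "alternating w \<Longrightarrow> multilin (lie_form x w)"
proof -
  have "linear (\<lambda>y. plug y (after vs (lie_form x w)))" if "alternating w" for vs
    using that
  proof (induction vs arbitrary: w)
    case Nil
    have "linear (\<lambda>y. lie_form x (plug y w))"
      using linear_compose[OF alternating_linear[OF Nil] linear_lie_form_form] by (simp add: o_def)
    then have "linear (\<lambda>y. plug y (lie_form x w))"
      unfolding plug_lie_form by (intro linear_compose_sub linear_comp_plug[OF Nil] linear_br(1))
    then have "linear (\<lambda>y. plug y (after [] (lie_form x w)))" by (simp only: after.simps)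
    then show ?case .
  next
    case (Cons v vs)
    have "linear (\<lambda>y. plug y (after vs (lie_form x (plug v w))))"
      by (rule Cons.IH[OF alternating_plug[OF Cons.prems]])
    moreover have "linear (\<lambda>y. plug y (after vs (plug (br x v) w)))"
      using alternating_multilin[OF alternating_plug[OF Cons.prems]] by (simp add: multilin_def)
    ultimately have "linear (\<lambda>y. plug y (after (v # vs) (lie_form x w)))"
      by (simp add: plug_lie_form linear_compose_sub)
    then show ?case .
  qed
  then show "alternating w \<Longrightarrow> multilin (lie_form x w)"
    by (simp add: multilin_def)
qed

lemma linear_ce_sum: "linear ce_sum"
  by (rule linearI)
    (simp_all add: ce_sum_def linear_add[OF linear_lie_form_form] linear_scale[OF linear_lie_form_form]
      sum.distrib scaleR_add_right scaleR_sum_right mult.commute)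

lemma multilin_ce_sum: "alternating w \<Longrightarrow> multilin (ce_sum w)"
proof -
  have "linear (\<lambda>y. plug y (after vs (ce_sum w)))" if "alternating w" for vs
    using that
  proof (induction vs arbitrary: w)
    case Nil
    have "linear (\<lambda>y. lie_form y w - ce_sum (plug y w))"
      using linear_compose[OF alternating_linear[OF Nil] linear_ce_sum]
      by (intro linear_compose_sub linear_lie_form[OF Nil]) (simp add: o_def)
    then have "linear (\<lambda>y. plug y (after [] (ce_sum w)))"
      by (simp only: plug_ce_sum[OF Nil] after.simps)
    then show ?case .
  next
    case (Cons v vs)
    have "linear (\<lambda>y. plug y (after vs (ce_sum (plug v w))))"
      by (rule Cons.IH[OF alternating_plug[OF Cons.prems]])
    moreover have "linear (\<lambda>y. plug y (after vs (lie_form v w)))"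
      using multilin_lie_form[OF Cons.prems] by (simp add: multilin_def)
    ultimately have "linear (\<lambda>y. plug y (after (v # vs) (ce_sum w)))"
      by (simp add: plug_ce_sum[OF Cons.prems] linear_compose_sub)
    then show ?case .
  qed
  then show "alternating w \<Longrightarrow> multilin (ce_sum w)"
    by (simp add: multilin_def)
qed

lemma nths_Cons_Compl:
  "nths (v # vs) (- {0}) = vs"
  "nths (v # vs) (- {Suc j}) = v # nths vs (- {j})"
  "nths (v # vs) (- {0, Suc j}) = nths vs (- {j})"
  "nths (v # vs) (- {Suc i, Suc j}) = v # nths vs (- {i, j})"
  by (auto simp: nths_Cons nths_all intro!: arg_cong[of _ _ "nths vs"])

text \<open>Moving \<open>br x (ys ! j)\<close> to the front passes \<open>j\<close> entries, which
  yields the sign.\<close>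

lemma lie_form_eq:
  assumes "alternating w"
  shows "lie_form x w ys = - (\<Sum>j<length ys. (-1) ^ j * w (br x (ys ! j) # nths ys (- {j})))"
  using assms
proof (induction ys arbitrary: w)
  case (Cons y ys)
  have swap: "w (u # y # vs) = - w (y # u # vs)" for u vs
    using fun_cong[OF alternating_swap[OF Cons.prems, of y u], of vs] by simp
  have IH: "lie_form x (plug y w) ys = - (\<Sum>j<length ys. (-1) ^ j * plug y w (br x (ys ! j) # nths ys (- {j})))"
    by (rule Cons.IH[OF alternating_plug[OF Cons.prems]])
  have "lie_form x w (y # ys) = - (\<Sum>j<length (y # ys). (-1) ^ j * w (br x ((y # ys) ! j) # nths (y # ys) (- {j})))"
    unfolding lie_form_Cons IH list.size(4) add_0_right add_Suc_right sum.lessThan_Suc_shift nths_Cons_Compl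
    by (simp add: swap sum_negf)
  then show ?case .
qed simp

text \<open>The pairs that contain the first entry \<open>x\<close> add up to
  \<open>lie_form x w\<close>, the others to minus the differential of \<open>plug x w\<close>. This
  is the recursion in \<open>plug_ce_sum\<close>.\<close>

lemma ce_differential_eq:
  assumes "alternating w"
  shows "ce_differential br w = ce_sum w"
proof
  fix xs show "ce_differential br w xs = ce_sum w xs"
    using assms
  proof (induction xs arbitrary: w)
    case Nil
    show ?case by (simp add: ce_differential_def ce_sum_Nil)
  next
    case (Cons x xs)
    have swap: "w (u # x # vs) = - w (x # u # vs)" for u vs
      using fun_cong[OF alternating_swap[OF Cons.prems, of x u], of vs] by simp
    have IH: "ce_differential br (plug x w) xs = ce_sum (plug x w) xs"
      by (rule Cons.IH[OF alternating_plug[OF Cons.prems]])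
    have "ce_differential br w (x # xs) = lie_form x w xs - ce_differential br (plug x w) xs"
      unfolding ce_differential_def list.size(4) add_0_right add_Suc_right sum.lessThan_Suc_shift
        nths_Cons_Compl lie_form_eq[OF Cons.prems]
      by (simp add: swap sum_negf sum.distrib sum_subtractf)
    also have "\<dots> = ce_sum w (x # xs)"
      using fun_cong[OF plug_ce_sum[OF Cons.prems], of x xs] by (simp add: IH)
    finally show ?case .
  qed
qed

lemma sharp_eq:
  assumes "linear l"
  shows "sharp ip l = (\<Sum>i\<in>I. l (e i) *\<^sub>R e' i)"
  unfolding sharp_def
proof (rule the_equality)
  have "ip (\<Sum>i\<in>I. l (e i) *\<^sub>R e' i) y = l y" for y
    using linear_expand_e[OF assms, of y]
    by (simp add: linear_sum[OF linear_ip(2)] linear_scale[OF linear_ip(2)] ip_commute[of y] mult.commute)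
  then show *: "\<forall>y. ip (\<Sum>i\<in>I. l (e i) *\<^sub>R e' i) y = l y" by blast
  fix x assume "\<forall>y. ip x y = l y"
  then show "x = (\<Sum>i\<in>I. l (e i) *\<^sub>R e' i)"
    using * by (intro ip_eqI) simp
qed

lemma ip_sharp: "linear l \<Longrightarrow> ip (sharp ip l) y = l y"
  using linear_expand_e[of l y]
  by (simp add: sharp_eq linear_sum[OF linear_ip(2)] linear_scale[OF linear_ip(2)] ip_commute[of y] mult.commute)

lemma ip_cyclic: "ip z (br x y) = ip x (br y z)"
  using ip_invariant[of y x z] by (simp add: br_swap[of x y] linear_neg[OF linear_ip(1)] ip_commute[of z])

text \<open>Contracts the structure constants with \<open>x\<close> and \<open>y\<close> expanded in
  the \<open>e i\<close>. One such sum for each permutation of three vectors occurs in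
  \<open>bracket_pi_pi\<close>.\<close>

lemma ip_triple: "(\<Sum>i\<in>I. \<Sum>j\<in>I. ip x (e' i) * (ip y (e' j) * ip (br (e i) (e j)) z)) = ip x (br y z)"
proof -
  have lin: "linear (\<lambda>v. ip (br u v) z)" "linear (\<lambda>v. ip (br v u) z)" for u
    using linear_compose[OF linear_br(1) linear_ip(2)] linear_compose[OF linear_br(2) linear_ip(2)]
    by (auto simp: o_def)
  have "(\<Sum>i\<in>I. \<Sum>j\<in>I. ip x (e' i) * (ip y (e' j) * ip (br (e i) (e j)) z))
    = (\<Sum>i\<in>I. ip x (e' i) *\<^sub>R (\<Sum>j\<in>I. ip y (e' j) *\<^sub>R ip (br (e i) (e j)) z))"
    by (simp add: sum_distrib_left)
  also have "\<dots> = ip (br x y) z"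
    by (simp only: linear_expand_e[OF lin(1)] linear_expand_e[OF lin(2)])
  finally show ?thesis by (simp add: ip_cyclic[of z] ip_commute[of _ z])
qed

end

section \<open>Quasi-Poisson manifolds\<close>

lemma plug_wdg_homogeneous_1:
  fixes X Y :: "'v list \<Rightarrow> 'c::{comm_ring_1,real_algebra_1}"
  assumes "homogeneous 1 X"
  shows "plug f (wdg X F) = scl (X [f]) F - wdg X (plug f F)"
  by (simp add: plug_wdg plug_homogeneous_1[OF assms] twist_homogeneous_1[OF assms])

text \<open>The right-hand side is the 3 by 3 determinant of the values.\<close>

lemma wdg_triple:
  fixes X Y Z :: "'c list \<Rightarrow> 'c::{comm_ring_1,real_algebra_1}"
  assumes X: "homogeneous 1 X" and Y: "homogeneous 1 Y" and Z: "homogeneous 1 Z"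
  shows "wdg X (wdg Y Z) [f, g, h] = X [f] * (Y [g] * Z [h]) - X [f] * (Y [h] * Z [g])
    + X [g] * (Y [h] * Z [f]) - X [g] * (Y [f] * Z [h])
    + X [h] * (Y [f] * Z [g]) - X [h] * (Y [g] * Z [f])"
proof -
  have 1: "wdg U F (f # fs) = U [f] * F fs - wdg U (plug f F) fs" if "homogeneous 1 U" for U F :: "'c list \<Rightarrow> 'c" and f fs
    using fun_cong[OF plug_wdg_homogeneous_1[OF that, of f F], of fs] by simp
  have nil: "U [] = 0" if "homogeneous 1 U" for U :: "'c list \<Rightarrow> 'c"
    using that by (simp add: homogeneous_def)
  show ?thesis
    by (simp add: 1[OF X] 1[OF Y] plug_wdg_homogeneous_1[OF Y] plug_homogeneous_1[OF Z] plug_homogeneous_1[OF Y]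
      nil[OF X] nil[OF Y] nil[OF Z] algebra_simps)
qed

locale quasi_poisson = manifold A + quadratic_lie br ip I e e'
  for A :: "('a::{t2_space, second_countable_topology}, 'b::real_normed_vector) chart set"
    and br :: "'g::real_vector \<Rightarrow> 'g \<Rightarrow> 'g" and ip I and e e' :: "'i \<Rightarrow> 'g" +
  fixes \<rho> :: "'a \<Rightarrow> 'g \<Rightarrow> 'a tangent" and \<pi> :: "'a mvfield"
  assumes qp: "quasi_poisson_manifold A br ip \<rho> \<pi>"
begin

definition fundamental :: "'g \<Rightarrow> ('a \<Rightarrow> real) list \<Rightarrow> 'a \<Rightarrow> real" where
  "fundamental x fs = (\<lambda>p. if length fs = 1 then \<rho> p x (hd fs) else 0)"

lemma rho_tangent: "\<rho> p x \<in> tangent_space A p"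
  and linear_rho: "linear (\<rho> p)"
  and rho_smooth: "f \<in> C \<Longrightarrow> (\<lambda>p. \<rho> p x f) \<in> C"
  and rho_br: "f \<in> C \<Longrightarrow> \<rho> p (br x y) f = \<rho> p x (\<lambda>q. \<rho> q y f) - \<rho> p y (\<lambda>q. \<rho> q x f)"
  using qp unfolding quasi_poisson_manifold_def lie_algebra_action_def by blast+

lemma pi_mem: "\<pi> \<in> mv_fields A 2"
  and pi_schouten: "schouten A 2 2 \<pi> \<pi> = anchor_ext A \<rho> (cartan_trivector br ip)"
  and pi_invariant: "schouten A 2 1 \<pi> (action_field A \<rho> x) = 0"
  using qp unfolding quasi_poisson_manifold_def by blast+

lemma fundamental_single [simp]: "fundamental x [f] = (\<lambda>p. \<rho> p x f)"
  by (simp add: fundamental_def)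

lemma linear_rho_apply: "linear (\<lambda>x. \<rho> p x f)"
  using linear_rho[of p] by (auto simp: linear_iff fun_eq_iff)

lemma linear_fundamental: "linear fundamental"
  by (intro linearI) (auto simp: fundamental_def fun_eq_iff linear_add[OF linear_rho_apply]
    linear_scale[OF linear_rho_apply])

lemma mv_eval_action_field: "mv_eval A (action_field A \<rho> x) = fundamental x"
proof (rule ext, rule ext)
  fix fs p
  show "mv_eval A (action_field A \<rho> x) fs p = fundamental x fs p"
    using dif_mem[of p] rho_tangent[of p x]
    by (cases fs) (auto simp: mv_eval_def action_field_def vector_field_def fundamental_def differential_def[of A p "hd fs"]
      differential_def)
qed

lemma action_field_outside: "\<not> set as \<subseteq> ctg p \<Longrightarrow> action_field A \<rho> x p as = 0"
  by (simp add: action_field_def vector_field_def)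

lemma homogeneous_fundamental: "homogeneous 1 (fundamental x)"
  by (auto simp: homogeneous_def fundamental_def fun_eq_iff)

lemma plug_fundamental: "plug f (fundamental x) = scl (\<lambda>p. \<rho> p x f) unit_list"
  by (auto simp: fun_eq_iff fundamental_def unit_list_def)

lemma multider_fundamental: "multider 1 (fundamental x)"
proof (rule mderI)
  have unit: "plug g (unit_list :: ('a \<Rightarrow> real) list \<Rightarrow> _) = (0 :: ('a \<Rightarrow> real) list \<Rightarrow> 'a \<Rightarrow> real)" for g
    by (auto simp: fun_eq_iff unit_list_def)
  have r: "\<rho> p x f = 0" if "f \<notin> C" for p f
    using tangent_out[OF rho_tangent that] .
  have add: "\<rho> p x (f + g) = \<rho> p x f + \<rho> p x g" if "f \<in> C" "g \<in> C" for p f g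
    using tangent_linear[OF rho_tangent that, of p x 1 1] by simp
  have scale: "\<rho> p x (c *\<^sub>R f) = c * \<rho> p x f" if "f \<in> C" for p f c
    using tangent_linear[OF rho_tangent that that, of p x c 0] by simp
  note mult = tangent_mult[OF rho_tangent]
  have nil: "fundamental x [] = 0" by (simp add: fundamental_def fun_eq_iff)
  show "front_der 1 (fundamental x)"
    unfolding front_der_def plug_fundamental plug_simps unit
    by (intro conjI allI ballI impI)
      (simp_all add: nil zero_closed r add scale mult, simp_all add: fun_eq_iff algebra_simps)
  have "multider 0 (plug f (fundamental x))" for f
  proof (cases "f \<in> C")
    case True
    then show ?thesis unfolding plug_fundamental by (intro multider_scl multider_unit rho_smooth)
  next
    case False
    then have "plug f (fundamental x) = 0"
      by (auto simp: fun_eq_iff plug_fundamental r)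
    then show ?thesis by (simp add: multider_zero)
  qed
  moreover have "multider 0 = multider (Suc 1)" by (rule multider_parity_cong) simp
  ultimately show "multider (Suc 1) (plug f (fundamental x))" for f by simp
qed

lemma eq_single:
  fixes F G :: "('a \<Rightarrow> real) list \<Rightarrow> 'a \<Rightarrow> real"
  assumes "homogeneous 1 F" "homogeneous 1 G" "\<And>f. F [f] = G [f]"
  shows "F = G"
proof
  fix fs show "F fs = G fs"
  proof (cases "length fs = 1")
    case True
    then obtain f where "fs = [f]" by (auto simp: length_Suc_conv)
    then show ?thesis using assms(3) by simp
  next
    case False
    then show ?thesis using assms(1,2) by (auto simp: homogeneous_def)
  qed
qed

lemma lie_fundamental: "lie (fundamental x) (fundamental y) = fundamental (br x y)"
proof (rule eq_single[OF _ homogeneous_fundamental])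
  show "homogeneous 1 (lie (fundamental x) (fundamental y))"
    using homogeneous_bracket[OF multider_fundamental multider_fundamental homogeneous_fundamental homogeneous_fundamental, of x y]
    by (simp add: bracket_1)
  fix f
  show "lie (fundamental x) (fundamental y) [f] = fundamental (br x y) [f]"
  proof (cases "f \<in> C")
    case True
    have "lie (fundamental x) (fundamental y) [f]
      = fundamental x [fundamental y [f]] - fundamental y [fundamental x [f]]"
      using bracket_single[OF multider_fundamental multider_fundamental, of x y f]
        multider_double_odd[OF multider_fundamental]
      unfolding bracket_1 by simp
    then show ?thesis using rho_br[OF True] by (simp add: fun_eq_iff)
  next
    case False
    \<comment> \<open>The axiom for the action concerns smooth functions only; on others both sides
      vanish.\<close>
    have "plug f (lie (fundamental x) (fundamental y)) = 0"
      by (rule multider_plug_out[OF multider_lie[OF multider_fundamental multider_fundamental] False])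
    from fun_cong[OF this, of "[]"] show ?thesis
      using tangent_out[OF rho_tangent False] by (simp add: fun_eq_iff)
  qed
qed

lemma mv_eval_schouten:
  assumes "multider p (mv_eval A P)" "multider q (mv_eval A Q)"
  shows "mv_eval A (schouten A p q P Q) = bracket p q (mv_eval A P) (mv_eval A Q)"
  unfolding schouten_eq by (rule mv_eval_mv_of[OF multider_bracket[OF assms]])

text \<open>The value of \<open>mu_rho\<close> on the differential of \<open>f\<close> at
  \<open>p\<close>, see \<open>mu_rho_dif\<close>.\<close>

definition moment :: "'a \<Rightarrow> ('a \<Rightarrow> real) \<Rightarrow> 'g" where
  "moment p f = sharp ip (\<lambda>x. \<rho> p x f)"

lemma moment_eq: "moment p f = (\<Sum>i\<in>I. \<rho> p (e i) f *\<^sub>R e' i)"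
  unfolding moment_def by (rule sharp_eq[OF linear_rho_apply])

lemma ip_moment: "\<rho> p x f = ip (moment p f) x"
  unfolding moment_def by (rule ip_sharp[OF linear_rho_apply, symmetric])

lemma anchor_transpose_dif: "anchor_transpose \<rho> p (dif p f) = (\<lambda>x. \<rho> p x f)"
  using rho_tangent by (auto simp: anchor_transpose_def differential_def)

text \<open>On three functions the right-hand side becomes six sums, each equal to the triple
  product of the three moments by cyclicity and skew symmetry. Together they give 6/12 of it, which
  is the 1/2 in \<open>cartan_trivector\<close>.\<close>

lemma bracket_pi_pi:
  "bracket 2 2 (mv_eval A \<pi>) (mv_eval A \<pi>) = (1/12) *\<^sub>R (\<Sum>i\<in>I. \<Sum>j\<in>I.
    wdg (fundamental (e' i)) (wdg (fundamental (e' j)) (fundamental (br (e i) (e j)))))"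
  (is "?L = ?R")
proof
  note m = multider_mv_eval[OF pi_mem] and h = homogeneous_mv_eval[OF pi_mem]
  fix fs show "?L fs = ?R fs"
  proof (cases "length fs = 3")
    case False
    have "homogeneous 3 ?L"
      using homogeneous_bracket[OF m m h h] by simp
    moreover have "homogeneous (1 + (1 + 1)) ?R"
      by (intro homogeneous_scaleR homogeneous_sum homogeneous_wdg homogeneous_fundamental)
    ultimately show ?thesis using False by (simp add: homogeneous_def)
  next
    case True
    then obtain f g h where fs: "fs = [f, g, h]"
      by (auto simp: length_Suc_conv numeral_3_eq_3)
    show ?thesis
    proof
      fix p
      let ?x = "moment p f" and ?y = "moment p g" and ?z = "moment p h"
      have "?L fs p = mv_eval A (anchor_ext A \<rho> (cartan_trivector br ip)) fs p"
        using mv_eval_schouten[OF m m] by (simp add: pi_schouten)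
      also have "\<dots> = ip ?x (br ?y ?z) / 2"
        using dif_mem[of p] linear_rho_apply[of p]
        by (simp add: fs mv_eval_def anchor_ext_def cartan_trivector_def anchor_transpose_dif moment_def)
      finally have L: "?L fs p = ip ?x (br ?y ?z) / 2" .
      let ?t = "\<lambda>x y z. \<Sum>i\<in>I. \<Sum>j\<in>I. ip x (e' i) * (ip y (e' j) * ip z (br (e i) (e j)))"
      have t: "?t x y z = ip x (br y z)" for x y z
        using ip_triple[of x y z] by (simp only: ip_commute[of "br _ _"])
      have s: "ip x (br z y) = - ip x (br y z)" for x y z
        by (simp add: br_swap[of z y] linear_neg[OF linear_ip(1)])
      have sum2: "(\<Sum>i\<in>I. \<Sum>j\<in>I. F i j) fs p = (\<Sum>i\<in>I. \<Sum>j\<in>I. F i j fs p)"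
        for F :: "'i \<Rightarrow> 'i \<Rightarrow> ('a \<Rightarrow> real) list \<Rightarrow> 'a \<Rightarrow> real"
      proof -
        have 1: "sum G S fs p = (\<Sum>i\<in>S. G i fs p)" for G :: "'i \<Rightarrow> ('a \<Rightarrow> real) list \<Rightarrow> 'a \<Rightarrow> real" and S
          by (induction S rule: infinite_finite_induct) simp_all
        show ?thesis by (simp only: 1)
      qed
      have "?R fs p = (1/12) * (?t ?x ?y ?z - ?t ?x ?z ?y + ?t ?y ?z ?x - ?t ?y ?x ?z + ?t ?z ?x ?y - ?t ?z ?y ?x)"
        unfolding scaleR_fun_apply sum2 unfolding fs wdg_triple[OF homogeneous_fundamental homogeneous_fundamental homogeneous_fundamental]
        by (simp add: ip_moment sum.distrib sum_subtractf)
      also have "\<dots> = (1/12) * (6 * ip ?x (br ?y ?z))"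
        using s[of ?x ?z ?y] ip_cyclic[of ?y ?z ?x] s[of ?y ?x ?z] ip_cyclic[of ?z ?x ?y] s[of ?z ?y ?x]
        unfolding t by simp
      finally show "?L fs p = ?R fs p" using L by simp
    qed
  qed
qed

lemma bracket_pi_fundamental: "bracket 2 1 (mv_eval A \<pi>) (fundamental x) = 0"
proof -
  have "mv_eval A (schouten A 2 1 \<pi> (action_field A \<rho> x)) = bracket 2 1 (mv_eval A \<pi>) (fundamental x)"
    using mv_eval_schouten[OF multider_mv_eval[OF pi_mem], of 1 "action_field A \<rho> x"] multider_fundamental
    by (simp add: mv_eval_action_field)
  moreover have "mv_eval A 0 = 0"
    by (intro ext) (simp add: mv_eval_def)
  ultimately show ?thesis unfolding pi_invariant by simp
qed

end

sublocale quasi_poisson \<subseteq> alg: quasi_poisson_algebra "smooth_functions A" br ip I e e' fundamental "mv_eval A \<pi>"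
  by unfold_locales
    (rule linear_add[OF linear_fundamental] linear_scale[OF linear_fundamental] multider_fundamental homogeneous_fundamental lie_fundamental
      multider_mv_eval[OF pi_mem] bracket_pi_fundamental bracket_pi_pi)+

section \<open>Transfer to multivector fields\<close>

context quasi_poisson begin

abbreviation "D \<equiv> quasi_poisson_differential A \<rho> \<pi> I e e'"

lemma D_eq:
  assumes m: "multider k (mv_eval A P)"
  shows "D k P = mv_of A (alg.qp_diff k (mv_eval A P))"
proof -
  have "mv_wedge (action_field A \<rho> x) (schouten A 1 k (action_field A \<rho> y) P) =
    mv_of A (wdg (fundamental x) (lie (fundamental y) (mv_eval A P)))" for x y
  proof -
    have "mv_eval A (schouten A 1 k (action_field A \<rho> y) P) = lie (fundamental y) (mv_eval A P)"
      using mv_eval_schouten[of 1 "action_field A \<rho> y", OF _ m] multider_fundamental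
      by (simp add: mv_eval_action_field bracket_1)
    then show ?thesis
      using mv_wedge_eq[of "action_field A \<rho> x" "schouten A 1 k (action_field A \<rho> y) P"]
      by (simp add: action_field_outside schouten_eq mv_of_outside mv_eval_action_field)
  qed
  then show ?thesis
    by (simp add: quasi_poisson_differential_def alg.qp_diff_def mv_of_simps mv_of_sum schouten_eq)
qed

lemma mv_eval_D: "multider k (mv_eval A P) \<Longrightarrow> mv_eval A (D k P) = alg.qp_diff k (mv_eval A P)"
  by (simp only: D_eq mv_eval_mv_of[OF alg.multider_diff_op])

lemma homogeneous_lie:
  assumes "multider k F" "homogeneous l F"
  shows "homogeneous l (lie (fundamental x) F)"
  using homogeneous_bracket[OF multider_fundamental assms(1) homogeneous_fundamental assms(2), of x] by (simp add: bracket_1)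

lemma homogeneous_diff_op:
  assumes "multider k F" "homogeneous (int k) F"
  shows "homogeneous (int (k + 1)) (alg.qp_diff k F)"
proof -
  have "homogeneous (2 + int k - 1) (bracket 2 k (mv_eval A \<pi>) F)"
    using homogeneous_bracket[OF multider_mv_eval[OF pi_mem] assms(1) _ assms(2), of 2] homogeneous_mv_eval[OF pi_mem] by simp
  moreover have "homogeneous (1 + int k) (wdg (fundamental x) (lie (fundamental y) F))" for x y
    by (intro homogeneous_wdg homogeneous_fundamental homogeneous_lie[OF assms])
  ultimately show ?thesis
    unfolding alg.qp_diff_def by (intro homogeneous_add homogeneous_scaleR homogeneous_sum) (simp_all add: add.commute)
qed

lemma mv_eval_linear: "mv_eval A (a *\<^sub>R P + b *\<^sub>R Q) = a *\<^sub>R mv_eval A P + b *\<^sub>R mv_eval A Q"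
  by (auto simp: mv_eval_def fun_eq_iff)

lemma diff_linear:
  assumes P: "multider k P" and Q: "multider k Q"
  shows "alg.qp_diff k (a *\<^sub>R P + b *\<^sub>R Q) = a *\<^sub>R alg.qp_diff k P + b *\<^sub>R alg.qp_diff k Q"
  unfolding alg.qp_diff_def
  by (simp add: bracket_add_right[OF alg.multider_pi multider_scaleR[OF P] multider_scaleR[OF Q]]
      bracket_scaleR_right[OF alg.multider_pi P] bracket_scaleR_right[OF alg.multider_pi Q]
      lie_add_right[OF multider_fundamental multider_scaleR[OF P] multider_scaleR[OF Q]]
      lie_scaleR_right[OF multider_fundamental P] lie_scaleR_right[OF multider_fundamental Q]
      sum.distrib scaleR_add_right scaleR_sum_right mult.commute add.commute add.left_commute)

theorem lie_algebroid: "lie_algebroid_differential (mv_fields A) mv_wedge D"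
  unfolding lie_algebroid_differential_def
proof (intro conjI allI ballI)
  fix k P assume P: "P \<in> mv_fields A k"
  note m = multider_mv_eval[OF P]
  show "D k P \<in> mv_fields A (k + 1)"
    unfolding D_eq[OF m] by (rule mv_of_mem[OF alg.multider_diff_op[OF m] homogeneous_diff_op[OF m homogeneous_mv_eval[OF P]]])
  have "D (k + 1) (D k P) = mv_of A (alg.qp_diff (k + 1) (alg.qp_diff k (mv_eval A P)))"
    using alg.multider_diff_op[OF m] by (subst D_eq) (simp_all only: mv_eval_D[OF m])
  then show "D (k + 1) (D k P) = 0"
    by (simp only: alg.diff_diff[OF m] mv_of_simps)
next
  fix k P Q a b assume P: "P \<in> mv_fields A k" and Q: "Q \<in> mv_fields A k"
  note mP = multider_mv_eval[OF P] and mQ = multider_mv_eval[OF Q]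
  have "multider k (mv_eval A (a *\<^sub>R P + b *\<^sub>R Q))"
    unfolding mv_eval_linear by (intro multider_add multider_scaleR mP mQ)
  then show "D k (a *\<^sub>R P + b *\<^sub>R Q) = a *\<^sub>R D k P + b *\<^sub>R D k Q"
    by (simp only: D_eq mP mQ mv_eval_linear diff_linear[OF mP mQ] mv_of_simps)
next
  fix k l P Q assume P: "P \<in> mv_fields A k" and Q: "Q \<in> mv_fields A l"
  note mP = multider_mv_eval[OF P] and mQ = multider_mv_eval[OF Q]
  note out = mv_fields_outside[OF P] mv_fields_outside[OF Q]
  have PQ: "mv_wedge P Q = mv_of A (wdg (mv_eval A P) (mv_eval A Q))"
    by (rule mv_wedge_eq[OF out])
  then have ev: "mv_eval A (mv_wedge P Q) = wdg (mv_eval A P) (mv_eval A Q)"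
    using mv_eval_mv_of[OF multider_wdg[OF mP mQ]] by simp
  have "D (k + l) (mv_wedge P Q) = mv_of A (alg.qp_diff (k + l) (wdg (mv_eval A P) (mv_eval A Q)))"
    using multider_wdg[OF mP mQ] by (subst D_eq) (simp_all only: ev)
  also have "\<dots> = mv_of A (wdg (mv_eval A (D k P)) (mv_eval A Q))
      + (-1) ^ k *\<^sub>R mv_of A (wdg (mv_eval A P) (mv_eval A (D l Q)))"
    by (simp only: alg.diff_wdg[OF mP mQ] mv_of_simps mv_eval_D[OF mP] mv_eval_D[OF mQ])
  also have "mv_of A (wdg (mv_eval A (D k P)) (mv_eval A Q)) = mv_wedge (D k P) Q"
    by (rule mv_wedge_eq[symmetric]) (simp_all add: D_eq[OF mP] mv_of_outside out)
  also have "mv_of A (wdg (mv_eval A P) (mv_eval A (D l Q))) = mv_wedge P (D l Q)"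
    by (rule mv_wedge_eq[symmetric]) (simp_all add: D_eq[OF mQ] mv_of_outside out)
  finally show "D (k + l) (mv_wedge P Q) = mv_wedge (D k P) Q + (-1) ^ k *\<^sub>R mv_wedge P (D l Q)" .
qed

text \<open>Each use of \<open>plug_lie\<close> splits off the term in which the first argument is
  differentiated; together these form the sum in \<open>lie_derivative\<close>.\<close>

lemma lie_apply:
  assumes "multider k F"
  shows "lie (fundamental x) F fs p =
    \<rho> p x (F fs) - (\<Sum>i<length fs. F (fs[i := (\<lambda>q. \<rho> q x (fs ! i))]) p)"
  using assms
proof (induction fs arbitrary: k F)
  case Nil
  have "fundamental x [] = 0" by (simp add: fundamental_def fun_eq_iff)
  moreover have "F [0] = 0"
    using multider_zero_entry[OF Nil, of 0 "[]" "[]"] by simp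
  ultimately have "lie (fundamental x) F [] p = \<rho> p x (F []) - (\<Sum>i<length []. F ([][i := (\<lambda>q. \<rho> q x ([] ! i))]) p)"
    by (simp add: lie_def bracket_Nil)
  then show ?case .
next
  case (Cons f fs)
  have IH: "lie (fundamental x) (plug f F) fs p =
    \<rho> p x (plug f F fs) - (\<Sum>i<length fs. plug f F (fs[i := (\<lambda>q. \<rho> q x (fs ! i))]) p)"
    by (rule Cons.IH[OF multider_plug[OF Cons.prems]])
  have "lie (fundamental x) F (f # fs) p
    = lie (fundamental x) (plug f F) fs p - F ((\<lambda>q. \<rho> q x f) # fs) p"
    using fun_cong[OF fun_cong[OF plug_lie[OF multider_fundamental homogeneous_fundamental Cons.prems, of f x]], of fs p]
    by (simp only: plug_apply minus_apply fundamental_single)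
  also have "\<dots> = \<rho> p x (F (f # fs)) - (\<Sum>i<length (f # fs). F ((f # fs)[i := (\<lambda>q. \<rho> q x ((f # fs) ! i))]) p)"
    unfolding IH by (simp add: sum.lessThan_Suc_shift del: sum.lessThan_Suc)
  finally show ?case .
qed

lemma lie_derivative_eq:
  assumes "multider k (mv_eval A P)"
  shows "lie_derivative A (\<lambda>p. \<rho> p x) P = mv_of A (lie (fundamental x) (mv_eval A P))"
  unfolding lie_derivative_def
  by (rule arg_cong[of _ _ "mv_of A"]) (intro ext, simp only: lie_apply[OF assms])

theorem preserves: "action_preserves A \<rho> D"
  unfolding action_preserves_def
proof (intro allI ballI)
  fix x k P assume "P \<in> mv_fields A k"
  note m = multider_mv_eval[OF this]
  have ml: "multider k (lie (fundamental x) (mv_eval A P))" by (rule multider_lie[OF multider_fundamental m])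
  have ev: "mv_eval A (lie_derivative A (\<lambda>p. \<rho> p x) P) = lie (fundamental x) (mv_eval A P)"
    by (simp only: lie_derivative_eq[OF m] mv_eval_mv_of[OF ml])
  have "D k (lie_derivative A (\<lambda>p. \<rho> p x) P) = mv_of A (alg.qp_diff k (lie (fundamental x) (mv_eval A P)))"
    using ml by (subst D_eq) (simp_all only: ev)
  also have "\<dots> = mv_of A (lie (fundamental x) (mv_eval A (D k P)))"
    by (simp only: alg.diff_lie_R[OF m] mv_eval_D[OF m])
  also have "\<dots> = lie_derivative A (\<lambda>p. \<rho> p x) (D k P)"
    by (rule lie_derivative_eq[symmetric, of "k + 1"]) (simp only: mv_eval_D[OF m] alg.multider_diff_op[OF m])
  finally show "D k (lie_derivative A (\<lambda>p. \<rho> p x) P) = lie_derivative A (\<lambda>p. \<rho> p x) (D k P)" .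
qed

text \<open>At a point the coefficients are numbers, so linearity gathers them into the vector
  \<open>moment p f\<close>.\<close>

lemma pull_apply: "multilin w \<Longrightarrow> alg.pull w fs p = w (map (moment p) fs)"
proof (induction fs arbitrary: w)
  case Nil
  have "(of_real c :: 'a \<Rightarrow> real) p = c" for c
    by (simp add: of_real_def)
  then have "alg.pull w [] p = w (map (moment p) [])" by simp
  then show ?case .
next
  case (Cons f fs)
  have IH: "alg.pull (plug (e' i) w) fs p = plug (e' i) w (map (moment p) fs)" for i
    by (rule Cons.IH[OF multilin_plug[OF Cons.prems]])
  have s: "(\<Sum>i\<in>S. G i) p = (\<Sum>i\<in>S. G i p)" for G :: "'i \<Rightarrow> 'a \<Rightarrow> real" and S
    by (induction S rule: infinite_finite_induct) simp_all
  have lin: "linear (\<lambda>x. w (x # vs))" for vs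
    using multilin_linear[OF Cons.prems] by (auto simp: linear_iff fun_eq_iff)
  have "alg.pull w (f # fs) p = (\<Sum>i\<in>I. \<rho> p (e i) f * w (e' i # map (moment p) fs))"
    unfolding alg.pull_Cons s times_fun_apply IH by simp
  also have "\<dots> = w (map (moment p) (f # fs))"
    by (simp add: moment_eq[of p f] linear_sum[OF lin] linear_scale[OF lin])
  finally show ?case .
qed

lemma mu_rho_dif: "mu_rho ip \<rho> (p, dif p f) = moment p f"
  by (simp add: mu_rho_def rho_star_def anchor_transpose_dif moment_def)

lemma pullback_form_eq:
  assumes "multilin w"
  shows "pullback_form A (mu_rho ip \<rho>) w = mv_of A (alg.pull w)"
proof (rule ext, rule ext)
  fix p as
  have "map (\<lambda>a. mu_rho ip \<rho> (p, a)) as = map (moment p) (map (rep p) as)" if "set as \<subseteq> ctg p"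
  proof -
    have "mu_rho ip \<rho> (p, a) = moment p (rep p a)" if "a \<in> ctg p" for a
      using mu_rho_dif[of p "rep p a"] rep[OF that] by simp
    then show ?thesis using that by auto
  qed
  then show "pullback_form A (mu_rho ip \<rho>) w p as = mv_of A (alg.pull w) p as"
    by (simp add: pullback_form_def mv_of_eq pull_apply[OF assms] del: map_map)
qed

theorem morphism: "lie_algebroid_morphism A D br (mu_rho ip \<rho>)"
  unfolding lie_algebroid_morphism_def
proof (intro conjI allI ballI)
  fix p a b s t assume "a \<in> ctg p" "b \<in> ctg p"
  then obtain f g where fg: "f \<in> C" "g \<in> C" "a = dif p f" "b = dif p g"
    by (auto simp: cotangent_space_def)
  have "moment p (s *\<^sub>R f + t *\<^sub>R g) = s *\<^sub>R moment p f + t *\<^sub>R moment p g"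
    by (simp add: moment_eq tangent_linear[OF rho_tangent fg(1,2)] scaleR_add_left sum.distrib
      scaleR_sum_right)
  then show "mu_rho ip \<rho> (p, s *\<^sub>R a + t *\<^sub>R b) = s *\<^sub>R mu_rho ip \<rho> (p, a) + t *\<^sub>R mu_rho ip \<rho> (p, b)"
    unfolding fg(3,4) dif_linear[OF fg(1,2), symmetric] mu_rho_dif .
next
  fix k and w :: "'g list \<Rightarrow> real" assume "w \<in> alt_forms UNIV k"
  note w = alternating_alt_forms[OF this]
  note m = alg.multider_pull[OF w(1) homogeneous_parity[OF w(2)]]
  have eq: "pullback_form A (mu_rho ip \<rho>) w = mv_of A (alg.pull w)"
    by (rule pullback_form_eq[OF alternating_multilin[OF w(1)]])
  show "pullback_form A (mu_rho ip \<rho>) w \<in> mv_fields A k"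
    unfolding eq by (rule mv_of_mem[OF m alg.homogeneous_pull[OF w(2)]])
  have "D k (mv_of A (alg.pull w)) = mv_of A (alg.qp_diff k (alg.pull w))"
    using m by (subst D_eq) (simp_all only: mv_eval_mv_of[OF m])
  then show "D k (pullback_form A (mu_rho ip \<rho>) w) = pullback_form A (mu_rho ip \<rho>) (ce_differential br w)"
    by (simp only: eq alg.diff_pull[OF w] ce_differential_eq[OF w(1)]
      pullback_form_eq[OF multilin_ce_sum[OF w(1)]])
qed

end

theorem theorem1:
  fixes A :: "('a::{t2_space, second_countable_topology}, 'b::real_normed_vector) chart set"
    and br :: "'g::real_vector \<Rightarrow> 'g \<Rightarrow> 'g"
    and ip :: "'g \<Rightarrow> 'g \<Rightarrow> real"
    and \<rho> :: "'a \<Rightarrow> 'g \<Rightarrow> 'a tangent"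
    and \<pi> :: "'a mvfield"
    and I :: "'i set"
    and e e' :: "'i \<Rightarrow> 'g"
  assumes "quadratic_lie_algebra br ip"
    and "quasi_poisson_manifold A br ip \<rho> \<pi>"
    and "dual_bases ip I e e'"
  shows "lie_algebroid_differential (mv_fields A) mv_wedge (quasi_poisson_differential A \<rho> \<pi> I e e') \<and>
    action_preserves A \<rho> (quasi_poisson_differential A \<rho> \<pi> I e e') \<and>
    lie_algebroid_morphism A (quasi_poisson_differential A \<rho> \<pi> I e e') br (mu_rho ip \<rho>)"
proof -
  have "smooth_manifold A"
    using assms(2) by (simp add: quasi_poisson_manifold_def)
  then interpret quasi_poisson A br ip I e e' \<rho> \<pi>
    by unfold_locales (use assms in auto)
  show ?thesis
    using lie_algebroid preserves morphism by blast
qed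

end
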